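(* Let $\mathcal S=\mathcal S(m)$ and let $\Omega=\Delta F(\det Q)^n$ be the super Pfaffian (a priori an element of the localisation $\mathcal S[\Delta^{-1}]$). Then $\Omega$ belongs to $\mathcal S^{\mathfrak{osp}(V)}$ (in particular to $\mathcal S$). It is even, homogeneous of degree $m(2n+1)$, and has leading term $\pi(\Omega)=\Delta^{2n+1}$. Furthermore, $g(\Omega)=\det(g)\,\Omega$ for all $g\in\mathrm{OSp}(V)_0$; hence $\Omega$ is a pseudo $\mathrm{OSp}(V)$-invariant.
   Context: Setting. Let $m\ge1$, $n\ge 0$ and let $V=V_{\bar0}\oplus V_{\bar1}=\mathbb C^{m|2n}$ be the complex superspace with standard basis $e_1,\dots,e_m$ (even), $e_{m+1},\dots,e_{m+2n}$ (odd), with the even non-degenerate supersymmetric bilinear form $(e_i,e_j)=\kappa_{ij}$, where $\kappa=\begin{pmatrix} I_m&0\\0&\eta\end{pmatrix}$, $\eta=\begin{pmatrix}0&I_n\\-I_n&0\end{pmatrix}$. $\mathfrak{osp}(V)\subset\mathfrak{gl}(V)$ is the Lie superalgebra preserving this form: it is spanned by homogeneous $Y$ with $(Yv,w)+(-1)^{[Y][v]}(v,Yw)=0$ for all homogeneous $v,w\in V$. $\mathrm{OSp}(V)$ is the Harish-Chandra super pair $(\mathrm{OSp}(V)_0,\mathfrak{osp}(V))$ with $\mathrm{OSp}(V)_0=\mathrm O(V_{\bar0})\times\mathrm{Sp}(V_{\bar1})$; $\det(g)\in\{\pm1\}$ is the determinant of $g\in\mathrm{OSp}(V)_0$ on $V$.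 $\mathcal S(m)$ is the symmetric superalgebra of $V\otimes\mathbb C^m$ ($\mathbb C^m$ purely even, with basis $f_t$), i.e. the free supercommutative superalgebra on $X^a_t=e_a\otimes f_t$ ($1\le a\le m+2n$, $1\le t\le m$), with its grading in which all $X^a_t$ have degree $1$. Write $x^i_t=X^i_t$ for $i\le m$ (even generators) and $\theta^\mu_t=X^{m+\mu}_t$ (odd generators). $\mathrm{OSp}(V)_0$ and $\mathfrak{osp}(V)$ act on $\mathcal S(m)$ by automorphisms, respectively superderivations, extending the natural action on $V\otimes\mathbb C^m$. $\mathcal S^{\mathfrak{osp}(V)}$ is the subalgebra of elements annihilated by $\mathfrak{osp}(V)$. A pseudo $\mathrm{OSp}(V)$-invariant is an $f\in\mathcal S^{\mathfrak{osp}(V)}$ with $g(f)=\det(g)f$ for all $g\in\mathrm{OSp}(V)_0$. Definitions. $X=(x^i_j)_{1\le i,j\le m}$, $\Delta=\det X$; $q_{ts}=\sum_{a,b}X_t^a(\kappa^{-1})_{ab}X_s^b$ and $Q=(q_{ij})_{1\le i,j\le m}$. The leading term map $\pi$ is the algebra homomorphism from $\mathcal S$ to the polynomial algebra $\mathbb C[x^i_t]$ with $\pi(x^i_t)=x^i_t$, $\pi(\theta^\mu_t)=0$. Then $\det Q=\Delta^2+\zeta$ with $\zeta$ nilpotent, and one defines in $\mathcal S[\Delta^{-1}]$ $$F=\sqrt{1+\tfrac{\zeta}{\Delta^2}}=1+\sum_{k\ge1}\frac1{k!}\prod_{j=0}^{k-1}\Big(\frac12-j\Big)\Big(\frac{\zeta}{\Delta^2}\Big)^k,$$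 a finite sum, so that $F^2=\det Q/\Delta^2$. The super Pfaffian is $\Omega=\Delta F(\det Q)^n$. *)

theory Defs
  imports
    "HOL-Library.Poly_Mapping"
    "HOL-Computational_Algebra.Fraction_Field"
    "Jordan_Normal_Form.Determinant"
    "Jordan_Normal_Form.Gauss_Jordan_Elimination"
begin

section \<open>Grassmann algebras over a commutative ring\<close>

text \<open>
  An element of the Grassmann algebra over \<open>'r\<close> with linearly ordered set of generators \<open>'i\<close> is
  a finite sum of terms \<open>c\<^sub>A \<theta>\<^sub>A\<close>, where \<open>A\<close> is a finite set of generators and
  \<open>\<theta>\<^sub>A\<close> is the product of the \<open>\<theta>\<^sub>i\<close>, \<open>i \<in> A\<close>, in increasing order. It is
  represented by the function \<open>A \<mapsto> c\<^sub>A\<close>.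
\<close>

typedef (overloaded) ('i, 'r::zero) grassmann =
  "{f :: 'i set \<Rightarrow> 'r. finite {A. f A \<noteq> 0} \<and> (\<forall>A. f A \<noteq> 0 \<longrightarrow> finite A)}"
  morphisms coef Abs_grassmann
  by (rule exI[of _ "\<lambda>_. 0"]) auto

setup_lifting type_definition_grassmann

lemma grassmann_eqI: "(\<And>A. coef f A = coef g A) \<Longrightarrow> f = g"
  by (simp add: coef_inject [symmetric] fun_eq_iff)

lemma finite_coef: "finite {A. coef f A \<noteq> 0}"
  using coef [of f] by simp

lemma coef_infinite: "infinite A \<Longrightarrow> coef f A = 0"
  using coef [of f] by auto

definition inversions :: "'i::linorder set \<Rightarrow> 'i set \<Rightarrow> nat" where
  "inversions A B = card {(a, b). a \<in> A \<and> b \<in> B \<and> b < a}"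

text \<open>For disjoint \<open>A\<close>, \<open>B\<close>:
  \<open>\<theta>\<^sub>A \<theta>\<^sub>B = (-1) ^ inversions A B \<theta>\<^bsub>A \<union> B\<^esub>\<close>.\<close>

definition ksign :: "'i::linorder set \<Rightarrow> 'i set \<Rightarrow> 'r::ring_1" where
  "ksign A B = (- 1) ^ inversions A B"

lemma finite_inversions:
  "finite A \<Longrightarrow> finite B \<Longrightarrow> finite {(a, b). a \<in> A \<and> b \<in> B \<and> b < (a::'i::linorder)}"
  by (rule finite_subset [of _ "A \<times> B"]) auto

lemma inversions_Un_left:
  assumes "finite A" "finite B" "finite C" "A \<inter> B = {}"
  shows "inversions (A \<union> B) C = inversions A C + inversions B C"
proof -
  have "{(a, b). a \<in> A \<union> B \<and> b \<in> C \<and> b < a} =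
    {(a, b). a \<in> A \<and> b \<in> C \<and> b < a} \<union> {(a, b). a \<in> B \<and> b \<in> C \<and> b < a}" by auto
  then show ?thesis unfolding inversions_def
    using assms by (subst card_Un_disjoint [symmetric]) (auto simp: finite_inversions)
qed

lemma inversions_Un_right:
  assumes "finite A" "finite B" "finite C" "B \<inter> C = {}"
  shows "inversions A (B \<union> C) = inversions A B + inversions A C"
proof -
  have "{(a, b). a \<in> A \<and> b \<in> B \<union> C \<and> b < a} =
    {(a, b). a \<in> A \<and> b \<in> B \<and> b < a} \<union> {(a, b). a \<in> A \<and> b \<in> C \<and> b < a}" by auto
  then show ?thesis unfolding inversions_def
    using assms by (subst card_Un_disjoint [symmetric]) (auto simp: finite_inversions)
qed

lemma ksign_Un_left:
  "finite A \<Longrightarrow> finite B \<Longrightarrow> finite C \<Longrightarrow> A \<inter> B = {} \<Longrightarrow>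
    ksign (A \<union> B) C = ksign A C * ksign B C"
  by (simp add: ksign_def inversions_Un_left power_add)

lemma ksign_Un_right:
  "finite A \<Longrightarrow> finite B \<Longrightarrow> finite C \<Longrightarrow> B \<inter> C = {} \<Longrightarrow>
    ksign A (B \<union> C) = ksign A B * ksign A C"
  by (simp add: ksign_def inversions_Un_right power_add)

lemma ksign_empty [simp]: "ksign {} B = 1" "ksign A {} = 1"
  by (simp_all add: ksign_def inversions_def)

instantiation grassmann :: (type, zero) zero
begin
lift_definition zero_grassmann :: "('a, 'b) grassmann" is "\<lambda>_. 0" by simp
instance ..
end

instantiation grassmann :: (type, zero_neq_one) one
begin
lift_definition one_grassmann :: "('a, 'b) grassmann" is "\<lambda>A. if A = {} then 1 else 0" by auto
instance ..
end

instantiation grassmann :: (type, ab_group_add) ab_group_add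
begin

lift_definition plus_grassmann :: "('a, 'b) grassmann \<Rightarrow> ('a, 'b) grassmann \<Rightarrow> ('a, 'b) grassmann"
  is "\<lambda>f g A. f A + g A"
proof safe
  fix f g :: "'a set \<Rightarrow> 'b"
  assume "finite {A. f A \<noteq> 0}" "finite {A. g A \<noteq> 0}"
  then show "finite {A. f A + g A \<noteq> 0}"
    by (rule finite_subset [rotated, OF finite_UnI]) auto
next
  fix f g :: "'a set \<Rightarrow> 'b" and A
  assume "f A + g A \<noteq> 0" and "\<forall>A. f A \<noteq> 0 \<longrightarrow> finite A" "\<forall>A. g A \<noteq> 0 \<longrightarrow> finite A"
  then show "finite A" by (metis add.right_neutral)
qed

lift_definition uminus_grassmann :: "('a, 'b) grassmann \<Rightarrow> ('a, 'b) grassmann"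
  is "\<lambda>f A. - f A" by simp

definition minus_grassmann :: "('a, 'b) grassmann \<Rightarrow> ('a, 'b) grassmann \<Rightarrow> ('a, 'b) grassmann"
  where "minus_grassmann f g = f + - g"

instance
  by intro_classes
    (auto simp: minus_grassmann_def zero_grassmann.rep_eq plus_grassmann.rep_eq
      uminus_grassmann.rep_eq ac_simps intro!: grassmann_eqI)

end

instantiation grassmann :: (linorder, comm_ring_1) ring_1
begin

lift_definition times_grassmann :: "('a, 'b) grassmann \<Rightarrow> ('a, 'b) grassmann \<Rightarrow> ('a, 'b) grassmann"
  is "\<lambda>f g S. \<Sum>A\<in>Pow S. ksign A (S - A) * f A * g (S - A)"
proof safe
  fix f g :: "'a set \<Rightarrow> 'b"
  assume "finite {A. f A \<noteq> 0}" "finite {A. g A \<noteq> 0}"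
  then have fin: "finite ((\<lambda>(A, B). A \<union> B) ` ({A. f A \<noteq> 0} \<times> {A. g A \<noteq> 0}))" by simp
  have "\<exists>A. A \<subseteq> S \<and> f A \<noteq> 0 \<and> g (S - A) \<noteq> 0"
    if "(\<Sum>A\<in>Pow S. ksign A (S - A) * f A * g (S - A)) \<noteq> 0" for S
    using sum.not_neutral_contains_not_neutral [OF that] by (metis PowD mult_zero_left mult_zero_right)
  then have "{S. (\<Sum>A\<in>Pow S. ksign A (S - A) * f A * g (S - A)) \<noteq> 0}
      \<subseteq> (\<lambda>(A, B). A \<union> B) ` ({A. f A \<noteq> 0} \<times> {A. g A \<noteq> 0})"
    by (fastforce simp: image_iff)
  then show "finite {S. (\<Sum>A\<in>Pow S. ksign A (S - A) * f A * g (S - A)) \<noteq> 0}"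
    using fin finite_subset by blast
next
  fix f g :: "'a set \<Rightarrow> 'b" and S
  assume "(\<Sum>A\<in>Pow S. ksign A (S - A) * f A * g (S - A)) \<noteq> 0"
  then show "finite S" using finite_Pow_iff sum.infinite by metis
qed

lemma coef_times_aux1:
  fixes f g h :: "('a, 'b) grassmann"
  assumes S: "finite S"
  shows "coef (f * g * h) S = (\<Sum>(A, B)\<in>{(A, B). A \<subseteq> S \<and> B \<subseteq> S \<and> A \<inter> B = {}}.
    ksign A B * ksign A (S - A - B) * ksign B (S - A - B) * coef f A * coef g B * coef h (S - A - B))"
proof -
  have "coef (f * g * h) S = (\<Sum>T\<in>Pow S. \<Sum>A\<in>Pow T. ksign T (S - T) *
      (ksign A (T - A) * coef f A * coef g (T - A)) * coef h (S - T))"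
    by (simp add: times_grassmann.rep_eq sum_distrib_left sum_distrib_right)
  also have "\<dots> = (\<Sum>(T, A)\<in>Sigma (Pow S) Pow. ksign T (S - T) *
      (ksign A (T - A) * coef f A * coef g (T - A)) * coef h (S - T))"
    using S by (intro sum.Sigma) (auto intro: finite_subset)
  also have "\<dots> = (\<Sum>(A, B)\<in>{(A, B). A \<subseteq> S \<and> B \<subseteq> S \<and> A \<inter> B = {}}.
    ksign A B * ksign A (S - A - B) * ksign B (S - A - B) * coef f A * coef g B * coef h (S - A - B))"
  proof (rule sum.reindex_bij_witness [where i = "\<lambda>(A, B). (A \<union> B, A)" and j = "\<lambda>(T, A). (A, T - A)"],
      goal_cases)
    case (5 p)
    obtain T A where p: "p = (T, A)" by force
    with 5 have TA: "T \<subseteq> S" "A \<subseteq> T" by auto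
    then have T: "T = A \<union> (T - A)" and fin: "finite A" "finite (T - A)" "finite (S - T)"
      using S by (auto intro: finite_subset)
    have e: "S - A - (T - A) = S - T" using TA by auto
    have "(ksign T (S - T) :: 'b) = ksign A (S - T) * ksign (T - A) (S - T)"
      by (subst T, rule ksign_Un_left) (use fin in auto)
    then show ?case by (simp add: p e algebra_simps)
  qed auto
  finally show ?thesis .
qed

lemma coef_times_aux2:
  fixes f g h :: "('a, 'b) grassmann"
  assumes S: "finite S"
  shows "coef (f * (g * h)) S = (\<Sum>(A, B)\<in>{(A, B). A \<subseteq> S \<and> B \<subseteq> S \<and> A \<inter> B = {}}.
    ksign A B * ksign A (S - A - B) * ksign B (S - A - B) * coef f A * coef g B * coef h (S - A - B))"
proof -
  have "coef (f * (g * h)) S = (\<Sum>A\<in>Pow S. \<Sum>B\<in>Pow (S - A). ksign A (S - A) * coef f A *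
      (ksign B (S - A - B) * coef g B * coef h (S - A - B)))"
    by (simp add: times_grassmann.rep_eq sum_distrib_left)
  also have "\<dots> = (\<Sum>(A, B)\<in>Sigma (Pow S) (\<lambda>A. Pow (S - A)). ksign A (S - A) * coef f A *
      (ksign B (S - A - B) * coef g B * coef h (S - A - B)))"
    using S by (intro sum.Sigma) (auto intro: finite_subset)
  also have "\<dots> = (\<Sum>(A, B)\<in>{(A, B). A \<subseteq> S \<and> B \<subseteq> S \<and> A \<inter> B = {}}.
    ksign A B * ksign A (S - A - B) * ksign B (S - A - B) * coef f A * coef g B * coef h (S - A - B))"
  proof (rule sum.cong, goal_cases)
    case (2 p)
    obtain A B where p: "p = (A, B)" by force
    with 2 have AB: "A \<subseteq> S" "B \<subseteq> S" "A \<inter> B = {}" by auto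
    then have T: "S - A = B \<union> (S - A - B)" and fin: "finite A" "finite B" "finite (S - A - B)"
      using S by (auto intro: finite_subset)
    have "(ksign A (S - A) :: 'b) = ksign A B * ksign A (S - A - B)"
      by (subst T, rule ksign_Un_right) (use fin in auto)
    then show ?case by (simp add: p algebra_simps)
  qed auto
  finally show ?thesis .
qed

instance
proof
  fix f g h :: "('a, 'b) grassmann"
  show "f * g * h = f * (g * h)"
  proof (rule grassmann_eqI)
    fix S show "coef (f * g * h) S = coef (f * (g * h)) S"
      by (cases "finite S") (simp_all add: coef_infinite coef_times_aux1 coef_times_aux2)
  qed
  show "1 * f = f"
  proof (rule grassmann_eqI)
    fix S
    have "coef (1 * f) S = (\<Sum>A\<in>Pow S. if A = {} then coef f S else 0)"
      unfolding times_grassmann.rep_eq by (rule sum.cong) (auto simp: one_grassmann.rep_eq)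
    then show "coef (1 * f) S = coef f S"
      by (cases "finite S") (simp_all add: coef_infinite)
  qed
  show "f * 1 = f"
  proof (rule grassmann_eqI)
    fix S
    have "coef (f * 1) S = (\<Sum>A\<in>Pow S. if A = S then coef f S else 0)"
      unfolding times_grassmann.rep_eq by (rule sum.cong) (auto simp: one_grassmann.rep_eq)
    then show "coef (f * 1) S = coef f S"
      by (cases "finite S") (simp_all add: coef_infinite)
  qed
  show "(f + g) * h = f * h + g * h" "f * (g + h) = f * g + f * h"
    by (auto intro!: grassmann_eqI
        simp: times_grassmann.rep_eq plus_grassmann.rep_eq algebra_simps sum.distrib)
  have "coef (0 :: ('a, 'b) grassmann) {} \<noteq> coef 1 {}"
    by (simp add: zero_grassmann.rep_eq one_grassmann.rep_eq)
  then show "(0 :: ('a, 'b) grassmann) \<noteq> 1" by auto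
qed

end

lift_definition gconst :: "'r::zero \<Rightarrow> ('i, 'r) grassmann" is "\<lambda>c A. if A = {} then c else 0"
  by auto

lift_definition gtheta :: "'i \<Rightarrow> ('i, 'r::zero_neq_one) grassmann" is "\<lambda>v A. if A = {v} then 1 else 0"
  by auto

text \<open>Applying a map with \<open>\<phi> 0 = 0\<close> to all coefficients.\<close>

lift_definition gmap :: "('r::zero \<Rightarrow> 's::zero) \<Rightarrow> ('i, 'r) grassmann \<Rightarrow> ('i, 's) grassmann"
  is "\<lambda>\<phi> f A. if f A = 0 then 0 else \<phi> (f A)"
proof safe
  fix \<phi> :: "'r \<Rightarrow> 's" and f :: "'i set \<Rightarrow> 'r"
  assume "finite {A. f A \<noteq> 0}"
  then show "finite {A. (if f A = 0 then 0 else \<phi> (f A)) \<noteq> 0}"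
    by (rule finite_subset [rotated]) auto
qed (auto split: if_splits)

text \<open>The left derivative \<open>\<partial>/\<partial>\<theta>\<^sub>v\<close>: \<open>\<theta>\<^sub>v\<close> is moved to the front
  and then removed.\<close>

lift_definition gderiv :: "'i::linorder \<Rightarrow> ('i, 'r::ring_1) grassmann \<Rightarrow> ('i, 'r) grassmann"
  is "\<lambda>v f A. if v \<in> A then 0 else (- 1) ^ card {b \<in> A. b < v} * f (insert v A)"
proof safe
  fix v :: 'i and f :: "'i set \<Rightarrow> 'r"
  assume fin: "finite {A. f A \<noteq> 0}"
  have "{A. (if v \<in> A then 0 else (- 1) ^ card {b \<in> A. b < v} * f (insert v A)) \<noteq> 0}
      \<subseteq> (\<lambda>A. A - {v}) ` {A. f A \<noteq> 0}"
    by (auto simp: image_iff split: if_splits)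
  with fin show "finite {A. (if v \<in> A then 0 else (- 1) ^ card {b \<in> A. b < v} * f (insert v A)) \<noteq> 0}"
    using finite_subset by blast
next
  fix v :: 'i and f :: "'i set \<Rightarrow> 'r" and A
  assume "\<forall>A. f A \<noteq> 0 \<longrightarrow> finite A"
    "(if v \<in> A then 0 else (- 1) ^ card {b \<in> A. b < v} * f (insert v A)) \<noteq> 0"
  then show "finite A" by (metis finite_insert mult_zero_right)
qed

section \<open>The superalgebra \<open>\<S>(m)\<close>\<close>

datatype gen = Gen (gen_row: nat) (gen_col: nat)

instantiation gen :: linorder
begin

definition less_eq_gen :: "gen \<Rightarrow> gen \<Rightarrow> bool" where
  "less_eq_gen v w \<longleftrightarrow> gen_row v < gen_row w \<or> gen_row v = gen_row w \<and> gen_col v \<le> gen_col w"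

definition less_gen :: "gen \<Rightarrow> gen \<Rightarrow> bool" where
  "less_gen v w \<longleftrightarrow> gen_row v < gen_row w \<or> gen_row v = gen_row w \<and> gen_col v < gen_col w"

instance
  by intro_classes (auto simp: less_eq_gen_def less_gen_def gen.expand)

end

text \<open>
  All indices start at \<open>0\<close>. \<open>Gen i t\<close> indexes \<open>x\<^sup>i\<^sub>t\<close> in \<open>cpoly\<close>, and
  \<open>\<theta>\<^sup>i\<^sub>t\<close> as a Grassmann generator; \<open>spoly\<close> is therefore the free
  supercommutative algebra, \<open>\<complex>[x] \<otimes> \<Lambda>[\<theta>]\<close>, in infinitely many generators, and
  \<open>\<S>(m)\<close> is the subalgebra \<open>superalg m n\<close> below. The
  localisation \<open>\<S>[\<Delta>\<^sup>-\<^sup>1] = \<complex>[x][\<Delta>\<^sup>-\<^sup>1] \<otimes> \<Lambda>[\<theta>]\<close> is regarded as a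
  subalgebra of \<open>\<complex>(x) \<otimes> \<Lambda>[\<theta>]\<close>, the type \<open>lpoly\<close>.
\<close>

type_synonym cpoly = "(gen \<Rightarrow>\<^sub>0 nat) \<Rightarrow>\<^sub>0 complex"
type_synonym spoly = "(gen, cpoly) grassmann"
type_synonym lpoly = "(gen, cpoly fract) grassmann"

definition pconst :: "complex \<Rightarrow> cpoly" where
  "pconst c = Poly_Mapping.single 0 c"

definition pvar :: "gen \<Rightarrow> cpoly" where
  "pvar v = Poly_Mapping.single (Poly_Mapping.single v 1) 1"

definition pderiv_var :: "gen \<Rightarrow> cpoly \<Rightarrow> cpoly" where
  "pderiv_var v p = (\<Sum>\<alpha>\<in>Poly_Mapping.keys p. Poly_Mapping.single (\<alpha> - Poly_Mapping.single v 1)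
     (of_nat (Poly_Mapping.lookup \<alpha> v) * Poly_Mapping.lookup p \<alpha>))"

definition sconst :: "complex \<Rightarrow> spoly" where
  "sconst c = gconst (pconst c)"

text \<open>The generator \<open>X\<^sup>a\<^sub>t\<close>: \<open>x\<^sup>a\<^sub>t\<close> for \<open>a < m\<close> and
  \<open>\<theta>\<^sup>a\<^sup>-\<^sup>m\<^sub>t\<close> otherwise.\<close>

definition Xgen :: "nat \<Rightarrow> nat \<Rightarrow> nat \<Rightarrow> spoly" where
  "Xgen m a t = (if a < m then gconst (pvar (Gen a t)) else gtheta (Gen (a - m) t))"

definition even_gens :: "nat \<Rightarrow> gen set" where
  "even_gens m = {Gen i t | i t. i < m \<and> t < m}"

definition odd_gens :: "nat \<Rightarrow> nat \<Rightarrow> gen set" where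
  "odd_gens m n = {Gen \<mu> t | \<mu> t. \<mu> < 2 * n \<and> t < m}"

definition superalg :: "nat \<Rightarrow> nat \<Rightarrow> spoly set" where
  "superalg m n = {f. \<forall>A. coef f A \<noteq> 0 \<longrightarrow> A \<subseteq> odd_gens m n \<and>
     (\<forall>\<alpha>\<in>Poly_Mapping.keys (coef f A). Poly_Mapping.keys \<alpha> \<subseteq> even_gens m)}"

definition sparity :: "nat \<Rightarrow> spoly \<Rightarrow> bool" where
  "sparity p f \<longleftrightarrow> (\<forall>A. coef f A \<noteq> 0 \<longrightarrow> card A mod 2 = p mod 2)"

definition seven :: "spoly \<Rightarrow> bool" where
  "seven f \<longleftrightarrow> sparity 0 f"

definition shomogeneous :: "nat \<Rightarrow> spoly \<Rightarrow> bool" where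
  "shomogeneous d f \<longleftrightarrow> (\<forall>A. \<forall>\<alpha>\<in>Poly_Mapping.keys (coef f A).
     (\<Sum>v\<in>Poly_Mapping.keys \<alpha>. Poly_Mapping.lookup \<alpha> v) + card A = d)"

text \<open>Setting all \<open>\<theta>\<close> to \<open>0\<close> leaves the coefficient of the empty product.\<close>

definition leading_term :: "spoly \<Rightarrow> cpoly" where
  "leading_term f = coef f {}"

definition to_loc :: "spoly \<Rightarrow> lpoly" where
  "to_loc = gmap (\<lambda>p. Fract p 1)"

section \<open>The form, the supergroup and the Lie superalgebra\<close>

definition eta :: "nat \<Rightarrow> complex mat" where
  "eta n = four_block_mat (0\<^sub>m n n) (1\<^sub>m n) (- 1\<^sub>m n) (0\<^sub>m n n)"

definition kappa :: "nat \<Rightarrow> nat \<Rightarrow> complex mat" where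
  "kappa m n = four_block_mat (1\<^sub>m m) (0\<^sub>m m (2 * n)) (0\<^sub>m (2 * n) m) (eta n)"

definition kappa_inv :: "nat \<Rightarrow> nat \<Rightarrow> complex mat" where
  "kappa_inv m n = the (mat_inverse (kappa m n))"

definition bform :: "nat \<Rightarrow> nat \<Rightarrow> complex vec \<Rightarrow> complex vec \<Rightarrow> complex" where
  "bform m n v w = v \<bullet> (kappa m n *\<^sub>v w)"

definition orthogonal_group :: "nat \<Rightarrow> complex mat set" where
  "orthogonal_group m = {A \<in> carrier_mat m m. A\<^sup>T * A = 1\<^sub>m m}"

definition symplectic_group :: "nat \<Rightarrow> complex mat set" where
  "symplectic_group n = {B \<in> carrier_mat (2 * n) (2 * n). B\<^sup>T * eta n * B = eta n}"

definition OSp0 :: "nat \<Rightarrow> nat \<Rightarrow> complex mat set" where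
  "OSp0 m n = {four_block_mat A (0\<^sub>m m (2 * n)) (0\<^sub>m (2 * n) m) B | A B.
     A \<in> orthogonal_group m \<and> B \<in> symplectic_group n}"

definition idx_parity :: "nat \<Rightarrow> nat \<Rightarrow> nat" where
  "idx_parity m a = (if a < m then 0 else 1)"

definition vec_parity :: "nat \<Rightarrow> nat \<Rightarrow> nat \<Rightarrow> complex vec \<Rightarrow> bool" where
  "vec_parity m n p v \<longleftrightarrow> v \<in> carrier_vec (m + 2 * n) \<and>
     (\<forall>a < m + 2 * n. v $ a \<noteq> 0 \<longrightarrow> idx_parity m a = p)"

definition mat_parity :: "nat \<Rightarrow> nat \<Rightarrow> nat \<Rightarrow> complex mat \<Rightarrow> bool" where
  "mat_parity m n p Y \<longleftrightarrow> Y \<in> carrier_mat (m + 2 * n) (m + 2 * n) \<and>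
     (\<forall>a < m + 2 * n. \<forall>b < m + 2 * n. Y $$ (b, a) \<noteq> 0 \<longrightarrow>
        (idx_parity m a + p) mod 2 = idx_parity m b)"

inductive_set osp :: "nat \<Rightarrow> nat \<Rightarrow> complex mat set" for m n where
  homogeneous: "p \<in> {0, 1} \<Longrightarrow> mat_parity m n p Y \<Longrightarrow>
    (\<And>r s v w. r \<in> {0, 1} \<Longrightarrow> s \<in> {0, 1} \<Longrightarrow> vec_parity m n r v \<Longrightarrow> vec_parity m n s w \<Longrightarrow>
       bform m n (Y *\<^sub>v v) w + (- 1) ^ (p * r) * bform m n v (Y *\<^sub>v w) = 0) \<Longrightarrow>
    Y \<in> osp m n"
| add: "Y \<in> osp m n \<Longrightarrow> Z \<in> osp m n \<Longrightarrow> Y + Z \<in> osp m n"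
| smult: "Y \<in> osp m n \<Longrightarrow> c \<cdot>\<^sub>m Y \<in> osp m n"

section \<open>The actions\<close>

text \<open>Evaluation of a superpolynomial at \<open>x\<^sub>v = \<xi> v\<close> and
  \<open>\<theta>\<^sub>v = \<tau> v\<close>. For even \<open>\<xi> v\<close> and odd \<open>\<tau> v\<close> this is the algebra
  endomorphism with the prescribed values on the generators.\<close>

definition subst :: "(gen \<Rightarrow> spoly) \<Rightarrow> (gen \<Rightarrow> spoly) \<Rightarrow> spoly \<Rightarrow> spoly" where
  "subst \<xi> \<tau> f = (\<Sum>A | coef f A \<noteq> 0. \<Sum>\<alpha>\<in>Poly_Mapping.keys (coef f A).
     sconst (Poly_Mapping.lookup (coef f A) \<alpha>)
     * prod_list (map (\<lambda>v. \<xi> v ^ Poly_Mapping.lookup \<alpha> v) (sorted_list_of_set (Poly_Mapping.keys \<alpha>)))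
     * prod_list (map \<tau> (sorted_list_of_set A)))"

text \<open>The natural action of a matrix \<open>Y\<close> on \<open>V \<otimes> \<complex>\<^sup>m\<close>:
  \<open>X\<^sup>a\<^sub>t \<mapsto> \<Sum>\<^sub>b Y\<^sub>b\<^sub>a X\<^sup>b\<^sub>t\<close>.\<close>

definition lin_act :: "nat \<Rightarrow> nat \<Rightarrow> complex mat \<Rightarrow> nat \<Rightarrow> nat \<Rightarrow> spoly" where
  "lin_act m n Y a t = (\<Sum>b < m + 2 * n. sconst (Y $$ (b, a)) * Xgen m b t)"

definition group_act :: "nat \<Rightarrow> nat \<Rightarrow> complex mat \<Rightarrow> spoly \<Rightarrow> spoly" where
  "group_act m n g = subst (\<lambda>v. lin_act m n g (gen_row v) (gen_col v))
     (\<lambda>v. lin_act m n g (m + gen_row v) (gen_col v))"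

definition Xderiv :: "nat \<Rightarrow> nat \<Rightarrow> nat \<Rightarrow> spoly \<Rightarrow> spoly" where
  "Xderiv m a t = (if a < m then gmap (pderiv_var (Gen a t)) else gderiv (Gen (a - m) t))"

text \<open>The superderivation extending the natural action, written with left derivatives; see
  \<open>lie_act_Xgen\<close> and \<open>lie_act_superderivation\<close> at the end of this theory.\<close>

definition lie_act :: "nat \<Rightarrow> nat \<Rightarrow> complex mat \<Rightarrow> spoly \<Rightarrow> spoly" where
  "lie_act m n Y f = (\<Sum>a < m + 2 * n. \<Sum>t < m. lin_act m n Y a t * Xderiv m a t f)"

definition osp_invariants :: "nat \<Rightarrow> nat \<Rightarrow> spoly set" where
  "osp_invariants m n = {f \<in> superalg m n. \<forall>Y \<in> osp m n. lie_act m n Y f = 0}"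

definition pseudo_invariant :: "nat \<Rightarrow> nat \<Rightarrow> spoly \<Rightarrow> bool" where
  "pseudo_invariant m n f \<longleftrightarrow> f \<in> osp_invariants m n \<and>
     (\<forall>g \<in> OSp0 m n. group_act m n g f = sconst (det g) * f)"

section \<open>The super Pfaffian\<close>

definition Delta :: "nat \<Rightarrow> cpoly" where
  "Delta m = det (mat m m (\<lambda>(i, j). pvar (Gen i j)))"

text \<open>The Leibniz formula for the determinant of an \<open>m \<times> m\<close> matrix over a ring that is not
  commutative; it is used only for matrices with even, hence mutually commuting, entries.\<close>

definition sdet :: "nat \<Rightarrow> (nat \<Rightarrow> nat \<Rightarrow> 'a::ring_1) \<Rightarrow> 'a" where
  "sdet m M = (\<Sum>p | p permutes {..<m}. of_int (sign p) * prod_list (map (\<lambda>i. M i (p i)) [0..<m]))"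

definition qform :: "nat \<Rightarrow> nat \<Rightarrow> nat \<Rightarrow> nat \<Rightarrow> spoly" where
  "qform m n t s = (\<Sum>a < m + 2 * n. \<Sum>b < m + 2 * n.
     Xgen m a t * sconst (kappa_inv m n $$ (a, b)) * Xgen m b s)"

definition detQ :: "nat \<Rightarrow> nat \<Rightarrow> spoly" where
  "detQ m n = sdet m (qform m n)"

definition zeta :: "nat \<Rightarrow> nat \<Rightarrow> spoly" where
  "zeta m n = detQ m n - gconst (Delta m) ^ 2"

definition zeta_frac :: "nat \<Rightarrow> nat \<Rightarrow> lpoly" where
  "zeta_frac m n = to_loc (zeta m n) * gconst (Fract 1 (Delta m ^ 2))"

definition lconst :: "complex \<Rightarrow> lpoly" where
  "lconst c = to_loc (sconst c)"

text \<open>\<open>zeta_frac\<close> is nilpotent, so the sum is finite and contains all nonzero terms.\<close>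

definition Fsqrt :: "nat \<Rightarrow> nat \<Rightarrow> lpoly" where
  "Fsqrt m n = 1 + (\<Sum>k | 1 \<le> k \<and> zeta_frac m n ^ k \<noteq> 0.
     lconst (1 / fact k * (\<Prod>j = 0..<k. 1 / 2 - of_nat j)) * zeta_frac m n ^ k)"

definition super_Pfaffian :: "nat \<Rightarrow> nat \<Rightarrow> lpoly" where
  "super_Pfaffian m n = to_loc (gconst (Delta m)) * Fsqrt m n * to_loc (detQ m n) ^ n"

section \<open>The Lie superalgebra acts by superderivations; \<open>\<S>\<close> embeds into its localisation\<close>

lemma coef_gconst_times: "coef (gconst c * f) S = c * coef f S"
proof -
  have "coef (gconst c * f) S = (\<Sum>A\<in>Pow S. if A = {} then c * coef f S else 0)"
    unfolding times_grassmann.rep_eq by (rule sum.cong) (auto simp: gconst.rep_eq)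
  then show ?thesis by (cases "finite S") (simp_all add: coef_infinite)
qed

lemma coef_times_gconst: "coef (f * gconst c) S = coef f S * c"
proof -
  have "coef (f * gconst c) S = (\<Sum>A\<in>Pow S. if A = S then coef f S * c else 0)"
    unfolding times_grassmann.rep_eq by (rule sum.cong) (auto simp: gconst.rep_eq)
  then show ?thesis by (cases "finite S") (simp_all add: coef_infinite)
qed

lemma gconst_commute: "gconst c * f = f * gconst c"
  by (rule grassmann_eqI) (simp add: coef_gconst_times coef_times_gconst mult.commute)

lemma coef_gtheta_times:
  "coef (gtheta v * f) S = (if v \<in> S then ksign {v} (S - {v}) * coef f (S - {v}) else 0)"
proof -
  have "coef (gtheta v * f) S =
      (\<Sum>A\<in>Pow S. if A = {v} then ksign {v} (S - {v}) * coef f (S - {v}) else 0)"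
    unfolding times_grassmann.rep_eq by (rule sum.cong) (auto simp: gtheta.rep_eq)
  then show ?thesis by (cases "finite S") (simp_all add: coef_infinite)
qed

lemma coef_times_gtheta:
  "coef (f * gtheta v) S = (if v \<in> S then ksign (S - {v}) {v} * coef f (S - {v}) else 0)"
proof -
  have "coef (f * gtheta v) S =
      (\<Sum>A\<in>Pow S. if v \<in> S \<and> A = S - {v} then ksign (S - {v}) {v} * coef f (S - {v}) else 0)"
    unfolding times_grassmann.rep_eq
  proof (rule sum.cong)
    fix A assume "A \<in> Pow S"
    then have "S - A = {v} \<longleftrightarrow> v \<in> S \<and> A = S - {v}" by auto
    then show "ksign A (S - A) * coef f A * coef (gtheta v) (S - A) =
      (if v \<in> S \<and> A = S - {v} then ksign (S - {v}) {v} * coef f (S - {v}) else 0)"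
      by (cases "S - A = {v}") (auto simp: gtheta.rep_eq)
  qed simp
  then show ?thesis by (cases "finite S") (auto simp: coef_infinite)
qed

lemma card_split:
  fixes v :: "'i::linorder"
  assumes "finite B" "v \<notin> B"
  shows "card {b \<in> B. b < v} + card {b \<in> B. v < b} = card B"
proof -
  have "{b \<in> B. b < v} \<union> {b \<in> B. v < b} = B"
    using assms by (auto simp: not_less order_le_less)
  moreover have "card ({b \<in> B. b < v} \<union> {b \<in> B. v < b}) = card {b \<in> B. b < v} + card {b \<in> B. v < b}"
    using assms by (intro card_Un_disjoint) auto
  ultimately show ?thesis by simp
qed

lemma ksign_single_left: "ksign {v} B = (- 1) ^ card {b \<in> B. b < v}"
proof -
  have "{(a, b). a \<in> {v} \<and> b \<in> B \<and> b < a} = Pair v ` {b \<in> B. b < v}" by auto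
  then show ?thesis by (simp add: ksign_def inversions_def card_image inj_on_def)
qed

lemma ksign_single_right: "ksign B {v} = (- 1) ^ card {b \<in> B. v < b}"
proof -
  have "{(a, b). a \<in> B \<and> b \<in> {v} \<and> b < a} = (\<lambda>a. (a, v)) ` {b \<in> B. v < b}" by auto
  then show ?thesis by (simp add: ksign_def inversions_def card_image inj_on_def)
qed

lemma minus_one_power_cong: "even (a + b) \<Longrightarrow> (- 1 :: 'a::ring_1) ^ a = (- 1) ^ b"
  by (cases "even a") auto

lemma idx_parity_simps: "a < m \<Longrightarrow> idx_parity m a = 0" "\<not> a < m \<Longrightarrow> idx_parity m a = 1"
  by (simp_all add: idx_parity_def)

lemma coef_sign_times: "coef ((- 1) ^ k * f) S = (- 1) ^ k * coef f S"
  by (cases "even k") (simp_all add: uminus_grassmann.rep_eq)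

lemma Xgen_supercommute:
  assumes "sparity r f"
  shows "Xgen m a t * f = (- 1) ^ (idx_parity m a * r) * f * Xgen m a t"
proof (cases "a < m")
  case True
  then show ?thesis by (simp add: Xgen_def idx_parity_simps gconst_commute)
next
  case False
  let ?v = "Gen (a - m) t"
  have "gtheta ?v * f = (- 1) ^ r * (f * gtheta ?v)"
  proof (rule grassmann_eqI)
    fix S
    show "coef (gtheta ?v * f) S = coef ((- 1) ^ r * (f * gtheta ?v)) S"
    proof (cases "?v \<in> S \<and> coef f (S - {?v}) \<noteq> 0")
      case True
      let ?B = "S - {?v}"
      have "finite ?B" using True coef_infinite by blast
      then have "card {b \<in> ?B. b < ?v} + card {b \<in> ?B. ?v < b} = card ?B"
        by (intro card_split) auto
      moreover have "card ?B mod 2 = r mod 2" using assms True by (auto simp: sparity_def)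
      ultimately have "even (card {b \<in> ?B. b < ?v} + (r + card {b \<in> ?B. ?v < b}))" by presburger
      from minus_one_power_cong [OF this, where 'a = cpoly] True show ?thesis
        by (simp add: coef_sign_times coef_gtheta_times coef_times_gtheta ksign_single_left ksign_single_right
             power_add mult.assoc)
    qed (auto simp: coef_sign_times coef_gtheta_times coef_times_gtheta)
  qed
  then show ?thesis using False by (simp add: Xgen_def idx_parity_simps mult.assoc)
qed

lemma gderiv_times:
  assumes f: "\<And>A. coef f A \<noteq> 0 \<Longrightarrow> card A mod 2 = r mod 2"
  shows "gderiv v (f * g) = gderiv v f * g + (- 1) ^ r * (f * gderiv v g)"
proof (rule grassmann_eqI)
  fix S
  show "coef (gderiv v (f * g)) S = coef (gderiv v f * g + (- 1) ^ r * (f * gderiv v g)) S"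
  proof (cases "finite S")
    case False
    then show ?thesis by (simp add: coef_infinite)
  next
    case fin: True
    show ?thesis
    proof (cases "v \<in> S")
      case True
      let ?S = "S - {v}"
      have S: "S = insert v ?S" and vS: "v \<notin> ?S" using True by auto
      have Pow: "Pow S = Pow ?S \<union> insert v ` Pow ?S" by (subst S) (rule Pow_insert)
      have disj: "Pow ?S \<inter> insert v ` Pow ?S = {}" by auto
      have inj: "inj_on (insert v) (Pow ?S)" by (auto simp: inj_on_def)
      let ?h1 = "\<lambda>A. ksign A (S - A) * coef (gderiv v f) A * coef g (S - A)"
      let ?h2 = "\<lambda>A. ksign A (S - A) * coef f A * coef (gderiv v g) (S - A)"
      have z1: "?h1 (insert v A) = 0" for A by (simp add: gderiv.rep_eq)
      have z2: "?h2 A = 0" if "A \<in> Pow ?S" for A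
        using that True by (auto simp: gderiv.rep_eq)
      have c: "?h1 A + (- 1) ^ r * ?h2 (insert v A) = 0" if A: "A \<in> Pow ?S" for A
      proof (cases "coef f (insert v A) = 0")
        case True
        then show ?thesis by (simp add: gderiv.rep_eq)
      next
        case False
        have vA: "v \<notin> A" and finA: "finite A" using A fin finite_subset by auto
        have e1: "S - A = (?S - A) \<union> {v}" and e2: "S - insert v A = ?S - A" using True vA by auto
        have k1: "ksign A (S - A) = ksign A (?S - A) * (ksign A {v} :: 'b)"
          unfolding e1 by (rule ksign_Un_right) (use finA fin in auto)
        have k2: "ksign (insert v A) (S - insert v A) = ksign A (?S - A) * (ksign {v} (?S - A) :: 'b)"
          unfolding e2 using ksign_Un_left [of A "{v}" "?S - A"] finA fin vA by simp
        have "card (insert v A) mod 2 = r mod 2" by (rule f [OF False])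
        then have "even (card {b \<in> A. v < b} + card {b \<in> A. b < v} + Suc r)"
          using card_split [OF finA vA] vA finA by simp presburger
        from minus_one_power_cong [OF this, where 'a = 'b]
        have s: "ksign A {v} * (- 1) ^ card {b \<in> A. b < v} = - ((- 1 :: 'b) ^ r)"
          by (simp add: power_add ksign_single_right)
        have "?h1 A = (ksign A {v} * (- 1) ^ card {b \<in> A. b < v}) *
            (ksign A (?S - A) * coef f (insert v A) * coef g (S - A))"
          using vA unfolding k1 by (simp add: gderiv.rep_eq mult_ac)
        moreover have "?h2 (insert v A) = ksign A (?S - A) * coef f (insert v A) * coef g (S - A)"
        proof -
          have "insert v (S - insert v A) = S - A" using True vA by auto
          moreover have "ksign {v} (?S - A) * (- 1) ^ card {b \<in> S - insert v A. b < v} = (1 :: 'b)"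
            unfolding e2 ksign_single_left power_add [symmetric] by (rule neg_one_even_power) simp
          moreover have "?h2 (insert v A) = (ksign {v} (?S - A) * (- 1) ^ card {b \<in> S - insert v A. b < v}) *
            (ksign A (?S - A) * coef f (insert v A) * coef g (insert v (S - insert v A)))"
            unfolding k2 by (simp add: gderiv.rep_eq mult_ac)
          ultimately show ?thesis by simp
        qed
        ultimately show ?thesis unfolding s by simp
      qed
      have "(\<Sum>A\<in>Pow S. ?h1 A) = (\<Sum>A\<in>Pow ?S. ?h1 A)"
        unfolding Pow using fin disj inj z1 by (subst sum.union_disjoint) (auto simp: sum.reindex)
      moreover have "(\<Sum>A\<in>Pow S. ?h2 A) = (\<Sum>A\<in>Pow ?S. ?h2 (insert v A))"
        unfolding Pow using fin disj inj z2 by (subst sum.union_disjoint) (auto simp: sum.reindex)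
      ultimately have "(\<Sum>A\<in>Pow S. ?h1 A) + (- 1) ^ r * (\<Sum>A\<in>Pow S. ?h2 A)
          = (\<Sum>A\<in>Pow ?S. ?h1 A + (- 1) ^ r * ?h2 (insert v A))"
        by (simp only: sum.distrib sum_distrib_left)
      also have "\<dots> = 0" using c by (intro sum.neutral) blast
      finally show ?thesis
        using True unfolding plus_grassmann.rep_eq coef_sign_times times_grassmann.rep_eq [of "gderiv v f"]
          times_grassmann.rep_eq [of f "gderiv v g"] by (simp add: gderiv.rep_eq [of v "f * g"])
    next
      case v: False
      have lt: "card {b \<in> S. b < v} = card {b \<in> A. b < v} + card {b \<in> S - A. b < v}"
        if "A \<subseteq> S" for A
      proof -
        have "{b \<in> S. b < v} = {b \<in> A. b < v} \<union> {b \<in> S - A. b < v}" using that by auto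
        then show ?thesis using fin that finite_subset [OF that fin]
          by (subst card_Un_disjoint [symmetric]) auto
      qed
      have Pow: "Pow (insert v S) = Pow S \<union> insert v ` Pow S" by (rule Pow_insert)
      have disj: "Pow S \<inter> insert v ` Pow S = {}" using v by auto
      have inj: "inj_on (insert v) (Pow S)" using v by (auto simp: inj_on_def)
      let ?h = "\<lambda>A. ksign A (insert v S - A) * coef f A * coef g (insert v S - A)"
      have 1: "(- 1) ^ card {b \<in> S. b < v} * ?h A =
          (- 1) ^ r * (ksign A (S - A) * coef f A * coef (gderiv v g) (S - A))"
        if A: "A \<in> Pow S" for A
      proof (cases "coef f A = 0")
        case False
        have e: "insert v S - A = (S - A) \<union> {v}" and vA: "v \<notin> A" "A \<subseteq> S" using A v by auto
        have finA: "finite A" using A fin finite_subset by auto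
        have k: "ksign A (insert v S - A) = ksign A (S - A) * (ksign A {v} :: 'b)"
          unfolding e by (rule ksign_Un_right) (use finA fin v in auto)
        have "even (card {b \<in> S. b < v} + card {b \<in> A. v < b} + (r + card {b \<in> S - A. b < v}))"
          using f [OF False] card_split [OF finA vA(1)] lt [OF vA(2)] by presburger
        from minus_one_power_cong [OF this, where 'a = 'b]
        have "(- 1) ^ card {b \<in> S. b < v} * ksign A {v} = (- 1) ^ r * (- 1 :: 'b) ^ card {b \<in> S - A. b < v}"
          by (simp add: power_add ksign_single_right)
        then have "((- 1) ^ card {b \<in> S. b < v} * ksign A {v}) * (ksign A (S - A) * coef f A * coef g (insert v (S - A)))
          = ((- 1) ^ r * (- 1 :: 'b) ^ card {b \<in> S - A. b < v}) * (ksign A (S - A) * coef f A * coef g (insert v (S - A)))"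
          by simp
        then show ?thesis using v unfolding k by (simp add: gderiv.rep_eq e mult_ac)
      qed simp
      have 2: "(- 1) ^ card {b \<in> S. b < v} * ?h (insert v A) =
          ksign A (S - A) * coef (gderiv v f) A * coef g (S - A)"
        if A: "A \<in> Pow S" for A
      proof -
        have e: "insert v S - insert v A = S - A" and vA: "v \<notin> A" "A \<subseteq> S" using A v by auto
        have finA: "finite A" using A fin finite_subset by auto
        have k: "ksign (insert v A) (S - A) = ksign A (S - A) * (ksign {v} (S - A) :: 'b)"
          using ksign_Un_left [of A "{v}" "S - A"] finA fin vA by simp
        have "even (card {b \<in> S. b < v} + card {b \<in> S - A. b < v} + card {b \<in> A. b < v})"
          using lt [OF vA(2)] by presburger
        from minus_one_power_cong [OF this, where 'a = 'b]
        have "(- 1) ^ card {b \<in> S. b < v} * ksign {v} (S - A) = (- 1 :: 'b) ^ card {b \<in> A. b < v}"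
          by (simp add: power_add ksign_single_left)
        then have "((- 1) ^ card {b \<in> S. b < v} * ksign {v} (S - A)) * (ksign A (S - A) * coef f (insert v A) * coef g (S - A))
          = (- 1 :: 'b) ^ card {b \<in> A. b < v} * (ksign A (S - A) * coef f (insert v A) * coef g (S - A))"
          by simp
        then show ?thesis using vA unfolding e k by (simp add: gderiv.rep_eq mult_ac)
      qed
      have "coef (gderiv v (f * g)) S = (- 1) ^ card {b \<in> S. b < v} * (sum ?h (Pow S) + sum ?h (insert v ` Pow S))"
        using v fin disj by (simp add: gderiv.rep_eq times_grassmann.rep_eq Pow sum.union_disjoint)
      also have "sum ?h (insert v ` Pow S) = (\<Sum>A\<in>Pow S. ?h (insert v A))"
        using inj by (simp add: sum.reindex)
      also have "(- 1) ^ card {b \<in> S. b < v} * (sum ?h (Pow S) + (\<Sum>A\<in>Pow S. ?h (insert v A))) =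
         (\<Sum>A\<in>Pow S. (- 1) ^ r * (ksign A (S - A) * coef f A * coef (gderiv v g) (S - A))) +
         (\<Sum>A\<in>Pow S. ksign A (S - A) * coef (gderiv v f) A * coef g (S - A))"
      proof -
        have "(- 1) ^ card {b \<in> S. b < v} * sum ?h (Pow S) =
          (\<Sum>A\<in>Pow S. (- 1) ^ r * (ksign A (S - A) * coef f A * coef (gderiv v g) (S - A)))"
          unfolding sum_distrib_left by (rule sum.cong [OF refl 1])
        moreover have "(- 1) ^ card {b \<in> S. b < v} * (\<Sum>A\<in>Pow S. ?h (insert v A)) =
          (\<Sum>A\<in>Pow S. ksign A (S - A) * coef (gderiv v f) A * coef g (S - A))"
          unfolding sum_distrib_left by (rule sum.cong [OF refl 2])
        ultimately show ?thesis by (simp only: distrib_left)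
      qed
      finally show ?thesis
        unfolding plus_grassmann.rep_eq coef_sign_times times_grassmann.rep_eq [of "gderiv v f"]
          times_grassmann.rep_eq [of f "gderiv v g"] by (simp add: sum_distrib_left)
    qed
  qed
qed

lemma lookup_pderiv_var:
  "Poly_Mapping.lookup (pderiv_var v p) \<alpha> =
    of_nat (Suc (Poly_Mapping.lookup \<alpha> v)) * Poly_Mapping.lookup p (\<alpha> + Poly_Mapping.single v 1)"
proof -
  let ?e = "Poly_Mapping.single v (1::nat)"
  have *: "(of_nat (Poly_Mapping.lookup \<beta> v) * c when \<beta> - ?e = \<alpha>) =
      (of_nat (Suc (Poly_Mapping.lookup \<alpha> v)) * c when \<beta> = \<alpha> + ?e)" for \<beta> and c :: complex
  proof (cases "\<beta> = \<alpha> + ?e")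
    case True
    then show ?thesis by (simp add: lookup_add)
  next
    case False
    have "Poly_Mapping.lookup \<beta> v = 0" if "\<beta> - ?e = \<alpha>"
    proof (rule ccontr)
      assume "Poly_Mapping.lookup \<beta> v \<noteq> 0"
      then have "\<beta> = (\<beta> - ?e) + ?e"
        by (intro poly_mapping_eqI) (auto simp: lookup_add lookup_minus lookup_single when_def)
      with that False show False by metis
    qed
    with False show ?thesis by (auto simp: when_def)
  qed
  have "Poly_Mapping.lookup (pderiv_var v p) \<alpha> = (\<Sum>\<beta>\<in>Poly_Mapping.keys p.
      (of_nat (Poly_Mapping.lookup \<beta> v) * Poly_Mapping.lookup p \<beta> when \<beta> - ?e = \<alpha>))"
    by (simp add: pderiv_var_def lookup_sum lookup_single)
  also have "\<dots> = (\<Sum>\<beta>\<in>Poly_Mapping.keys p.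
      (of_nat (Suc (Poly_Mapping.lookup \<alpha> v)) * Poly_Mapping.lookup p \<beta> when \<beta> = \<alpha> + ?e))"
    by (simp only: *)
  also have "\<dots> = of_nat (Suc (Poly_Mapping.lookup \<alpha> v)) * Poly_Mapping.lookup p (\<alpha> + ?e)"
    by (simp add: when_def sum.delta' in_keys_iff del: of_nat_Suc)
  finally show ?thesis .
qed

lemma pderiv_var_zero [simp]: "pderiv_var v 0 = 0"
  by (simp add: pderiv_var_def)

lemma pderiv_var_add: "pderiv_var v (p + q) = pderiv_var v p + pderiv_var v q"
  by (rule poly_mapping_eqI) (simp only: lookup_pderiv_var lookup_add distrib_left)

lemma pderiv_var_sum: "pderiv_var v (sum f A) = (\<Sum>x\<in>A. pderiv_var v (f x))"
  by (induction A rule: infinite_finite_induct) (simp_all add: pderiv_var_add)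

lemma pderiv_var_uminus: "pderiv_var v (- p) = - pderiv_var v p"
  by (rule poly_mapping_eqI) (simp add: lookup_pderiv_var)

lemma pderiv_var_single:
  "pderiv_var v (Poly_Mapping.single \<alpha> c) =
    Poly_Mapping.single (\<alpha> - Poly_Mapping.single v 1) (of_nat (Poly_Mapping.lookup \<alpha> v) * c)"
  by (cases "c = 0") (simp_all add: pderiv_var_def)

lemma pderiv_var_times_single:
  "pderiv_var v (Poly_Mapping.single \<alpha> c * Poly_Mapping.single \<beta> d) =
    pderiv_var v (Poly_Mapping.single \<alpha> c) * Poly_Mapping.single \<beta> d
    + Poly_Mapping.single \<alpha> c * pderiv_var v (Poly_Mapping.single \<beta> d)"
proof -
  let ?e = "Poly_Mapping.single v (1::nat)"
  have *: "Poly_Mapping.single (\<alpha> + \<beta> - ?e) (of_nat (Poly_Mapping.lookup \<alpha> v) * x) =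
    Poly_Mapping.single (\<alpha> - ?e + \<beta>) (of_nat (Poly_Mapping.lookup \<alpha> v) * x)"
    for \<alpha> \<beta> and x :: complex
  proof (cases "Poly_Mapping.lookup \<alpha> v = 0")
    case False
    then have "\<alpha> + \<beta> - ?e = \<alpha> - ?e + \<beta>"
      by (intro poly_mapping_eqI) (auto simp: lookup_add lookup_minus lookup_single when_def)
    then show ?thesis by simp
  qed simp
  show ?thesis
    using * [of \<alpha> \<beta> "c * d"] * [of \<beta> \<alpha> "c * d"]
    by (simp add: pderiv_var_single mult_single lookup_add distrib_left distrib_right single_add mult_ac add_ac)
qed

lemma poly_mapping_sum_single:
  "p = (\<Sum>\<alpha>\<in>Poly_Mapping.keys p. Poly_Mapping.single \<alpha> (Poly_Mapping.lookup p \<alpha>))"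
proof (rule poly_mapping_eqI)
  fix \<beta>
  have "(\<Sum>\<alpha>\<in>Poly_Mapping.keys p. Poly_Mapping.lookup (Poly_Mapping.single \<alpha> (Poly_Mapping.lookup p \<alpha>)) \<beta>)
      = (\<Sum>\<alpha>\<in>Poly_Mapping.keys p. if \<alpha> = \<beta> then Poly_Mapping.lookup p \<beta> else 0)"
    by (rule sum.cong) (auto simp: lookup_single when_def)
  then show "Poly_Mapping.lookup p \<beta> = Poly_Mapping.lookup
      (\<Sum>\<alpha>\<in>Poly_Mapping.keys p. Poly_Mapping.single \<alpha> (Poly_Mapping.lookup p \<alpha>)) \<beta>"
    by (simp add: lookup_sum in_keys_iff)
qed

lemma pderiv_var_times: "pderiv_var v (p * q) = pderiv_var v p * q + p * pderiv_var v q"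
proof -
  have 1: "pderiv_var v (Poly_Mapping.single \<alpha> c * q) =
    pderiv_var v (Poly_Mapping.single \<alpha> c) * q + Poly_Mapping.single \<alpha> c * pderiv_var v q" for \<alpha> c
    by (subst (1 2 3) poly_mapping_sum_single [of q])
      (simp only: sum_distrib_left pderiv_var_sum pderiv_var_times_single sum.distrib)
  show ?thesis
    by (subst (1 2 3) poly_mapping_sum_single [of p])
      (simp only: sum_distrib_right pderiv_var_sum 1 sum.distrib)
qed

lemma coef_gmap: "\<phi> 0 = 0 \<Longrightarrow> coef (gmap \<phi> f) A = \<phi> (coef f A)"
  by (simp add: gmap.rep_eq)

lemma pderiv_var_one [simp]: "pderiv_var v 1 = 0"
  by (simp add: pderiv_var_single flip: single_one)

lemma pderiv_var_ksign [simp]: "pderiv_var v (ksign A B) = 0"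
  by (cases "even (inversions A B)") (simp_all add: ksign_def pderiv_var_uminus)

lemma gmap_pderiv_times:
  "gmap (pderiv_var v) (f * g) = gmap (pderiv_var v) f * g + f * gmap (pderiv_var v) g"
  by (rule grassmann_eqI)
    (simp add: coef_gmap times_grassmann.rep_eq plus_grassmann.rep_eq pderiv_var_sum mult.assoc
      pderiv_var_times distrib_left sum.distrib)

lemma Xderiv_times:
  assumes "sparity r f"
  shows "Xderiv m a t (f * g) = Xderiv m a t f * g + (- 1) ^ (idx_parity m a * r) * (f * Xderiv m a t g)"
proof (cases "a < m")
  case True
  then show ?thesis by (simp add: Xderiv_def idx_parity_simps gmap_pderiv_times)
next
  case False
  have "gderiv v (f * g) = gderiv v f * g + (- 1) ^ r * (f * gderiv v g)" for v
    using assms unfolding sparity_def by (intro gderiv_times) blast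
  then show ?thesis using False by (simp add: Xderiv_def idx_parity_simps)
qed

lemma sconst_zero [simp]: "sconst 0 = 0"
  by (rule grassmann_eqI) (simp add: sconst_def pconst_def gconst.rep_eq zero_grassmann.rep_eq)

lemma lin_act_supercommute:
  assumes Y: "mat_parity m n p Y" and f: "sparity r f" and a: "a < m + 2 * n"
  shows "(- 1) ^ (idx_parity m a * r) * (lin_act m n Y a t * f) = (- 1) ^ (p * r) * (f * lin_act m n Y a t)"
proof -
  have "(- 1) ^ (idx_parity m a * r) * (sconst (Y $$ (b, a)) * Xgen m b t * f) =
      (- 1) ^ (p * r) * (f * (sconst (Y $$ (b, a)) * Xgen m b t))" if b: "b < m + 2 * n" for b
  proof (cases "Y $$ (b, a) = 0")
    case False
    with Y a b have "(idx_parity m a + p) mod 2 = idx_parity m b" by (auto simp: mat_parity_def)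
    then have "even (idx_parity m a + p + idx_parity m b)" by presburger
    then have "even ((idx_parity m a + p + idx_parity m b) * r)" by simp
    then have "even (idx_parity m a * r + idx_parity m b * r + p * r)" by (simp add: algebra_simps)
    from minus_one_power_cong [OF this, where 'a = spoly]
    have s: "(- 1) ^ (idx_parity m a * r) * (- 1) ^ (idx_parity m b * r) = (- 1 :: spoly) ^ (p * r)"
      by (simp add: power_add)
    have "(- 1) ^ (idx_parity m a * r) * (sconst (Y $$ (b, a)) * Xgen m b t * f) =
      (- 1) ^ (idx_parity m a * r) * (sconst (Y $$ (b, a)) * ((- 1) ^ (idx_parity m b * r) * f * Xgen m b t))"
      by (simp only: mult.assoc [of "sconst (Y $$ (b, a))"] Xgen_supercommute [OF f])
    also have "\<dots> = ((- 1) ^ (idx_parity m a * r) * (- 1) ^ (idx_parity m b * r)) * (sconst (Y $$ (b, a)) * f * Xgen m b t)"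
      by (cases "even (idx_parity m b * r)") (simp_all add: mult.assoc)
    also have "sconst (Y $$ (b, a)) * f = f * sconst (Y $$ (b, a))"
      by (simp add: sconst_def gconst_commute)
    finally show ?thesis by (simp only: s mult.assoc)
  qed simp
  then show ?thesis by (simp add: lin_act_def sum_distrib_left sum_distrib_right)
qed

lemma lie_act_superderivation:
  assumes Y: "mat_parity m n p Y" and f: "sparity r f"
  shows "lie_act m n Y (f * g) = lie_act m n Y f * g + (- 1) ^ (p * r) * (f * lie_act m n Y g)"
proof -
  have "lin_act m n Y a t * Xderiv m a t (f * g) = lin_act m n Y a t * Xderiv m a t f * g
     + (- 1) ^ (p * r) * (f * (lin_act m n Y a t * Xderiv m a t g))" if "a < m + 2 * n" for a t
  proof -
    have "lin_act m n Y a t * ((- 1) ^ (idx_parity m a * r) * (f * Xderiv m a t g))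
       = (- 1) ^ (idx_parity m a * r) * (lin_act m n Y a t * f) * Xderiv m a t g"
      by (cases "even (idx_parity m a * r)") (simp_all add: mult.assoc)
    then show ?thesis
      using lin_act_supercommute [OF Y f that, of t]
      by (simp add: Xderiv_times [OF f] distrib_left mult.assoc)
  qed
  then show ?thesis
    by (simp add: lie_act_def sum_distrib_left sum_distrib_right sum.distrib)
qed

lemma Xderiv_Xgen: "Xderiv m a t (Xgen m b s) = (if a = b \<and> t = s then 1 else 0)"
proof -
  have x: "pderiv_var (Gen a t) (pvar (Gen b s)) = (if a = b \<and> t = s then 1 else 0)" for a b t s
    by (auto simp add: pvar_def pderiv_var_single lookup_single when_def simp flip: single_one)
  show ?thesis
    by (rule grassmann_eqI)
      (auto simp: Xderiv_def Xgen_def coef_gmap gconst.rep_eq gtheta.rep_eq gderiv.rep_eq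
        one_grassmann.rep_eq zero_grassmann.rep_eq x split: if_splits)
qed

lemma lie_act_Xgen:
  assumes "a < m + 2 * n" "t < m"
  shows "lie_act m n Y (Xgen m a t) = lin_act m n Y a t"
proof -
  have 1: "(\<Sum>s < m. lin_act m n Y b s * Xderiv m b s (Xgen m a t)) =
      (if b = a then lin_act m n Y a t else 0)" for b
  proof -
    have "(\<Sum>s < m. lin_act m n Y b s * Xderiv m b s (Xgen m a t)) =
        (\<Sum>s < m. if s = t then (if b = a then lin_act m n Y a t else 0) else 0)"
      by (intro sum.cong refl) (simp add: Xderiv_Xgen)
    then show ?thesis using assms by simp
  qed
  show ?thesis using assms by (simp add: lie_act_def 1)
qed

lemma to_loc_hom:
  "to_loc (f + g) = to_loc f + to_loc g" "to_loc (f * g) = to_loc f * to_loc g" "to_loc 1 = 1"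
proof -
  have F0: "Fract (0 :: cpoly) 1 = 0" by (simp add: Zero_fract_def)
  have Fa: "Fract (p + q) 1 = Fract p 1 + Fract q 1" for p q :: cpoly by simp
  have Fs: "Fract (sum h A) 1 = (\<Sum>x\<in>A. Fract (h x) 1)" for h :: "'x \<Rightarrow> cpoly" and A
    by (induction A rule: infinite_finite_induct) (simp_all add: F0 Fa del: add_fract)
  show "to_loc (f + g) = to_loc f + to_loc g"
    by (rule grassmann_eqI) (simp add: to_loc_def coef_gmap F0 plus_grassmann.rep_eq)
  have k: "Fract (ksign A B * p) 1 = ksign A B * Fract p (1 :: cpoly)" for A B :: "gen set" and p
    by (cases "even (inversions A B)") (simp_all add: ksign_def)
  show "to_loc (f * g) = to_loc f * to_loc g"
    by (rule grassmann_eqI) (simp add: to_loc_def coef_gmap F0 times_grassmann.rep_eq Fs k mult.assoc)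
  show "to_loc 1 = 1"
    by (rule grassmann_eqI) (simp add: to_loc_def coef_gmap F0 one_grassmann.rep_eq One_fract_def)
qed

lemma inj_to_loc: "inj to_loc"
proof (rule injI, rule grassmann_eqI)
  fix f g A
  assume "to_loc f = to_loc g"
  then have "coef (to_loc f) A = coef (to_loc g) A" by simp
  then show "coef f A = coef g A"
    by (simp add: to_loc_def coef_gmap Zero_fract_def [symmetric] eq_fract)
qed

lemma group_act_Xgen:
  assumes "a < m + 2 * n"
  shows "group_act m n g (Xgen m a t) = lin_act m n g a t"
proof -
  have s1: "sconst 1 = 1"
    by (rule grassmann_eqI) (simp add: sconst_def pconst_def gconst.rep_eq one_grassmann.rep_eq)
  show ?thesis
  proof (cases "a < m")
    case True
    have "(Poly_Mapping.single (Poly_Mapping.single v 1) 1 :: cpoly) \<noteq> 0" for v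
      by (metis lookup_single_eq lookup_zero one_neq_zero)
    then have "{A. coef (gconst (pvar v) :: spoly) A \<noteq> 0} = {{}}" for v
      by (auto simp: gconst.rep_eq pvar_def)
    then show ?thesis using True
      by (simp add: group_act_def subst_def Xgen_def gconst.rep_eq) (simp add: pvar_def s1)
  next
    case False
    have "{A. coef (gtheta v :: spoly) A \<noteq> 0} = {{v}}" for v
      by (auto simp: gtheta.rep_eq)
    then show ?thesis using False
      by (simp add: group_act_def subst_def Xgen_def gtheta.rep_eq s1)
  qed
qed

end

theory Submission
  imports Defs "HOL-Computational_Algebra.Formal_Power_Series"
begin

text \<open>
  Put \<open>u = \<Theta> X\<^sup>-\<^sup>1\<close>, a matrix of odd elements of the localisation. Then
  \<open>Q = X\<^sup>T Q\<^sub>0(u) X\<close>, so that \<open>det Q = \<Delta>\<^sup>2 det Q\<^sub>0(u)\<close> and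
  \<open>\<Omega> = \<Delta> \<cdot> \<Delta>\<^sup>2\<^sup>n f(u)\<close> where \<open>f\<close> has constant coefficients. Each of the \<open>2n\<close> rows
  of \<open>u\<close> contributes at most one factor \<open>\<Delta>\<close> to the denominator of a monomial, hence
  \<open>\<Omega>\<close> is polynomial.

  The other properties follow from \<open>\<Omega>\<^sup>2 = (det Q)\<^bsup>2n+1\<^esup>\<close>. As the leading term of the even
  element \<open>\<Omega>\<close> is not zero, \<open>\<Omega>\<close> is not a zero divisor, so every derivation \<open>D\<close> that scales
  the \<open>q\<^sub>t\<^sub>s\<close> also scales \<open>\<Omega>\<close>, because \<open>D(\<Omega>\<^sup>2) = 2\<Omega>D(\<Omega>)\<close>. For an element \<open>g\<close> of the
  group, \<open>(g\<Omega> - \<epsilon>\<Omega>)(g\<Omega> + \<epsilon>\<Omega>) = 0\<close> with \<open>\<epsilon> = det g = \<plusminus>1\<close>, and the leading term of \<open>g\<Omega>\<close>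
  tells which factor vanishes.
\<close>

section \<open>Parity in Grassmann algebras\<close>

text \<open>The product of \<open>Delta\<close> and \<open>Fsqrt\<close> is already a square root of
  det Q, but its expansion can contain negative powers of \<open>Delta\<close>; the factor (det Q)^n
  supplies Delta^(2n), which is enough to clear them. This is where the exponent n comes from. The
  principle for derivations is applied to three families: elements of \<open>osp\<close>; partial
  derivatives in generators outside the range of S(m), which gives membership in
  \<open>superalg\<close>; and the Euler derivation, which gives the degree. An odd element of
  \<open>osp\<close> acts by an odd superderivation, but the product rule is needed only for an even
  first factor, where it carries no sign. Two obstacles shape the rest. Determinants need a
  commutative ring, while the Grassmann algebra is only supercommutative; the even elements are
  therefore made into a type of their own. And \<open>Delta\<close> is multiplied by the determinant
  of the orthogonal block, whereas the claim speaks of the determinant on V, so the symplectic block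
  has to be shown to have determinant 1.\<close>

lemmas coef_zero [simp] = zero_grassmann.rep_eq
lemmas coef_one = one_grassmann.rep_eq
lemmas coef_plus [simp] = plus_grassmann.rep_eq
lemmas coef_uminus [simp] = uminus_grassmann.rep_eq
lemmas coef_times = times_grassmann.rep_eq

lemma coef_minus [simp]: "coef (f - g) A = coef f A - coef g A"
  unfolding minus_grassmann_def coef_plus coef_uminus by simp

lemma coef_sum: "coef (sum f I) A = (\<Sum>i\<in>I. coef (f i) A)"
  by (induction I rule: infinite_finite_induct) auto

lemma coef_times_empty [simp]: "coef (f * g) {} = coef f {} * coef g {}"
  by (simp add: coef_times)

lemma coef_power_empty [simp]: "coef (f ^ k) {} = coef f {} ^ k"
  by (induction k) (auto simp: coef_one)

lemma coef_of_nat_times [simp]: "coef (of_nat k * f) A = of_nat k * coef f A"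
  by (induction k) (auto simp: distrib_right)

lemma coef_gconst: "coef (gconst c) A = (if A = {} then c else 0)"
  by (simp add: gconst.rep_eq)

lemma gconst_zero [simp]: "gconst 0 = 0"
  by (rule grassmann_eqI) (simp add: coef_gconst)

lemma gconst_one [simp]: "gconst 1 = 1"
  by (rule grassmann_eqI) (simp add: coef_gconst coef_one)

lemma gconst_add: "gconst (a + b) = gconst a + gconst b"
  by (rule grassmann_eqI) (simp add: coef_gconst)

lemma gconst_uminus: "gconst (- a) = - gconst a"
  by (rule grassmann_eqI) (simp add: coef_gconst)

lemma gconst_mult: "gconst (a * b) = gconst a * gconst b"
  by (rule grassmann_eqI) (auto simp add: coef_gconst_times coef_gconst)

lemma gconst_sum: "gconst (sum f I) = (\<Sum>i\<in>I. gconst (f i))"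
  by (induction I rule: infinite_finite_induct) (auto simp: gconst_add)

lemma gconst_power: "gconst (a ^ k) = gconst a ^ k"
  by (induction k) (auto simp: gconst_mult)

text \<open>The same notion as \<open>sparity\<close>, for arbitrary generators and coefficients:
  parity is also needed in the localisation and over constant coefficients. Writing it as evenness
  of a sum makes parities additive.\<close>

definition gparity :: "nat \<Rightarrow> ('i, 'r::zero) grassmann \<Rightarrow> bool" where
  "gparity r f \<longleftrightarrow> (\<forall>A. coef f A \<noteq> 0 \<longrightarrow> even (card A + r))"

lemma sparity_iff_gparity: "sparity r f \<longleftrightarrow> gparity r f"
proof -
  have "card A mod 2 = r mod 2 \<longleftrightarrow> even (card A + r)" for A :: "gen set" by presburger
  then show ?thesis by (simp add: sparity_def gparity_def)
qed

lemma gparity_zero [simp]: "gparity r 0"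
  by (simp add: gparity_def)

lemma gparity_gconst [simp]: "gparity 0 (gconst c)"
  by (auto simp: gparity_def coef_gconst)

lemma gparity_one [simp]: "gparity 0 1"
  by (auto simp: gparity_def coef_one)

lemma gparity_gtheta [simp]: "gparity (Suc 0) (gtheta v)"
  by (auto simp: gparity_def gtheta.rep_eq split: if_splits)

lemma gparity_add: "gparity r f \<Longrightarrow> gparity r g \<Longrightarrow> gparity r (f + g)"
  unfolding gparity_def by (metis add.right_neutral coef_plus)

lemma gparity_uminus: "gparity r f \<Longrightarrow> gparity r (- f)"
  by (auto simp: gparity_def)

lemma gparity_minus: "gparity r f \<Longrightarrow> gparity r g \<Longrightarrow> gparity r (f - g)"
  by (metis gparity_add gparity_uminus minus_grassmann_def)

lemma gparity_sum: "(\<And>i. i \<in> I \<Longrightarrow> gparity r (f i)) \<Longrightarrow> gparity r (sum f I)"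
  by (induction I rule: infinite_finite_induct) (auto intro: gparity_add)

lemma coef_times_nonzeroE:
  assumes "coef (f * g) S \<noteq> 0"
  obtains A where "finite S" "A \<subseteq> S" "coef f A \<noteq> 0" "coef g (S - A) \<noteq> 0"
proof -
  have "finite S" using assms coef_infinite by blast
  from assms obtain A where "A \<in> Pow S" "ksign A (S - A) * coef f A * coef g (S - A) \<noteq> 0"
    unfolding coef_times by (rule sum.not_neutral_contains_not_neutral)
  with \<open>finite S\<close> show ?thesis by (intro that [of A]) auto
qed

lemma gparity_mult:
  assumes f: "gparity r f" and g: "gparity s g"
  shows "gparity (r + s) (f * g)"
  unfolding gparity_def
proof (intro allI impI)
  fix S assume "coef (f * g) S \<noteq> 0"
  then obtain A where fin: "finite S" and A: "A \<subseteq> S" "coef f A \<noteq> 0" "coef g (S - A) \<noteq> 0"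
    by (rule coef_times_nonzeroE)
  then have "even (card A + r)" "even (card (S - A) + s)" using f g by (auto simp: gparity_def)
  moreover have "card S = card A + card (S - A)"
    using A(1) fin by (simp add: card_Diff_subset card_mono finite_subset)
  ultimately show "even (card S + (r + s))" by presburger
qed

lemma gparity_cong: "gparity r f \<Longrightarrow> even (r + s) \<Longrightarrow> gparity s f"
  by (auto simp: gparity_def)

lemma gparity_mult_even: "gparity 0 f \<Longrightarrow> gparity 0 g \<Longrightarrow> gparity 0 (f * g)"
  using gparity_mult [of 0 f 0 g] by simp

lemma gparity_mult_odd: "gparity (Suc 0) f \<Longrightarrow> gparity (Suc 0) g \<Longrightarrow> gparity 0 (f * g)"
  using gparity_mult [of "Suc 0" f "Suc 0" g] by (rule gparity_cong) auto

lemma gparity_gconst_mult: "gparity r f \<Longrightarrow> gparity r (gconst c * f)"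
  unfolding gparity_def coef_gconst_times by (metis mult_zero_right)

lemma gparity_power: "gparity 0 f \<Longrightarrow> gparity 0 (f ^ k)"
  by (induction k) (auto intro: gparity_mult_even)

lemma gparity_Xgen: "gparity (idx_parity m a) (Xgen m a t)"
  by (simp add: Xgen_def idx_parity_def)

text \<open>As A and B are disjoint, every pair in the product of A and B is an inversion in exactly
  one of the two orders.\<close>

lemma inversions_swap:
  assumes A: "finite A" and B: "finite B" and disj: "A \<inter> B = {}"
  shows "inversions A B + inversions B A = card A * card B"
proof -
  let ?P = "{(a, b). a \<in> A \<and> b \<in> B \<and> b < a}" and ?Q = "{(a, b). a \<in> A \<and> b \<in> B \<and> a < b}"
  have swap: "{(b, a). b \<in> B \<and> a \<in> A \<and> a < b} = prod.swap ` ?Q" by auto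
  have Q: "inversions B A = card ?Q"
    unfolding inversions_def swap by (rule card_image) simp
  have Un: "?P \<union> ?Q = A \<times> B"
    using disj by (auto simp: neq_iff)
  have fin: "finite (?P \<union> ?Q)" unfolding Un using A B by simp
  have "card ?P + card ?Q = card (?P \<union> ?Q)"
    by (rule card_Un_disjoint [symmetric]) (use fin in auto)
  then show ?thesis unfolding Q unfolding inversions_def by (simp only: Un card_cartesian_product)
qed

lemma ksign_swap:
  assumes "finite A" "finite B" "A \<inter> B = {}"
  shows "ksign A B = (- 1) ^ (card A * card B) * ksign B A"
  unfolding ksign_def inversions_swap [OF assms, symmetric] power_add [symmetric]
  by (rule minus_one_power_cong) presburger

text \<open>Replacing A by its complement in S indexes both products by the same sets, so the
  commutation rules reduce to comparing signs term by term.\<close>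

lemma coef_times_flip:
  "coef (g * f) S = (\<Sum>A\<in>Pow S. ksign (S - A) A * coef f A * coef g (S - A))"
proof -
  have "coef (g * f) S = (\<Sum>A\<in>Pow S. ksign (S - A) A * coef g (S - A) * coef f A)"
    unfolding coef_times
    by (rule sum.reindex_bij_witness [of _ "\<lambda>A. S - A" "\<lambda>A. S - A"]) (simp_all add: double_diff)
  then show ?thesis by (simp add: mult_ac)
qed

lemma gparity_even_commute:
  assumes f: "gparity 0 f"
  shows "f * g = g * f"
proof (rule grassmann_eqI)
  fix S
  show "coef (f * g) S = coef (g * f) S"
  proof (cases "finite S")
    case True
    have "ksign A (S - A) * coef f A = ksign (S - A) A * coef f A" if "A \<subseteq> S" for A
    proof (cases "coef f A = 0")
      case False
      then have "even (card A)" using f by (auto simp: gparity_def)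
      moreover have "finite A" using True that finite_subset by blast
      ultimately show ?thesis using True that ksign_swap [of A "S - A", where 'b = 'b] by auto
    qed simp
    then show ?thesis unfolding coef_times_flip [of g f] coef_times [of f g]
      by (intro sum.cong refl) auto
  qed (simp add: coef_infinite)
qed

lemma gparity_odd_anticommute:
  assumes f: "gparity (Suc 0) f" and g: "gparity (Suc 0) g"
  shows "f * g = - (g * f)"
proof (rule grassmann_eqI)
  fix S
  show "coef (f * g) S = coef (- (g * f)) S"
  proof (cases "finite S")
    case True
    have "ksign A (S - A) * coef f A * coef g (S - A) = - (ksign (S - A) A * coef f A * coef g (S - A))"
      if "A \<subseteq> S" for A
    proof (cases "coef f A = 0 \<or> coef g (S - A) = 0")
      case False
      then have "odd (card A)" "odd (card (S - A))" using f g by (auto simp: gparity_def)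
      moreover have "finite A" using True that finite_subset by blast
      ultimately show ?thesis using True that ksign_swap [of A "S - A", where 'b = 'b] by auto
    qed auto
    then have "coef (f * g) S = (\<Sum>A\<in>Pow S. - (ksign (S - A) A * coef f A * coef g (S - A)))"
      unfolding coef_times by (intro sum.cong refl) auto
    then show ?thesis unfolding coef_uminus coef_times_flip [where f = f and g = g] by (simp add: sum_negf)
  qed (simp add: coef_infinite)
qed

text \<open>Anticommuting with itself only makes twice the square vanish; the hypothesis on 2 is
  what allows cancelling.\<close>

lemma gparity_odd_square:
  fixes f :: "('i::linorder, 'r::idom) grassmann"
  assumes "gparity (Suc 0) f" and two: "(2 :: 'r) \<noteq> 0"
  shows "f * f = 0"
proof (rule grassmann_eqI)
  fix S
  have "coef (f * f) S = - coef (f * f) S"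
    using gparity_odd_anticommute [OF assms(1,1)] by (metis coef_uminus)
  then have "2 * coef (f * f) S = 0" by (metis add.right_inverse mult_2)
  with two show "coef (f * f) S = coef 0 S" by simp
qed

text \<open>Look at a component of lowest degree of the other factor.\<close>

lemma grassmann_mult_eq_0:
  fixes f g :: "('i::linorder, 'r::idom) grassmann"
  assumes "f * g = 0" and f: "coef f {} \<noteq> 0"
  shows "g = 0"
proof (rule grassmann_eqI)
  fix S
  show "coef g S = coef 0 S"
  proof (cases "finite S")
    case True
    then show ?thesis
    proof (induction S rule: finite_psubset_induct)
      case (psubset S)
      have "0 = coef (f * g) S" using assms by simp
      also have "\<dots> = (\<Sum>A\<in>Pow S. if A = {} then coef f {} * coef g S else 0)"
        unfolding coef_times
      proof (rule sum.cong [OF refl])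
        fix A assume "A \<in> Pow S"
        then show "ksign A (S - A) * coef f A * coef g (S - A) =
          (if A = {} then coef f {} * coef g S else 0)"
          using psubset.IH [of "S - A"] by auto
      qed
      finally show ?case using f psubset.hyps by simp
    qed
  qed (simp add: coef_infinite)
qed

text \<open>Only finitely many generators occur in f, and without a constant term each factor uses
  up at least one of them; a product of more factors than generators must repeat one.\<close>

lemma grassmann_nilpotent:
  fixes f :: "('i::linorder, 'r::comm_ring_1) grassmann"
  assumes f: "coef f {} = 0"
  shows "\<exists>N. \<forall>k\<ge>N. f ^ k = 0"
proof -
  define G where "G = \<Union>{A. coef f A \<noteq> 0}"
  have G: "finite G"
    unfolding G_def by (rule finite_Union) (use finite_coef [of f] coef_infinite [of _ f] in auto)
  have *: "A \<subseteq> G \<and> k \<le> card A" if "coef (f ^ k) A \<noteq> 0" for k A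
    using that
  proof (induction k arbitrary: A)
    case 0
    then show ?case by (auto simp: coef_one split: if_splits)
  next
    case (Suc k)
    from Suc.prems obtain B
      where fin: "finite A" and B: "B \<subseteq> A" "coef f B \<noteq> 0" "coef (f ^ k) (A - B) \<noteq> 0"
      unfolding power_Suc by (rule coef_times_nonzeroE)
    then have "A - B \<subseteq> G" "k \<le> card (A - B)" using Suc.IH by auto
    moreover have "B \<subseteq> G" using B(2) by (auto simp: G_def)
    moreover have "B \<noteq> {}" using B(2) f by auto
    then have "card (A - B) < card A"
      using B(1) fin by (intro psubset_card_mono) auto
    ultimately show ?case by auto
  qed
  have "f ^ k = 0" if "k \<ge> Suc (card G)" for k
  proof (rule grassmann_eqI, rule ccontr)
    fix A assume "coef (f ^ k) A \<noteq> coef 0 A"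
    then have "A \<subseteq> G \<and> k \<le> card A" using * by simp
    then show False using that card_mono [OF G, of A] by simp
  qed
  then show ?thesis by blast
qed

section \<open>Homomorphisms out of a Grassmann algebra\<close>

lift_definition gsingle :: "'i set \<Rightarrow> 'r \<Rightarrow> ('i, 'r::zero) grassmann"
  is "\<lambda>A c B. if B = A \<and> finite A then c else 0" by auto

lemma gsingle_zero [simp]: "gsingle A 0 = 0"
  by (rule grassmann_eqI) (simp add: gsingle.rep_eq)

lemma gsingle_sum: "(\<Sum>A | coef f A \<noteq> 0. gsingle A (coef f A)) = f"
proof (rule grassmann_eqI)
  fix B
  have "coef (\<Sum>A | coef f A \<noteq> 0. gsingle A (coef f A)) B =
      (\<Sum>A | coef f A \<noteq> 0. if A = B then coef f B else 0)"
    unfolding coef_sum by (rule sum.cong) (auto simp: gsingle.rep_eq coef_infinite)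
  then show "coef (\<Sum>A | coef f A \<noteq> 0. gsingle A (coef f A)) B = coef f B"
    using finite_coef [of f] by simp
qed

lemma gsingle_mult:
  assumes "finite A" "finite B"
  shows "gsingle A a * gsingle B b =
    (if A \<inter> B = {} then gsingle (A \<union> B) (ksign A B * (a * b)) else 0)"
proof (rule grassmann_eqI)
  fix S
  show "coef (gsingle A a * gsingle B b) S =
    coef (if A \<inter> B = {} then gsingle (A \<union> B) (ksign A B * (a * b)) else 0) S"
  proof (cases "finite S")
    case True
    have "coef (gsingle A a * gsingle B b) S =
        (\<Sum>C\<in>Pow S. if C = A then (if S - A = B then ksign A B * (a * b) else 0) else 0)"
      unfolding coef_times by (rule sum.cong) (use assms in \<open>auto simp: gsingle.rep_eq\<close>)
    then show ?thesis using True assms by (auto simp: gsingle.rep_eq)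
  qed (simp add: coef_infinite)
qed

definition gprod :: "('i::linorder \<Rightarrow> 'a::monoid_mult) \<Rightarrow> 'i set \<Rightarrow> 'a" where
  "gprod \<tau> A = prod_list (map \<tau> (sorted_list_of_set A))"

text \<open>Coefficients are mapped as a whole by h, and the target may be any ring. Both the group
  action and the substitution of u for the odd generators are instances.\<close>

definition gsubst :: "('r::zero \<Rightarrow> 'a::ring_1) \<Rightarrow> ('i::linorder \<Rightarrow> 'a) \<Rightarrow> ('i, 'r) grassmann \<Rightarrow> 'a" where
  "gsubst h \<tau> f = (\<Sum>A | coef f A \<noteq> 0. h (coef f A) * gprod \<tau> A)"

lemma gprod_empty [simp]: "gprod \<tau> {} = 1"
  by (simp add: gprod_def)

text \<open>For equal indices anticommutation says only that twice the square vanishes, so the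
  vanishing of squares is a separate assumption.\<close>

locale anticommuting =
  fixes \<tau> :: "'i::linorder \<Rightarrow> 'a::ring_1"
  assumes anticommute: "\<tau> v * \<tau> w = - (\<tau> w * \<tau> v)" and square_zero: "\<tau> v * \<tau> v = 0"
begin

text \<open>On its way to its sorted position, the factor at v passes precisely the factors with
  smaller index, and each of them contributes one sign.\<close>

lemma prod_list_insort:
  assumes "sorted xs" "distinct xs" "v \<notin> set xs"
  shows "\<tau> v * prod_list (map \<tau> xs) =
    (- 1) ^ card {b \<in> set xs. b < v} * prod_list (map \<tau> (insort v xs))"
  using assms
proof (induction xs)
  case (Cons x xs)
  show ?case
  proof (cases "v \<le> x")
    case True
    then have "{b \<in> set (x # xs). b < v} = {}" using Cons.prems by auto
    then have "card {b \<in> set (x # xs). b < v} = 0" by (simp only: card.empty)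
    moreover have "insort v (x # xs) = v # x # xs" using True by simp
    ultimately show ?thesis by (simp only: power_0 list.map prod_list.Cons mult_1_left)
  next
    case False
    then have "{b \<in> set (x # xs). b < v} = insert x {b \<in> set xs. b < v}" by auto
    then have card: "card {b \<in> set (x # xs). b < v} = Suc (card {b \<in> set xs. b < v})"
      using Cons.prems by simp
    have "\<tau> v * prod_list (map \<tau> (x # xs)) = (\<tau> v * \<tau> x) * prod_list (map \<tau> xs)"
      by (simp add: mult.assoc)
    also have "\<dots> = - (\<tau> x * (\<tau> v * prod_list (map \<tau> xs)))"
      by (subst anticommute) (simp add: mult.assoc)
    also have "\<tau> v * prod_list (map \<tau> xs) =
      (- 1) ^ card {b \<in> set xs. b < v} * prod_list (map \<tau> (insort v xs))"
      using Cons by simp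
    finally show ?thesis
      using False card by (cases "even (card {b \<in> set xs. b < v})") simp_all
  qed
qed simp

lemma prod_list_member:
  "v \<in> set xs \<Longrightarrow> \<tau> v * prod_list (map \<tau> xs) = 0"
proof (induction xs)
  case (Cons x xs)
  have "\<tau> v * prod_list (map \<tau> (x # xs)) = (\<tau> v * \<tau> x) * prod_list (map \<tau> xs)"
    by (simp add: mult.assoc)
  also have "\<dots> = 0"
  proof (cases "v = x")
    case False
    then have "\<tau> v * prod_list (map \<tau> xs) = 0" using Cons by auto
    then show ?thesis by (subst anticommute) (simp add: mult.assoc)
  qed (simp add: square_zero)
  finally show ?case .
qed simp

lemma gprod_insert:
  assumes "finite A" "v \<notin> A"
  shows "\<tau> v * gprod \<tau> A = ksign {v} A * gprod \<tau> (insert v A)"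
  using prod_list_insort [of "sorted_list_of_set A" v] assms
  by (simp add: gprod_def ksign_single_left)

lemma gprod_member: "finite A \<Longrightarrow> v \<in> A \<Longrightarrow> \<tau> v * gprod \<tau> A = 0"
  unfolding gprod_def by (rule prod_list_member) simp

lemma gprod_insert_less:
  assumes "finite A" "\<forall>a\<in>A. v < a"
  shows "gprod \<tau> (insert v A) = \<tau> v * gprod \<tau> A"
proof -
  have "{b \<in> A. b < v} = {}" using assms by auto
  then have "ksign {v} A = (1 :: 'a)" by (simp only: ksign_single_left card.empty power_0)
  then show ?thesis using gprod_insert [of A v] assms by auto
qed

text \<open>Induction on A by its least element v: being least, v stands in front of the product
  over A without a sign, and \<open>gprod_insert\<close> then moves it into the union, or kills the
  product if v lies in B.\<close>

lemma gprod_mult: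
  assumes "finite A" "finite B"
  shows "gprod \<tau> A * gprod \<tau> B = (if A \<inter> B = {} then ksign A B * gprod \<tau> (A \<union> B) else 0)"
  using assms(1)
proof (induction A rule: finite_linorder_min_induct)
  case (insert v A)
  have "{b \<in> A. b < v} = {}" using insert.hyps by auto
  then have 1: "ksign {v} A = (1 :: 'a)" by (simp only: ksign_single_left card.empty power_0)
  have vA: "v \<notin> A" using insert.hyps by auto
  have comm: "\<tau> v * ksign C D = ksign C D * \<tau> v" for C D :: "'i set"
    by (cases "even (inversions C D)") (simp_all add: ksign_def)
  have *: "gprod \<tau> (insert v A) * gprod \<tau> B = \<tau> v * (gprod \<tau> A * gprod \<tau> B)"
    using insert.hyps by (simp add: gprod_insert_less mult.assoc)
  show ?case
  proof (cases "A \<inter> B = {}")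
    case disj: True
    then have **: "gprod \<tau> (insert v A) * gprod \<tau> B = ksign A B * (\<tau> v * gprod \<tau> (A \<union> B))"
      unfolding * insert.IH by (simp add: comm flip: mult.assoc)
    show ?thesis
    proof (cases "v \<in> B")
      case True
      then show ?thesis using insert.hyps assms(2) by (simp add: ** gprod_member)
    next
      case False
      have "ksign (insert v A) B = ksign {v} B * (ksign A B :: 'a)"
        using ksign_Un_left [of "{v}" A B] insert.hyps vA assms(2) by simp
      moreover have "ksign {v} (A \<union> B) = (ksign {v} B :: 'a)"
        using ksign_Un_right [of "{v}" A B, where 'b = 'a] insert.hyps assms(2) disj 1 by simp
      moreover have "ksign A B * ksign {v} B = ksign {v} B * (ksign A B :: 'a)"
        unfolding ksign_def power_add [symmetric] by (simp add: add.commute)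
      ultimately show ?thesis
        using False vA insert.hyps assms(2) disj by (simp add: ** gprod_insert flip: mult.assoc)
    qed
  next
    case False
    then have "insert v A \<inter> B \<noteq> {}" by auto
    then show ?thesis unfolding * insert.IH using False by simp
  qed
qed simp

end

locale grassmann_hom = anticommuting \<tau>
  for \<tau> :: "'i::linorder \<Rightarrow> 'a::ring_1" +
  fixes h :: "'r::comm_ring_1 \<Rightarrow> 'a"
  assumes h_add: "h (a + b) = h a + h b" and h_mult: "h (a * b) = h a * h b" and h_one: "h 1 = 1"
    and h_commute: "h c * \<tau> v = \<tau> v * h c"
begin

lemma h_zero: "h 0 = 0"
  using h_add [of 0 0] by simp

lemma h_uminus: "h (- a) = - h a"
  using h_add [of a "- a"] h_zero by (simp add: minus_unique)

lemma h_ksign: "h (ksign A B) = ksign A B"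
  by (cases "even (inversions A B)") (simp_all add: ksign_def h_uminus h_one)

lemma h_gprod: "h c * gprod \<tau> A = gprod \<tau> A * h c"
proof -
  have "h c * prod_list (map \<tau> xs) = prod_list (map \<tau> xs) * h c" for xs
    by (induction xs) (simp_all add: h_commute mult.assoc flip: mult.assoc [of "h c"])
  then show ?thesis by (simp add: gprod_def)
qed

lemma gsubst_finite_superset:
  assumes "finite F" "{A. coef f A \<noteq> 0} \<subseteq> F"
  shows "gsubst h \<tau> f = (\<Sum>A\<in>F. h (coef f A) * gprod \<tau> A)"
  unfolding gsubst_def by (rule sum.mono_neutral_left) (use assms in \<open>auto simp: h_zero\<close>)

lemma gsubst_zero: "gsubst h \<tau> 0 = 0"
  by (simp add: gsubst_def)

lemma gsubst_add: "gsubst h \<tau> (f + g) = gsubst h \<tau> f + gsubst h \<tau> g"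
proof -
  let ?F = "{A. coef f A \<noteq> 0} \<union> {A. coef g A \<noteq> 0}"
  have F: "finite ?F" by (simp add: finite_coef)
  show ?thesis
    by (subst (1 2 3) gsubst_finite_superset [OF F])
      (auto simp: h_add distrib_right sum.distrib)
qed

lemma gsubst_sum: "gsubst h \<tau> (sum f I) = (\<Sum>i\<in>I. gsubst h \<tau> (f i))"
  by (induction I rule: infinite_finite_induct) (auto simp: gsubst_add gsubst_zero)

lemma gsubst_uminus: "gsubst h \<tau> (- f) = - gsubst h \<tau> f"
  using gsubst_add [of f "- f"] gsubst_zero by (simp add: minus_unique)

lemma gsubst_minus: "gsubst h \<tau> (f - g) = gsubst h \<tau> f - gsubst h \<tau> g"
  unfolding minus_grassmann_def gsubst_add gsubst_uminus by (rule add_uminus_conv_diff)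

lemma gsubst_gsingle:
  assumes "finite A"
  shows "gsubst h \<tau> (gsingle A c) = h c * gprod \<tau> A"
  by (subst gsubst_finite_superset [of "{A}"]) (use assms in \<open>auto simp: gsingle.rep_eq\<close>)

text \<open>Both sides are biadditive, so monomials suffice. For these, \<open>gprod_mult\<close>
  produces in the target the sign that multiplication of monomials produces in the source; the
  coefficients in between move past the generators by \<open>h_commute\<close>.\<close>

lemma gsubst_mult: "gsubst h \<tau> (f * g) = gsubst h \<tau> f * gsubst h \<tau> g"
proof -
  have single: "gsubst h \<tau> (gsingle A a * gsingle B b) =
      gsubst h \<tau> (gsingle A a) * gsubst h \<tau> (gsingle B b)" if "finite A" "finite B" for A B a b
  proof -
    have "gsubst h \<tau> (gsingle A a) * gsubst h \<tau> (gsingle B b) =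
        h a * (gprod \<tau> A * h b) * gprod \<tau> B"
      using that by (simp add: gsubst_gsingle mult.assoc)
    also have "\<dots> = h a * h b * (gprod \<tau> A * gprod \<tau> B)"
      by (simp add: mult.assoc flip: h_gprod)
    also have "\<dots> = gsubst h \<tau> (gsingle A a * gsingle B b)"
    proof (cases "A \<inter> B = {}")
      case True
      have "h a * h b * ksign A B = ksign A B * h a * h b"
        by (cases "even (inversions A B)") (simp_all add: ksign_def)
      then show ?thesis using that True
        by (simp add: gprod_mult gsingle_mult gsubst_gsingle h_mult h_ksign flip: mult.assoc)
    qed (use that in \<open>simp add: gprod_mult gsingle_mult gsubst_zero\<close>)
    finally show ?thesis ..
  qed
  have fin: "finite A" if "coef f A \<noteq> 0" for A and f :: "('i, 'r) grassmann"
    using that coef_infinite by blast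
  have "gsubst h \<tau> (f * g) = gsubst h \<tau>
      ((\<Sum>A | coef f A \<noteq> 0. gsingle A (coef f A)) * (\<Sum>B | coef g B \<noteq> 0. gsingle B (coef g B)))"
    unfolding gsingle_sum ..
  also have "\<dots> = (\<Sum>A | coef f A \<noteq> 0. \<Sum>B | coef g B \<noteq> 0.
      gsubst h \<tau> (gsingle A (coef f A) * gsingle B (coef g B)))"
    by (simp only: sum_product gsubst_sum)
  also have "\<dots> = (\<Sum>A | coef f A \<noteq> 0. \<Sum>B | coef g B \<noteq> 0.
      gsubst h \<tau> (gsingle A (coef f A)) * gsubst h \<tau> (gsingle B (coef g B)))"
    by (intro sum.cong refl single) (auto intro: fin)
  also have "\<dots> = gsubst h \<tau> (\<Sum>A | coef f A \<noteq> 0. gsingle A (coef f A))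
      * gsubst h \<tau> (\<Sum>B | coef g B \<noteq> 0. gsingle B (coef g B))"
    by (simp only: sum_product gsubst_sum)
  finally show ?thesis unfolding gsingle_sum .
qed

lemma gsubst_gconst: "gsubst h \<tau> (gconst c) = h c"
  by (subst gsubst_finite_superset [of "{{}}"]) (auto simp: coef_gconst)

lemma gsubst_gtheta: "gsubst h \<tau> (gtheta v) = \<tau> v"
  by (subst gsubst_finite_superset [of "{{v}}"]) (auto simp: gtheta.rep_eq h_one gprod_def)

lemma gsubst_one: "gsubst h \<tau> 1 = 1"
  using gsubst_gconst [of 1] by (simp add: h_one)

lemma gsubst_power: "gsubst h \<tau> (f ^ k) = gsubst h \<tau> f ^ k"
  by (induction k) (simp_all add: gsubst_one gsubst_mult)

end

section \<open>The even subalgebra and determinants over it\<close>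

text \<open>Even elements commute with each other, so this type is an instance of
  \<open>comm_ring_1\<close>, and the theory of \<open>det\<close> applies to matrices with even
  entries.\<close>

typedef (overloaded) ('i, 'r) geven =
  "{f :: ('i::linorder, 'r::comm_ring_1) grassmann. gparity 0 f}"
  morphisms of_geven Abs_geven
  by (rule exI [of _ 0]) simp

setup_lifting type_definition_geven

instantiation geven :: (linorder, comm_ring_1) comm_ring_1
begin
lift_definition zero_geven :: "('a, 'b) geven" is 0 by simp
lift_definition one_geven :: "('a, 'b) geven" is 1 by simp
lift_definition plus_geven :: "('a, 'b) geven \<Rightarrow> ('a, 'b) geven \<Rightarrow> ('a, 'b) geven" is "(+)"
  by (rule gparity_add)
lift_definition uminus_geven :: "('a, 'b) geven \<Rightarrow> ('a, 'b) geven" is uminus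
  by (rule gparity_uminus)
lift_definition minus_geven :: "('a, 'b) geven \<Rightarrow> ('a, 'b) geven \<Rightarrow> ('a, 'b) geven" is "(-)"
  by (rule gparity_minus)
lift_definition times_geven :: "('a, 'b) geven \<Rightarrow> ('a, 'b) geven \<Rightarrow> ('a, 'b) geven" is "(*)"
  by (rule gparity_mult_even)
instance
proof
  fix a b c :: "('a, 'b) geven"
  show "a * b = b * a" by transfer (rule gparity_even_commute)
  show "a * b * c = a * (b * c)" by transfer (rule mult.assoc)
  show "(a + b) * c = a * c + b * c" by transfer (rule distrib_right)
  show "a + b + c = a + (b + c)" by transfer (rule add.assoc)
  show "a + b = b + a" by transfer (rule add.commute)
  show "a - b = a + - b" by transfer (rule minus_grassmann_def)
qed (transfer, simp; fail)+
end

lemma gparity_of_geven [simp]: "gparity 0 (of_geven x)"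
  using of_geven by auto

lemma of_geven_Abs: "gparity 0 f \<Longrightarrow> of_geven (Abs_geven f) = f"
  by (simp add: Abs_geven_inverse)

lemma of_geven_sum: "of_geven (sum f I) = (\<Sum>i\<in>I. of_geven (f i))"
  by (induction I rule: infinite_finite_induct) (simp_all add: zero_geven.rep_eq plus_geven.rep_eq)

lemma of_geven_prod_list: "of_geven (prod_list xs) = prod_list (map of_geven xs)"
  by (induction xs) (simp_all add: one_geven.rep_eq times_geven.rep_eq)

lemma of_geven_power: "of_geven (x ^ k) = of_geven x ^ k"
  by (induction k) (simp_all add: one_geven.rep_eq times_geven.rep_eq)

lemma of_geven_of_nat: "of_geven (of_nat k) = of_nat k"
  by (induction k) (simp_all add: zero_geven.rep_eq one_geven.rep_eq plus_geven.rep_eq)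

lemma sdet_hom:
  fixes h :: "'a::ring_1 \<Rightarrow> 'b::ring_1"
  assumes add: "\<And>a b. h (a + b) = h a + h b" and mult: "\<And>a b. h (a * b) = h a * h b" and one: "h 1 = 1"
  shows "h (sdet m M) = sdet m (\<lambda>i j. h (M i j))"
proof -
  have zero: "h 0 = 0" using add [of 0 0] by simp
  have uminus: "h (- a) = - h a" for a using add [of a "- a"] zero by (simp add: minus_unique)
  have sum: "h (sum f I) = (\<Sum>i\<in>I. h (f i))" for f and I :: "(nat \<Rightarrow> nat) set"
    by (induction I rule: infinite_finite_induct) (simp_all add: add zero)
  have sign: "h (of_int (sign p)) = of_int (sign p)" for p :: "nat \<Rightarrow> nat"
    by (simp add: sign_def uminus one)
  have prod: "h (prod_list xs) = prod_list (map h xs)" for xs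
    by (induction xs) (simp_all add: mult one)
  show ?thesis by (simp add: sdet_def sum mult sign prod comp_def)
qed

lemma sdet_comm: "sdet m M = det (mat m m (\<lambda>(i, j). M i j))"
  for M :: "nat \<Rightarrow> nat \<Rightarrow> 'a::comm_ring_1"
proof -
  have "of_int (sign p) * prod_list (map (\<lambda>i. M i (p i)) [0..<m]) =
      signof p * (\<Prod>i = 0..<m. mat m m (\<lambda>(i, j). M i j) $$ (i, p i))"
    if p: "p permutes {0..<m}" for p
  proof -
    have "(\<Prod>i = 0..<m. mat m m (\<lambda>(i, j). M i j) $$ (i, p i)) = (\<Prod>i = 0..<m. M i (p i))"
      using permutes_in_image [OF p] by (intro prod.cong refl) auto
    also have "\<dots> = prod_list (map (\<lambda>i. M i (p i)) [0..<m])"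
      using prod.distinct_set_conv_list [of "[0..<m]" "\<lambda>i. M i (p i)"] by simp
    finally show ?thesis by simp
  qed
  then show ?thesis by (simp add: sdet_def det_def lessThan_atLeast0)
qed

lemma sdet_of_geven: "sdet m (\<lambda>i j. of_geven (M i j)) = of_geven (det (mat m m (\<lambda>(i, j). M i j)))"
  unfolding sdet_comm [symmetric]
  by (rule sdet_hom [symmetric]) (simp_all add: plus_geven.rep_eq times_geven.rep_eq one_geven.rep_eq)

lemma sdet_cong: "(\<And>i j. i < m \<Longrightarrow> j < m \<Longrightarrow> M i j = N i j) \<Longrightarrow> sdet m M = sdet m N"
  unfolding sdet_def
  by (intro sum.cong refl arg_cong2 [of _ _ _ _ "(*)"] arg_cong [of _ _ prod_list] map_cong)
    (auto dest: permutes_in_image)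

lemma sdet_det:
  assumes "\<And>i j. i < m \<Longrightarrow> j < m \<Longrightarrow> gparity 0 (M i j)"
  shows "sdet m M = of_geven (det (mat m m (\<lambda>(i, j). Abs_geven (M i j))))"
proof -
  have "sdet m M = sdet m (\<lambda>i j. of_geven (Abs_geven (M i j)))"
    by (rule sdet_cong) (simp add: of_geven_Abs assms)
  then show ?thesis by (simp only: sdet_of_geven)
qed

lemma gparity_sdet: "(\<And>i j. i < m \<Longrightarrow> j < m \<Longrightarrow> gparity 0 (M i j)) \<Longrightarrow> gparity 0 (sdet m M)"
  by (simp add: sdet_det)

text \<open>Even entries lift both matrices to \<open>geven\<close>, where the determinant over a
  commutative ring is multiplicative.\<close>

lemma sdet_mult:
  assumes M: "\<And>i j. i < m \<Longrightarrow> j < m \<Longrightarrow> gparity 0 (M i j)"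
    and N: "\<And>i j. i < m \<Longrightarrow> j < m \<Longrightarrow> gparity 0 (N i j)"
  shows "sdet m (\<lambda>i j. \<Sum>k<m. M i k * N k j) = sdet m M * sdet m N"
proof -
  let ?A = "\<lambda>M. mat m m (\<lambda>(i, j). Abs_geven (M i j))"
  have "Abs_geven (\<Sum>k<m. M i k * N k j) = (\<Sum>k<m. Abs_geven (M i k) * Abs_geven (N k j))"
    if "i < m" "j < m" for i j
  proof -
    have "of_geven (\<Sum>k<m. Abs_geven (M i k) * Abs_geven (N k j)) = (\<Sum>k<m. M i k * N k j)"
      unfolding of_geven_sum times_geven.rep_eq
      using that M N by (intro sum.cong refl) (simp add: of_geven_Abs)
    from arg_cong [OF this, of Abs_geven] show ?thesis by (simp only: of_geven_inverse)
  qed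
  then have eq: "?A (\<lambda>i j. \<Sum>k<m. M i k * N k j) = ?A M * ?A N"
    by (intro eq_matI) (auto simp: scalar_prod_def lessThan_atLeast0)
  have "sdet m (\<lambda>i j. \<Sum>k<m. M i k * N k j) = of_geven (det (?A M * ?A N))"
    unfolding eq [symmetric]
    by (rule sdet_det) (auto intro!: gparity_sum gparity_mult_even M N)
  also have "det (?A M * ?A N) = det (?A M) * det (?A N)"
    by (rule det_mult) auto
  finally show ?thesis using M N by (simp add: times_geven.rep_eq sdet_det)
qed

lemma Abs_geven_gconst_hom:
  "comm_ring_hom (\<lambda>c. Abs_geven (gconst c) :: ('i::linorder, 'r::comm_ring_1) geven)"
proof unfold_locales
  fix a b :: 'r
  show "Abs_geven (gconst (a + b)) = Abs_geven (gconst a) + (Abs_geven (gconst b) :: ('i, 'r) geven)"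
    by (simp add: of_geven_inject [symmetric] of_geven_Abs plus_geven.rep_eq flip: gconst_add)
  show "Abs_geven (gconst (a * b)) = Abs_geven (gconst a) * (Abs_geven (gconst b) :: ('i, 'r) geven)"
    by (simp add: of_geven_inject [symmetric] of_geven_Abs times_geven.rep_eq flip: gconst_mult)
qed (simp_all add: of_geven_inject [symmetric] of_geven_Abs zero_geven.rep_eq one_geven.rep_eq)

lemma sdet_gconst:
  "sdet m (\<lambda>i j. gconst (M i j) :: ('i::linorder, 'r::comm_ring_1) grassmann) =
    gconst (det (mat m m (\<lambda>(i, j). M i j)))"
proof -
  let ?h = "\<lambda>c. Abs_geven (gconst c) :: ('i, 'r) geven"
  have "mat m m (\<lambda>(i, j). ?h (M i j)) = map_mat ?h (mat m m (\<lambda>(i, j). M i j))"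
    by (intro eq_matI) auto
  then have "det (mat m m (\<lambda>(i, j). ?h (M i j))) = ?h (det (mat m m (\<lambda>(i, j). M i j)))"
    by (simp only: comm_ring_hom.hom_det [OF Abs_geven_gconst_hom])
  then show ?thesis by (simp add: sdet_det of_geven_Abs)
qed

section \<open>Evaluation of polynomials\<close>

text \<open>The unordered product over the variables requires a commutative target. It is used with
  \<open>geven\<close>, to let a group element act on the even generators, and with the complex
  numbers, to specialise \<open>Delta\<close>.\<close>

definition peval :: "('r::zero \<Rightarrow> 'b::comm_ring_1) \<Rightarrow> ('v \<Rightarrow> 'b) \<Rightarrow> (('v \<Rightarrow>\<^sub>0 nat) \<Rightarrow>\<^sub>0 'r) \<Rightarrow> 'b" where
  "peval c x p = (\<Sum>\<alpha>\<in>Poly_Mapping.keys p. c (Poly_Mapping.lookup p \<alpha>) *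
     (\<Prod>v\<in>Poly_Mapping.keys \<alpha>. x v ^ Poly_Mapping.lookup \<alpha> v))"

context
  fixes c :: "complex \<Rightarrow> 'b::comm_ring_1" and x :: "gen \<Rightarrow> 'b"
  assumes c: "comm_ring_hom c"
begin

interpretation c: comm_ring_hom c by (rule c)

lemma peval_superset:
  assumes "finite F" "Poly_Mapping.keys p \<subseteq> F"
  shows "peval c x p = (\<Sum>\<alpha>\<in>F. c (Poly_Mapping.lookup p \<alpha>) *
     (\<Prod>v\<in>Poly_Mapping.keys \<alpha>. x v ^ Poly_Mapping.lookup \<alpha> v))"
  unfolding peval_def
  by (rule sum.mono_neutral_left) (use assms in \<open>auto simp: in_keys_iff\<close>)

lemma peval_zero: "peval c x 0 = 0"
  by (simp add: peval_def)

lemma peval_add: "peval c x (p + q) = peval c x p + peval c x q"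
proof -
  let ?F = "Poly_Mapping.keys p \<union> Poly_Mapping.keys q"
  show ?thesis
    using Poly_Mapping.keys_add [of p q]
    by (subst (1 2 3) peval_superset [of ?F])
      (auto simp: lookup_add c.hom_add distrib_right sum.distrib)
qed

lemma peval_sum: "peval c x (sum f I) = (\<Sum>i\<in>I. peval c x (f i))"
  by (induction I rule: infinite_finite_induct) (auto simp: peval_add peval_zero)

lemma peval_single: "peval c x (Poly_Mapping.single \<alpha> a) =
    c a * (\<Prod>v\<in>Poly_Mapping.keys \<alpha>. x v ^ Poly_Mapping.lookup \<alpha> v)"
  by (subst peval_superset [of "{\<alpha>}"]) (auto simp: lookup_single)

lemma prod_keys_add:
  "(\<Prod>v\<in>Poly_Mapping.keys (\<alpha> + \<beta>). x v ^ Poly_Mapping.lookup (\<alpha> + \<beta>) v) =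
    (\<Prod>v\<in>Poly_Mapping.keys \<alpha>. x v ^ Poly_Mapping.lookup \<alpha> v) *
    (\<Prod>v\<in>Poly_Mapping.keys \<beta>. x v ^ Poly_Mapping.lookup \<beta> v)"
proof -
  let ?F = "Poly_Mapping.keys \<alpha> \<union> Poly_Mapping.keys \<beta>"
  have *: "(\<Prod>v\<in>Poly_Mapping.keys \<gamma>. x v ^ Poly_Mapping.lookup \<gamma> v) =
      (\<Prod>v\<in>?F. x v ^ Poly_Mapping.lookup \<gamma> v)" if "Poly_Mapping.keys \<gamma> \<subseteq> ?F" for \<gamma>
    using that by (intro prod.mono_neutral_left) (auto simp: in_keys_iff)
  show ?thesis
    using Poly_Mapping.keys_add [of \<alpha> \<beta>]
    by (subst (1 2 3) *) (auto simp: lookup_add power_add prod.distrib)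
qed

lemma peval_mult: "peval c x (p * q) = peval c x p * peval c x q"
proof -
  have 1: "peval c x (Poly_Mapping.single \<alpha> a * q) = peval c x (Poly_Mapping.single \<alpha> a) * peval c x q"
    for \<alpha> a
    by (subst (1 2) poly_mapping_sum_single [of q])
      (simp only: sum_distrib_left peval_sum mult_single peval_single prod_keys_add c.hom_mult mult_ac)
  show ?thesis
    by (subst (1 2) poly_mapping_sum_single [of p])
      (simp only: sum_distrib_right peval_sum 1)
qed

lemma peval_one: "peval c x 1 = 1"
  using peval_single [of 0 1] by simp

lemma peval_hom: "comm_ring_hom (peval c x)"
  by unfold_locales (simp_all add: peval_add peval_mult peval_zero peval_one)

lemma peval_pconst: "peval c x (pconst a) = c a"
  by (simp add: pconst_def peval_single)

lemma peval_pvar: "peval c x (pvar v) = x v"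
  by (simp add: pvar_def peval_single)

end

section \<open>Products of linear combinations of anticommuting elements\<close>

context
  fixes e :: "nat \<Rightarrow> ('i::linorder, 'r::comm_ring_1) grassmann"
  assumes e: "anticommuting e"
begin

interpretation anticommuting e by (rule e)

text \<open>The factor \<open>e j\<close> anticommutes past each shortened linear form and
  annihilates the component along itself, so behind \<open>e j\<close> these components are
  invisible. In \<open>prod_list_linear\<close> this is what deletes column j.\<close>

lemma prod_list_linear_drop:
  assumes "finite K"
  shows "e j * prod_list (map (\<lambda>i. \<Sum>k\<in>K. gconst (c i k) * e k) xs) =
    e j * prod_list (map (\<lambda>i. \<Sum>k\<in>K - {j}. gconst (c i k) * e k) xs)"
proof (induction xs)
  case (Cons i xs)
  let ?v = "\<lambda>i. \<Sum>k\<in>K. gconst (c i k) * e k" and ?w = "\<lambda>i. \<Sum>k\<in>K - {j}. gconst (c i k) * e k"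
  have swap: "e j * (gconst a * e k) = - (gconst a * e k * e j)" for a k
  proof -
    have "e j * (gconst a * e k) = gconst a * (e j * e k)"
      by (simp only: mult.assoc [symmetric] gconst_commute [of a "e j"])
    then show ?thesis by (subst (asm) anticommute) (simp add: mult.assoc)
  qed
  have w: "e j * ?w i = - (?w i * e j)"
    unfolding sum_distrib_left sum_distrib_right sum_negf [symmetric] by (simp only: swap)
  have v: "e j * ?v i = e j * ?w i"
  proof (cases "j \<in> K")
    case True
    have "e j * (gconst (c i j) * e j) = 0"
      unfolding swap by (simp add: mult.assoc square_zero)
    then show ?thesis using True assms by (simp add: sum.remove [of K j] distrib_left)
  qed simp
  have "e j * prod_list (map ?v (i # xs)) = - (?w i * (e j * prod_list (map ?v xs)))"
    by (simp add: v w flip: mult.assoc)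
  also have "\<dots> = - (?w i * (e j * prod_list (map ?w xs)))"
    by (simp only: Cons)
  also have "\<dots> = e j * prod_list (map ?w (i # xs))"
    by (simp add: w flip: mult.assoc)
  finally show ?case .
qed simp

lemma anticommuting_reindex: "anticommuting (\<lambda>i. e (f i))"
  by unfold_locales (rule anticommute, rule square_zero)

end

text \<open>The determinant as the action on the top exterior power, by Laplace expansion along row
  0: choosing \<open>e j\<close> from the first factor removes column j from all the others, which
  leaves the minor to the induction hypothesis.\<close>

lemma prod_list_linear:
  fixes e :: "nat \<Rightarrow> ('i::linorder, 'r::comm_ring_1) grassmann"
  assumes "anticommuting e" "M \<in> carrier_mat N N"
  shows "prod_list (map (\<lambda>i. \<Sum>j<N. gconst (M $$ (i, j)) * e j) [0..<N]) =
    gconst (det M) * prod_list (map e [0..<N])"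
  using assms
proof (induction N arbitrary: e M)
  case 0
  then show ?case by (simp add: det_def)
next
  case (Suc N)
  interpret anticommuting e by (rule Suc.prems)
  \<comment> \<open>The increasing enumeration of all indices except j, matching the columns of
    \<open>mat_delete\<close>.\<close>
  define skip where "skip = (\<lambda>j k. if k < j then k else Suc k)"
  define v where "v = (\<lambda>i. \<Sum>j<Suc N. gconst (M $$ (i, j)) * e j)"
  have upt: "[0..<Suc N] = 0 # map Suc [0..<N]" by (simp add: map_Suc_upt upt_conv_Cons)
  have rest: "e j * prod_list (map (\<lambda>i. v (Suc i)) [0..<N]) =
      gconst (cofactor M 0 j) * prod_list (map e [0..<Suc N])" if j: "j < Suc N" for j
  proof -
    let ?D = "mat_delete M 0 j" and ?A = "{..<Suc N} - {j}"
    have skip: "(\<Sum>k\<in>?A. gconst (M $$ (Suc i, k)) * e k) =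
        (\<Sum>k<N. gconst (?D $$ (i, k)) * e (skip j k))" if "i < N" for i
      by (rule sum.reindex_bij_witness [of _ "skip j" "\<lambda>k. if k < j then k else k - 1"])
        (use that j Suc.prems in \<open>auto simp: skip_def mat_delete_def\<close>)
    have sorted: "map (skip j) [0..<N] = sorted_list_of_set ?A"
    proof -
      have "strict_mono (skip j)" by (auto simp: strict_mono_def skip_def)
      then have "sorted_wrt (<) (map (skip j) [0..<N])"
        by (auto simp: sorted_wrt_map strict_mono_def intro: sorted_wrt_mono_rel [OF _ sorted_wrt_upt])
      moreover have "set (map (skip j) [0..<N]) = ?A"
      proof -
        have "k \<in> skip j ` {0..<N}" if "k < Suc N" "k \<noteq> j" for k
          using that j by (intro image_eqI [of _ _ "if k < j then k else k - 1"]) (auto simp: skip_def)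
        moreover have "skip j k \<in> ?A" if "k < N" for k
          using that by (simp add: skip_def)
        ultimately show ?thesis by auto
      qed
      ultimately show ?thesis
        by (metis sorted_list_of_set.idem_if_sorted_distinct strict_sorted_iff)
    qed
    have "e j * prod_list (map (\<lambda>i. v (Suc i)) [0..<N]) =
        e j * prod_list (map (\<lambda>i. \<Sum>k\<in>?A. gconst (M $$ (Suc i, k)) * e k) [0..<N])"
      unfolding v_def by (rule prod_list_linear_drop [OF Suc.prems(1)]) simp
    also have "map (\<lambda>i. \<Sum>k\<in>?A. gconst (M $$ (Suc i, k)) * e k) [0..<N] =
        map (\<lambda>i. \<Sum>k<N. gconst (?D $$ (i, k)) * e (skip j k)) [0..<N]"
      by (intro map_cong refl skip) simp
    also have "prod_list \<dots> = gconst (det ?D) * prod_list (map (\<lambda>k. e (skip j k)) [0..<N])"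
      by (rule Suc.IH [OF anticommuting_reindex [OF Suc.prems(1)]])
        (use Suc.prems(2) in \<open>auto simp: mat_delete_def\<close>)
    also have "map (\<lambda>k. e (skip j k)) [0..<N] = map e (sorted_list_of_set ?A)"
      by (simp flip: sorted)
    also have "e j * (gconst (det ?D) * prod_list \<dots>) = gconst (det ?D) * (e j * gprod e ?A)"
      by (simp add: gprod_def gconst_commute [symmetric] flip: mult.assoc)
    \<comment> \<open>Sorting \<open>e j\<close> into place passes the j smaller indices; the
      resulting sign is that of the cofactor in row 0.\<close>
    also have "e j * gprod e ?A = (- 1) ^ j * gprod e {..<Suc N}"
    proof -
      have "{b \<in> ?A. b < j} = {..<j}" using j by auto
      then have "card {b \<in> ?A. b < j} = j" by simp
      moreover have "insert j ?A = {..<Suc N}" using j by auto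
      ultimately show ?thesis using gprod_insert [of ?A j] by (simp add: ksign_single_left)
    qed
    also have "gconst (det ?D) * ((- 1) ^ j * gprod e {..<Suc N}) =
        gconst (cofactor M 0 j) * gprod e {..<Suc N}"
      by (cases "even j") (simp_all add: cofactor_def gconst_uminus)
    also have "gprod e {..<Suc N} = prod_list (map e [0..<Suc N])"
      by (simp add: gprod_def lessThan_atLeast0 del: upt_Suc)
    finally show ?thesis .
  qed
  have "prod_list (map v [0..<Suc N]) = v 0 * prod_list (map (\<lambda>i. v (Suc i)) [0..<N])"
    unfolding upt by (simp add: comp_def)
  also have "\<dots> = (\<Sum>j<Suc N. gconst (M $$ (0, j)) * (e j * prod_list (map (\<lambda>i. v (Suc i)) [0..<N])))"
    by (simp only: v_def [of] sum_distrib_right mult.assoc)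
  also have "\<dots> = (\<Sum>j<Suc N. gconst (M $$ (0, j) * cofactor M 0 j) * prod_list (map e [0..<Suc N]))"
    by (intro sum.cong refl) (simp only: rest lessThan_iff gconst_mult mult.assoc)
  also have "\<dots> = gconst (det M) * prod_list (map e [0..<Suc N])"
    unfolding sum_distrib_right [symmetric] gconst_sum [symmetric]
    by (subst laplace_expansion_row [OF Suc.prems(2), of 0]) auto
  finally show ?case unfolding v_def .
qed

section \<open>The square root series\<close>

text \<open>By Vandermonde's identity the Cauchy square of the binomial series with exponent 1/2 is
  the binomial series with exponent 1, whose coefficients vanish from degree 2 on. Truncation is
  harmless because the products of degree N or more vanish.\<close>

lemma sqrt_series_square:
  fixes z :: "'a::ring_1"
  assumes add: "\<And>a b. c (a + b) = c a + c b" and mult: "\<And>a b. c (a * b) = c a * c b" and one: "c 1 = 1"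
    and comm: "\<And>a. c (a :: complex) * z = z * c a" and N: "z ^ N = 0"
  shows "(\<Sum>k<N. c ((1 / 2) gchoose k) * z ^ k) ^ 2 = 1 + z"
proof -
  let ?b = "\<lambda>k. (1 / 2 :: complex) gchoose k"
  have zero: "c 0 = 0" using add [of 0 0] by simp
  have csum: "c (sum f I) = (\<Sum>i\<in>I. c (f i))" for f and I :: "nat set"
    by (induction I rule: infinite_finite_induct) (simp_all add: add zero)
  have cz: "z ^ i * c a = c a * z ^ i" for i a
    by (induction i) (simp_all add: mult.assoc comm, simp add: comm flip: mult.assoc)
  have z0: "z ^ k = 0" if "k \<ge> N" for k
    using that N by (metis le_add_diff_inverse mult_zero_left power_add)
  have "(\<Sum>k<N. c (?b k) * z ^ k) ^ 2 =
      (\<Sum>i<N. \<Sum>j<N. c (?b i * ?b j) * z ^ (i + j))"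
    unfolding power2_eq_square sum_product
    by (intro sum.cong refl) (metis (no_types, lifting) cz mult mult.assoc power_add)
  also have "\<dots> = (\<Sum>(i, j)\<in>{..<N} \<times> {..<N}. c (?b i * ?b j) * z ^ (i + j))"
    by (simp add: sum.cartesian_product)
  also have "\<dots> = (\<Sum>(i, j)\<in>{(i, j). i + j < N}. c (?b i * ?b j) * z ^ (i + j))"
  proof (rule sum.mono_neutral_right)
    show "\<forall>p\<in>{..<N} \<times> {..<N} - {(i, j). i + j < N}. (case p of (i, j) \<Rightarrow> c (?b i * ?b j) * z ^ (i + j)) = 0"
      by (simp add: z0 split_beta)
  qed auto
  also have "\<dots> = (\<Sum>k<N. \<Sum>i\<le>k. c (?b i * ?b (k - i)) * z ^ (i + (k - i)))"
    by (rule sum.triangle_reindex)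
  also have "\<dots> = (\<Sum>k<N. c (1 gchoose k) * z ^ k)"
  proof (rule sum.cong [OF refl])
    fix k
    have "(\<Sum>i\<le>k. c (?b i * ?b (k - i)) * z ^ (i + (k - i))) = c (\<Sum>i\<le>k. ?b i * ?b (k - i)) * z ^ k"
      by (simp add: csum sum_distrib_right)
    also have "(\<Sum>i\<le>k. ?b i * ?b (k - i)) = (1 gchoose k)"
      using gbinomial_Vandermonde [of "1 / 2 :: complex" "1 / 2" k] by (simp add: atLeast0AtMost)
    finally show "(\<Sum>i\<le>k. c (?b i * ?b (k - i)) * z ^ (i + (k - i))) = c (1 gchoose k) * z ^ k" .
  qed
  also have "\<dots> = (\<Sum>k<N. if k = 0 then 1 else if k = 1 then z else 0)"
  proof (rule sum.cong [OF refl])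
    fix k :: nat
    have "(1 gchoose k :: complex) = of_nat (1 choose k)" by (simp add: binomial_gbinomial)
    also have "\<dots> = (if k = 0 then 1 else if k = 1 then 1 else 0)" by (simp add: binomial_eq_0)
    finally show "c (1 gchoose k) * z ^ k = (if k = 0 then 1 else if k = 1 then z else 0)"
      by (simp add: one zero)
  qed
  also have "\<dots> = (\<Sum>k\<in>{0, 1} \<inter> {..<N}. if k = 0 then 1 else if k = 1 then z else 0)"
    by (rule sum.mono_neutral_right) auto
  also have "\<dots> = 1 + z"
  proof -
    \<comment> \<open>For small N the linear term lies outside the range of summation; the
      hypothesis on z then gives z = 0 for N = 1 and is contradictory for N = 0.\<close>
    consider "N = 0" | "N = 1" | "N \<ge> 2" by linarith
    then show ?thesis
    proof cases
      case 3
      then have "{0, 1} \<inter> {..<N} = {0, 1}" by auto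
      then show ?thesis by simp
    qed (use N in auto)
  qed
  finally show ?thesis .
qed

section \<open>The form and the groups\<close>

text \<open>Scalars enter three Grassmann algebras in different ways, as \<open>gconst\<close>,
  \<open>sconst\<close> and \<open>lconst\<close>; the calculus of bilinear forms uses only that
  they are central.\<close>

locale central_hom =
  fixes c :: "'k::comm_ring_1 \<Rightarrow> 'a::ring_1"
  assumes c_add: "c (x + y) = c x + c y" and c_mult: "c (x * y) = c x * c y" and c_one: "c 1 = 1"
    and c_central: "c x * f = f * c x"
begin

lemma c_zero: "c 0 = 0"
  using c_add [of 0 0] by simp

lemma c_sum: "c (sum f I) = (\<Sum>i\<in>I. c (f i))"
  by (induction I rule: infinite_finite_induct) (simp_all add: c_add c_zero)

definition bil :: "nat \<Rightarrow> 'k mat \<Rightarrow> (nat \<Rightarrow> 'a) \<Rightarrow> (nat \<Rightarrow> 'a) \<Rightarrow> 'a" where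
  "bil N K u w = (\<Sum>a<N. \<Sum>b<N. u a * (c (K $$ (a, b)) * w b))"

text \<open>The two arguments are treated separately because a derivation acts on one factor at a
  time; a group element acts on both, and the matrix K then becomes the product of Y, K and the
  transpose of Y.\<close>

lemma bil_left:
  assumes Y: "Y \<in> carrier_mat N N" and K: "K \<in> carrier_mat N N"
  shows "bil N K (\<lambda>a. \<Sum>d<N. c (Y $$ (d, a)) * u d) w = bil N (Y * K) u w"
proof -
  have "bil N K (\<lambda>a. \<Sum>d<N. c (Y $$ (d, a)) * u d) w =
      (\<Sum>a<N. \<Sum>b<N. \<Sum>d<N. u d * (c (Y $$ (d, a) * K $$ (a, b)) * w b))"
    unfolding bil_def sum_distrib_right c_mult
    by (intro sum.cong refl) (simp only: c_central [of _ "u _"] mult.assoc)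
  also have "\<dots> = (\<Sum>d<N. \<Sum>b<N. \<Sum>a<N. u d * (c (Y $$ (d, a) * K $$ (a, b)) * w b))"
    by (subst sum.swap, subst (2) sum.swap, subst sum.swap) (rule refl)
  also have "\<dots> = bil N (Y * K) u w"
    unfolding bil_def
  proof (intro sum.cong refl)
    fix d b assume "d \<in> {..<N}" "b \<in> {..<N}"
    then have "(Y * K) $$ (d, b) = (\<Sum>a<N. Y $$ (d, a) * K $$ (a, b))"
      using Y K by (auto simp: scalar_prod_def lessThan_atLeast0 intro!: sum.cong)
    then show "(\<Sum>a<N. u d * (c (Y $$ (d, a) * K $$ (a, b)) * w b)) = u d * (c ((Y * K) $$ (d, b)) * w b)"
      by (simp only: c_sum sum_distrib_left sum_distrib_right)
  qed
  finally show ?thesis .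
qed

lemma bil_right:
  assumes Y: "Y \<in> carrier_mat N N" and K: "K \<in> carrier_mat N N"
  shows "bil N K u (\<lambda>b. \<Sum>d<N. c (Y $$ (d, b)) * w d) = bil N (K * Y\<^sup>T) u w"
proof -
  have "bil N K u (\<lambda>b. \<Sum>d<N. c (Y $$ (d, b)) * w d) =
      (\<Sum>a<N. \<Sum>b<N. \<Sum>d<N. u a * (c (K $$ (a, b) * Y $$ (d, b)) * w d))"
    unfolding bil_def sum_distrib_left c_mult
    by (intro sum.cong refl) (simp only: mult.assoc)
  also have "\<dots> = (\<Sum>a<N. \<Sum>d<N. \<Sum>b<N. u a * (c (K $$ (a, b) * Y $$ (d, b)) * w d))"
    by (rule sum.cong [OF refl], rule sum.swap)
  also have "\<dots> = bil N (K * Y\<^sup>T) u w"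
    unfolding bil_def
  proof (intro sum.cong refl)
    fix a d assume "a \<in> {..<N}" "d \<in> {..<N}"
    then have "(K * Y\<^sup>T) $$ (a, d) = (\<Sum>b<N. K $$ (a, b) * Y $$ (d, b))"
      using Y K by (auto simp: scalar_prod_def lessThan_atLeast0 intro!: sum.cong)
    then show "(\<Sum>b<N. u a * (c (K $$ (a, b) * Y $$ (d, b)) * w d)) = u a * (c ((K * Y\<^sup>T) $$ (a, d)) * w d)"
      by (simp only: c_sum sum_distrib_left sum_distrib_right)
  qed
  finally show ?thesis .
qed

lemma bil_add:
  assumes "K \<in> carrier_mat N N" "L \<in> carrier_mat N N"
  shows "bil N (K + L) u w = bil N K u w + bil N L u w"
  using assms by (simp add: bil_def sum.distrib [symmetric] c_add distrib_left distrib_right)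

lemma bil_zero: "bil N (0\<^sub>m N N) u w = 0"
  by (simp add: bil_def c_zero)

end

lemma gconst_central_hom: "central_hom gconst"
  by unfold_locales (simp_all only: gconst_add gconst_mult gconst_one, rule gconst_commute)

lemma pconst_hom: "pconst (a + b) = pconst a + pconst b" "pconst (a * b) = pconst a * pconst b"
  "pconst 1 = 1" "pconst 0 = 0"
  by (simp_all add: pconst_def single_add mult_single)

lemma sconst_central_hom: "central_hom sconst"
  unfolding sconst_def
  by unfold_locales (simp_all only: pconst_hom gconst_add gconst_mult gconst_one, rule gconst_commute)

interpretation gconst: central_hom gconst by (rule gconst_central_hom)
interpretation sconst: central_hom sconst by (rule sconst_central_hom)

section \<open>The matrix of the form and its inverse\<close>

lemma eta_carrier [simp]: "eta n \<in> carrier_mat (2 * n) (2 * n)"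
  unfolding eta_def mult_2 by (rule four_block_carrier_mat) auto

lemma dim_eta [simp]: "dim_row (eta n) = 2 * n" "dim_col (eta n) = 2 * n"
  using eta_carrier [of n] by (auto simp del: eta_carrier)

lemma eta_square: "eta n * eta n = - 1\<^sub>m (2 * n)"
  unfolding eta_def
  by (subst mult_four_block_mat [of _ n n _ n _ n]) (auto intro!: eq_matI simp: mult_2)

lemma kappa_carrier [simp]: "kappa m n \<in> carrier_mat (m + 2 * n) (m + 2 * n)"
  unfolding kappa_def by (rule four_block_carrier_mat) auto

lemma kappa_times_inverse:
  "kappa m n * four_block_mat (1\<^sub>m m) (0\<^sub>m m (2 * n)) (0\<^sub>m (2 * n) m) (- eta n) = 1\<^sub>m (m + 2 * n)"
proof -
  have "eta n * - eta n = 1\<^sub>m (2 * n)"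
    by (simp add: eta_square)
  moreover have "- 0\<^sub>m m (2 * n) = (0\<^sub>m m (2 * n) :: complex mat)" by (intro eq_matI) auto
  ultimately show ?thesis
    unfolding kappa_def
    by (subst mult_four_block_mat [of _ m m _ "2 * n" _ "2 * n"]) auto
qed

text \<open>\<open>kappa_inv\<close> is the output of Gauss-Jordan elimination. The explicit block
  matrix is a two-sided inverse, so elimination cannot fail, and by uniqueness of inverses its
  result is that matrix; the block \<open>- eta n\<close> comes from
  \<open>eta_square\<close>.\<close>

lemma kappa_inv_eq:
  "kappa_inv m n = four_block_mat (1\<^sub>m m) (0\<^sub>m m (2 * n)) (0\<^sub>m (2 * n) m) (- eta n)" (is "_ = ?L")
  and kappa_inv_carrier [simp]: "kappa_inv m n \<in> carrier_mat (m + 2 * n) (m + 2 * n)"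
  and kappa_kappa_inv: "kappa m n * kappa_inv m n = 1\<^sub>m (m + 2 * n)"
  and kappa_inv_kappa: "kappa_inv m n * kappa m n = 1\<^sub>m (m + 2 * n)"
proof -
  let ?N = "m + 2 * n"
  have L: "?L \<in> carrier_mat ?N ?N" by (rule four_block_carrier_mat) auto
  have right: "kappa m n * ?L = 1\<^sub>m ?N" by (rule kappa_times_inverse)
  have left: "?L * kappa m n = 1\<^sub>m ?N"
    by (rule mat_mult_left_right_inverse [OF kappa_carrier L right])
  have "mat_inverse (kappa m n) \<noteq> None"
  proof
    assume "mat_inverse (kappa m n) = None"
    from mat_inverse(1) [OF kappa_carrier this, of undefined] show False
      using L left right by (auto simp: Units_def ring_mat_def)
  qed
  then obtain B where B: "mat_inverse (kappa m n) = Some B" by auto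
  from mat_inverse(2) [OF kappa_carrier B]
  have *: "kappa m n * B = 1\<^sub>m ?N" "B * kappa m n = 1\<^sub>m ?N" "B \<in> carrier_mat ?N ?N" by auto
  have "B = (B * kappa m n) * ?L"
    using * L right assoc_mult_mat [OF *(3) kappa_carrier L] by simp
  then have "B = ?L" using * L by simp
  moreover have "kappa_inv m n = B" by (simp add: kappa_inv_def B)
  ultimately show "kappa_inv m n = ?L" "kappa_inv m n \<in> carrier_mat ?N ?N"
    "kappa m n * kappa_inv m n = 1\<^sub>m ?N" "kappa_inv m n * kappa m n = 1\<^sub>m ?N"
    using * by auto
qed

lemma kappa_inv_even: "a < m \<Longrightarrow> b < m + 2 * n \<Longrightarrow> kappa_inv m n $$ (a, b) = (if a = b then 1 else 0)"
  unfolding kappa_inv_eq by (subst index_mat_four_block) auto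

lemma kappa_inv_odd_even: "\<not> a < m \<Longrightarrow> a < m + 2 * n \<Longrightarrow> b < m \<Longrightarrow> kappa_inv m n $$ (a, b) = 0"
  unfolding kappa_inv_eq by (subst index_mat_four_block) auto

lemma kappa_inv_parity:
  assumes "a < m + 2 * n" "b < m + 2 * n" "kappa_inv m n $$ (a, b) \<noteq> 0"
  shows "idx_parity m a = idx_parity m b"
  using assms kappa_inv_even [of a m b n] kappa_inv_odd_even [of a m n b]
  by (auto simp: idx_parity_def split: if_splits)

section \<open>The even group preserves the form\<close>

lemma OSp0_carrier: "g \<in> OSp0 m n \<Longrightarrow> g \<in> carrier_mat (m + 2 * n) (m + 2 * n)"
  unfolding OSp0_def orthogonal_group_def symplectic_group_def by (auto intro!: four_block_carrier_mat)

lemma OSp0_mat_parity: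
  assumes "g \<in> OSp0 m n"
  shows "mat_parity m n 0 g"
proof -
  obtain A B where g: "g = four_block_mat A (0\<^sub>m m (2 * n)) (0\<^sub>m (2 * n) m) B"
    and A: "A \<in> carrier_mat m m" and B: "B \<in> carrier_mat (2 * n) (2 * n)"
    using assms by (auto simp: OSp0_def orthogonal_group_def symplectic_group_def)
  have "idx_parity m a = idx_parity m b"
    if "a < m + 2 * n" "b < m + 2 * n" "g $$ (b, a) \<noteq> 0" for a b
    using that A B unfolding g
    by (subst (asm) index_mat_four_block) (auto simp: idx_parity_def split: if_splits)
  then show ?thesis
    using OSp0_carrier [OF assms] by (auto simp: mat_parity_def idx_parity_def)
qed

text \<open>Invariance of K exhibits the product of L, the transpose of g, and K as a left inverse
  of g. For square matrices it is also a right inverse, and multiplying that relation by L on the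
  right gives the claim.\<close>

lemma inverse_form_invariant:
  fixes g K L :: "'k::field mat"
  assumes g: "g \<in> carrier_mat N N" and K: "K \<in> carrier_mat N N" and L: "L \<in> carrier_mat N N"
    and KL: "K * L = 1\<^sub>m N" and inv: "g\<^sup>T * K * g = K"
  shows "g * L * g\<^sup>T = L"
proof -
  have gT: "g\<^sup>T \<in> carrier_mat N N" using g by simp
  have LK: "L * K = 1\<^sub>m N" by (rule mat_mult_left_right_inverse [OF K L KL])
  define M where "M = L * g\<^sup>T"
  have M: "M \<in> carrier_mat N N" and MK: "M * K \<in> carrier_mat N N"
    using L gT K by (simp_all add: M_def)
  have "(M * K) * g = L * (g\<^sup>T * K * g)"
    using assoc_mult_mat [OF L gT K] assoc_mult_mat [OF L mult_carrier_mat [OF gT K] g]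
    by (simp add: M_def)
  then have "(M * K) * g = 1\<^sub>m N" by (simp add: inv LK)
  then have "g * (M * K) = 1\<^sub>m N"
    by (rule mat_mult_left_right_inverse [OF MK g])
  then have "L = g * (M * K) * L" using L by simp
  also have "\<dots> = g * (M * (K * L))"
    by (simp only: assoc_mult_mat [OF g MK L] assoc_mult_mat [OF M K L])
  also have "\<dots> = g * L * g\<^sup>T"
    using M by (simp only: KL right_mult_one_mat) (simp only: M_def assoc_mult_mat [OF g L gT])
  finally show ?thesis ..
qed

text \<open>The quadratic forms q_ts have \<open>kappa_inv\<close> as coefficient matrix, and the
  action on the generators turns it into the left-hand side; this is the invariance that
  \<open>gact_qform\<close> needs.\<close>

lemma OSp0_kappa_inv:
  assumes "g \<in> OSp0 m n"
  shows "g * kappa_inv m n * g\<^sup>T = kappa_inv m n"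
proof -
  obtain A B where g: "g = four_block_mat A (0\<^sub>m m (2 * n)) (0\<^sub>m (2 * n) m) B"
    and A: "A \<in> carrier_mat m m" "A\<^sup>T * A = 1\<^sub>m m"
    and B: "B \<in> carrier_mat (2 * n) (2 * n)" "B\<^sup>T * eta n * B = eta n"
    using assms by (auto simp: OSp0_def orthogonal_group_def symplectic_group_def)
  have gT: "g\<^sup>T = four_block_mat A\<^sup>T (0\<^sub>m m (2 * n)) (0\<^sub>m (2 * n) m) B\<^sup>T"
    unfolding g by (subst transpose_four_block_mat [of _ m m _ "2 * n" _ "2 * n"]) (use A B in auto)
  have "g\<^sup>T * kappa m n = four_block_mat A\<^sup>T (0\<^sub>m m (2 * n)) (0\<^sub>m (2 * n) m) (B\<^sup>T * eta n)"
    unfolding gT kappa_def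
    by (subst mult_four_block_mat [of _ m m _ "2 * n" _ "2 * n"])
      (use A B eta_carrier [of n] in \<open>auto simp del: eta_carrier\<close>)
  also have "\<dots> * g = kappa m n"
    unfolding g kappa_def
    by (subst mult_four_block_mat [of _ m m _ "2 * n" _ "2 * n"])
      (use A B eta_carrier [of n] in \<open>auto simp del: eta_carrier\<close>)
  finally have "g\<^sup>T * kappa m n * g = kappa m n" .
  from inverse_form_invariant [OF OSp0_carrier [OF assms] kappa_carrier kappa_inv_carrier kappa_kappa_inv this]
  show ?thesis .
qed

text \<open>The action of a symplectic \<open>B\<close> on the Grassmann algebra fixes
  \<open>\<omega> = \<Sum>\<^sub>i \<theta>\<^sub>i \<theta>\<^bsub>n+i\<^esub>\<close>, hence the top degree element \<open>\<omega>\<^sup>n\<close>,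
  on which it acts by \<open>det B\<close>.\<close>

lemma square_zero_sum_power:
  fixes w :: "nat \<Rightarrow> 'a::comm_ring_1"
  assumes "\<And>i. w i * w i = 0"
  shows "(\<Sum>i<k. w i) ^ k = of_nat (fact k) * (\<Prod>i<k. w i)"
proof (induction k)
  case (Suc k)
  \<comment> \<open>As \<open>w k\<close> squares to zero, the binomial expansion stops after the
    linear term.\<close>
  have step: "(s + w k) ^ Suc j = s ^ Suc j + of_nat (Suc j) * (s ^ j * w k)" for s j
  proof (induction j)
    case (Suc j)
    have "(s + w k) ^ Suc (Suc j) = (s + w k) * (s ^ Suc j + of_nat (Suc j) * (s ^ j * w k))"
      using Suc by simp
    also have "\<dots> = s ^ Suc (Suc j) + of_nat (Suc (Suc j)) * (s ^ Suc j * w k)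
        + of_nat (Suc j) * s ^ j * (w k * w k)"
      by (simp add: algebra_simps)
    finally show ?case by (simp add: assms)
  qed simp
  have "w j * (\<Prod>i<k. w i) = 0" if "j < k" for j
  proof -
    have "(\<Prod>i<k. w i) = w j * (\<Prod>i\<in>{..<k} - {j}. w i)"
      using that by (simp add: prod.remove [of "{..<k}" j])
    then show ?thesis by (simp add: assms flip: mult.assoc)
  qed
  then have "(\<Sum>i<k. w i) * (\<Prod>i<k. w i) = 0" by (simp add: sum_distrib_right)
  then have "(\<Sum>i<k. w i) ^ Suc k = 0" by (simp add: Suc mult.left_commute)
  then show ?case
    using step [of "\<Sum>i<k. w i" k] by (simp add: Suc algebra_simps)
qed simp

lemma coef_gprod_gtheta: "finite A \<Longrightarrow> coef (gprod gtheta A :: ('i::linorder, 'r::comm_ring_1) grassmann) A = 1"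
proof (induction A rule: finite_linorder_min_induct)
  case (insert v A)
  have "gprod gtheta (insert v A) = gtheta v * (gprod gtheta A :: ('i, 'r) grassmann)"
  proof -
    have "sorted_list_of_set (insert v A) = v # sorted_list_of_set A"
      using insert.hyps by (subst sorted_list_of_set_insert) (auto intro!: insort_is_Cons order_less_imp_le)
    then show ?thesis by (simp add: gprod_def)
  qed
  moreover have "insert v A - {v} = A" using insert.hyps by auto
  moreover have "{b \<in> A. b < v} = {}" using insert.hyps by auto
  then have "ksign {v} A = (1 :: 'r)" by (simp only: ksign_single_left card.empty power_0)
  ultimately show ?case using insert.IH by (simp add: coef_gtheta_times)
qed (simp add: coef_one)

text \<open>Unfolds the product of pairs into a single list of generators in the order 0, n, 1, n+1
  and so on, so that \<open>prod_list_linear\<close> can be applied with a permutation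
  matrix.\<close>

lemma prod_list_pairs:
  "prod_list (map (\<lambda>i. e i * e (n + i)) [0..<k]) =
    prod_list (map (\<lambda>i. e (if even i then i div 2 else n + i div 2)) [0..<2 * k])"
  for e :: "nat \<Rightarrow> 'a::monoid_mult"
  by (induction k) (simp_all add: mult.assoc)

text \<open>Pairs of odd elements commute with each other and have square zero, so the n-th power of
  their sum is n! times their product, and n! can be cancelled over the complex numbers.\<close>

lemma symplectic_pairs_eq:
  fixes e f :: "nat \<Rightarrow> (nat, complex) grassmann"
  assumes e: "\<And>i. gparity (Suc 0) (e i)" and f: "\<And>i. gparity (Suc 0) (f i)"
    and eq: "(\<Sum>i<n. e i * e (n + i)) = (\<Sum>i<n. f i * f (n + i))"
  shows "prod_list (map (\<lambda>i. e i * e (n + i)) [0..<n]) = prod_list (map (\<lambda>i. f i * f (n + i)) [0..<n])"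
proof -
  have main: "of_nat (fact n) * prod_list (map (\<lambda>i. h i * h (n + i)) [0..<n]) = (\<Sum>i<n. h i * h (n + i)) ^ n"
    if h: "\<And>i. gparity (Suc 0) (h i)" for h :: "nat \<Rightarrow> (nat, complex) grassmann"
  proof -
    define w where "w = (\<lambda>i. Abs_geven (h i * h (n + i)))"
    have w: "of_geven (w i) = h i * h (n + i)" for i
      unfolding w_def by (intro of_geven_Abs gparity_mult_odd h)
    have "h i * h (n + i) * (h i * h (n + i)) = 0" for i
    proof -
      have "h i * h (n + i) * (h i * h (n + i)) = h i * (h i * h (n + i)) * h (n + i)"
        using gparity_even_commute [OF gparity_mult_odd [OF h h], of i "n + i" "h i"]
        by (metis mult.assoc)
      also have "\<dots> = 0" by (simp add: gparity_odd_square [OF h] flip: mult.assoc)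
      finally show ?thesis .
    qed
    then have "w i * w i = 0" for i
      by (simp add: of_geven_inject [symmetric] times_geven.rep_eq w zero_geven.rep_eq)
    from arg_cong [OF square_zero_sum_power [of w, OF this, of n], of of_geven]
    have "(\<Sum>i<n. h i * h (n + i)) ^ n = of_geven (of_nat (fact n)) * of_geven (\<Prod>i<n. w i)"
      by (simp add: of_geven_power of_geven_sum w times_geven.rep_eq)
    also have "(\<Prod>i<n. w i) = prod_list (map w [0..<n])"
      using prod.distinct_set_conv_list [of "[0..<n]" w] by (simp add: lessThan_atLeast0)
    finally show ?thesis by (simp add: of_geven_of_nat of_geven_prod_list comp_def w)
  qed
  have "of_nat (fact n) * prod_list (map (\<lambda>i. e i * e (n + i)) [0..<n]) =
      of_nat (fact n) * prod_list (map (\<lambda>i. f i * f (n + i)) [0..<n])"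
    by (simp only: main e f eq)
  then have "of_nat (fact n) * coef (prod_list (map (\<lambda>i. e i * e (n + i)) [0..<n])) A =
      of_nat (fact n) * coef (prod_list (map (\<lambda>i. f i * f (n + i)) [0..<n])) A" for A
    unfolding coef_of_nat_times [symmetric] by simp
  then show ?thesis by (intro grassmann_eqI) simp
qed

lemma sum_lessThan_add: "(\<Sum>i<m + k. s i) = (\<Sum>i<m. s i) + (\<Sum>i<k. s (m + i))"
  for s :: "nat \<Rightarrow> 'a::comm_monoid_add"
  by (induction k) (simp_all add: add.assoc)

text \<open>Each pair occurs twice in the double sum, in both orders; the sign of \<open>eta\<close>
  in the second one is undone by anticommutation, whence the factor 2.\<close>

lemma bil_eta:
  fixes e :: "nat \<Rightarrow> (nat, complex) grassmann"
  assumes "\<And>i. gparity (Suc 0) (e i)"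
  shows "gconst.bil (2 * n) (eta n) e e = 2 * (\<Sum>i<n. e i * e (n + i))"
proof -
  have row1: "(\<Sum>b<2 * n. e a * (gconst (eta n $$ (a, b)) * e b)) = e a * e (n + a)" if "a < n" for a
  proof -
    have "e a * (gconst (eta n $$ (a, b)) * e b) = (if b = n + a then e a * e (n + a) else 0)"
      if "b < 2 * n" for b
      using that \<open>a < n\<close> unfolding eta_def by (subst index_mat_four_block) auto
    then have "(\<Sum>b<2 * n. e a * (gconst (eta n $$ (a, b)) * e b)) =
        (\<Sum>b<2 * n. if b = n + a then e a * e (n + a) else 0)"
      by (intro sum.cong) auto
    then show ?thesis using that by simp
  qed
  have row2: "(\<Sum>b<2 * n. e (n + a) * (gconst (eta n $$ (n + a, b)) * e b)) = e a * e (n + a)" if "a < n" for a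
  proof -
    have "e (n + a) * (gconst (eta n $$ (n + a, b)) * e b) = (if b = a then e a * e (n + a) else 0)"
      if "b < 2 * n" for b
      using that \<open>a < n\<close> gparity_odd_anticommute [OF assms assms, of "n + a" a] unfolding eta_def
      by (subst index_mat_four_block) (auto simp: gconst_uminus)
    then have "(\<Sum>b<2 * n. e (n + a) * (gconst (eta n $$ (n + a, b)) * e b)) =
        (\<Sum>b<2 * n. if b = a then e a * e (n + a) else 0)"
      by (intro sum.cong) auto
    then show ?thesis using that by simp
  qed
  show ?thesis
    using sum_lessThan_add [of "\<lambda>a. \<Sum>b<2 * n. e a * (gconst (eta n $$ (a, b)) * e b)" n n]
    unfolding gconst.bil_def mult_2 [of "\<Sum>i<n. e i * e (n + i)"]
    by (simp only: mult_2 [of n, symmetric]) (simp add: row1 row2)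
qed

lemma grassmann_double_cancel:
  fixes f g :: "('i::linorder, 'r::idom) grassmann"
  assumes two: "(2 :: 'r) \<noteq> 0" and eq: "2 * f = 2 * g"
  shows "f = g"
proof (rule grassmann_eqI)
  fix A
  have double: "coef (2 * h) A = 2 * coef h A" for h :: "('i, 'r) grassmann"
    using coef_of_nat_times [of 2 h A] by simp
  from arg_cong [OF eq, of "\<lambda>f. coef f A"] show "coef f A = coef g A"
    unfolding double using two by simp
qed

lemma symplectic_det:
  assumes "B \<in> symplectic_group n"
  shows "det B = 1"
proof -
  have B: "B \<in> carrier_mat (2 * n) (2 * n)" and inv: "B\<^sup>T * eta n * B = eta n"
    using assms by (auto simp: symplectic_group_def)
  let ?N = "2 * n"
  define e :: "nat \<Rightarrow> (nat, complex) grassmann" where "e = gtheta"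
  define f where "f = (\<lambda>i. \<Sum>j<?N. gconst (B $$ (j, i)) * e j)"
  \<comment> \<open>The interleaving order from \<open>prod_list_pairs\<close>, and its permutation
    matrix. The sign of this permutation occurs on both sides and cancels, so it is enough that
    \<open>det P\<close> is not zero.\<close>
  define \<pi> where "\<pi> = (\<lambda>i. if even i then i div 2 else n + i div 2)"
  define P :: "complex mat" where "P = mat ?N ?N (\<lambda>(k, i). if i = \<pi> k then 1 else 0)"
  have \<pi>: "\<pi> k < ?N" if "k < ?N" for k using that by (auto simp: \<pi>_def)
  have e: "gparity (Suc 0) (e i)" for i by (simp add: e_def)
  have f: "gparity (Suc 0) (f i)" for i
    unfolding f_def by (intro gparity_sum gparity_gconst_mult e)
  have anti: "anticommuting e"
    by unfold_locales (rule gparity_odd_anticommute [OF e e], simp add: gparity_odd_square [OF e])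
  have m_eta: "- eta n \<in> carrier_mat ?N ?N" by simp
  have "eta n * - eta n = 1\<^sub>m ?N"
    by (simp add: eta_square)
  \<comment> \<open>The coefficients of \<open>f i\<close> form column i of B, so the form in the f
    has matrix \<open>B * eta n * B\<^sup>T\<close>; the hypothesis has the transpose on the other
    side and is converted by passing to inverses.\<close>
  from inverse_form_invariant [OF B eta_carrier m_eta this inv]
  have "B * - eta n * B\<^sup>T = - eta n" .
  then have inv': "B * eta n * B\<^sup>T = eta n"
    using B by (simp add: uminus_eq_mat)
  have "gconst.bil ?N (eta n) f f = gconst.bil ?N (B * eta n * B\<^sup>T) e e"
    unfolding f_def using B by (simp add: gconst.bil_left gconst.bil_right)
  then have "2 * (\<Sum>i<n. f i * f (n + i)) = 2 * (\<Sum>i<n. e i * e (n + i))"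
    by (simp add: bil_eta e f inv')
  then have "(\<Sum>i<n. f i * f (n + i)) = (\<Sum>i<n. e i * e (n + i))"
    by (rule grassmann_double_cancel [rotated]) simp
  from symplectic_pairs_eq [OF f e this]
  have pairs: "prod_list (map (\<lambda>k. f (\<pi> k)) [0..<?N]) = prod_list (map (\<lambda>k. e (\<pi> k)) [0..<?N])"
    unfolding prod_list_pairs \<pi>_def .
  have P: "P \<in> carrier_mat ?N ?N" by (simp add: P_def)
  have "(\<Sum>j<?N. gconst (P $$ (k, j)) * e j) = e (\<pi> k)" if "k < ?N" for k
  proof -
    have "(\<Sum>j<?N. gconst (P $$ (k, j)) * e j) = (\<Sum>j<?N. if j = \<pi> k then e (\<pi> k) else 0)"
      using that by (intro sum.cong) (auto simp: P_def)
    then show ?thesis using \<pi> that by simp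
  qed
  then have "prod_list (map (\<lambda>k. e (\<pi> k)) [0..<?N]) =
      prod_list (map (\<lambda>k. \<Sum>j<?N. gconst (P $$ (k, j)) * e j) [0..<?N])"
    by (intro arg_cong [of _ _ prod_list] map_cong) auto
  then have eP: "prod_list (map (\<lambda>k. e (\<pi> k)) [0..<?N]) = gconst (det P) * prod_list (map e [0..<?N])"
    by (simp only: prod_list_linear [OF anti P])
  have PB: "P * B\<^sup>T \<in> carrier_mat ?N ?N" using P B by simp
  have "(P * B\<^sup>T) $$ (k, j) = B $$ (j, \<pi> k)" if "k < ?N" "j < ?N" for k j
  proof -
    have "(P * B\<^sup>T) $$ (k, j) = (\<Sum>i<?N. (if i = \<pi> k then 1 else 0) * B $$ (j, i))"
      using that B P by (auto simp: scalar_prod_def P_def lessThan_atLeast0 intro!: sum.cong)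
    also have "\<dots> = (\<Sum>i<?N. if i = \<pi> k then B $$ (j, \<pi> k) else 0)"
      by (intro sum.cong) auto
    finally show ?thesis using \<pi> that by simp
  qed
  then have "prod_list (map (\<lambda>k. f (\<pi> k)) [0..<?N]) =
      prod_list (map (\<lambda>k. \<Sum>j<?N. gconst ((P * B\<^sup>T) $$ (k, j)) * e j) [0..<?N])"
    unfolding f_def by (intro arg_cong [of _ _ prod_list] map_cong sum.cong) auto
  then have fP: "prod_list (map (\<lambda>k. f (\<pi> k)) [0..<?N]) = gconst (det (P * B\<^sup>T)) * prod_list (map e [0..<?N])"
    by (simp only: prod_list_linear [OF anti PB])
  have "prod_list (map e [0..<?N]) = gprod gtheta {..<?N}"
    by (simp add: e_def gprod_def lessThan_atLeast0)
  with pairs eP fP have "coef (gconst (det (P * B\<^sup>T)) * gprod gtheta {..<?N} :: (nat, complex) grassmann) {..<?N}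
      = coef (gconst (det P) * gprod gtheta {..<?N}) {..<?N}" by simp
  then have "det (P * B\<^sup>T) = det P" by (simp add: coef_gconst_times coef_gprod_gtheta)
  moreover have "det (P * B\<^sup>T) = det P * det B"
    using det_mult [OF P, of "B\<^sup>T"] B det_transpose [OF B] by simp
  moreover have "det P \<noteq> 0"
  proof -
    have inj: "k = l" if "\<pi> k = \<pi> l" "k < ?N" "l < ?N" for k l
    proof -
      have "even k = even l" using that by (auto simp: \<pi>_def split: if_splits)
      then show ?thesis using that(1) by (auto simp: \<pi>_def split: if_splits elim!: evenE oddE)
    qed
    have "P * P\<^sup>T = 1\<^sub>m ?N"
    proof (rule eq_matI)
      fix k l assume "k < dim_row (1\<^sub>m ?N :: complex mat)" "l < dim_col (1\<^sub>m ?N :: complex mat)"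
      then have kl: "k < ?N" "l < ?N" by auto
      then have "(P * P\<^sup>T) $$ (k, l) = (\<Sum>i<?N. (if i = \<pi> k then 1 else 0) * (if i = \<pi> l then 1 else 0))"
        by (auto simp: scalar_prod_def P_def lessThan_atLeast0 intro!: sum.cong)
      also have "\<dots> = (\<Sum>i<?N. if i = \<pi> k then if \<pi> k = \<pi> l then 1 else 0 else 0)"
        by (intro sum.cong) auto
      finally show "(P * P\<^sup>T) $$ (k, l) = 1\<^sub>m ?N $$ (k, l)" using \<pi> kl inj [of k l] by auto
    qed (auto simp: P_def)
    then have "det P * det P = 1"
      using det_mult [OF P, of "P\<^sup>T"] P det_transpose [OF P] by simp
    then show ?thesis by auto
  qed
  ultimately show ?thesis by simp
qed

text \<open>\<open>Delta\<close> sees only the orthogonal block; this identifies the factor it picks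
  up with the determinant on all of V.\<close>

lemma OSp0_det:
  assumes "A \<in> orthogonal_group m" "B \<in> symplectic_group n"
  shows "det (four_block_mat A (0\<^sub>m m (2 * n)) (0\<^sub>m (2 * n) m) B) = det A"
proof -
  have "det (four_block_mat A (0\<^sub>m m (2 * n)) (0\<^sub>m (2 * n) m) B) = det A * det B"
    by (rule det_four_block_mat_lower_left_zero)
      (use assms in \<open>auto simp: orthogonal_group_def symplectic_group_def\<close>)
  then show ?thesis using symplectic_det [OF assms(2)] by simp
qed

lemma orthogonal_det:
  assumes "A \<in> orthogonal_group m"
  shows "det A * det A = 1"
proof -
  have A: "A \<in> carrier_mat m m" "A\<^sup>T * A = 1\<^sub>m m" using assms by (auto simp: orthogonal_group_def)
  then have "det (A\<^sup>T) * det A = 1" using det_mult [of "A\<^sup>T" m A] by simp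
  then show ?thesis by (simp add: det_transpose [OF A(1)])
qed

section \<open>Derivations\<close>

lemma of_nat_mult_left_commute: "f * (of_nat k * g) = of_nat k * (f * g)"
  for f g :: "'a::ring_1"
  by (induction k) (simp_all add: distrib_left distrib_right)

lemma dim_kappa [simp]: "dim_row (kappa m n) = m + 2 * n" "dim_col (kappa m n) = m + 2 * n"
  using carrier_matD [OF kappa_carrier] .

lemma dim_kappa_inv [simp]: "dim_row (kappa_inv m n) = m + 2 * n" "dim_col (kappa_inv m n) = m + 2 * n"
  using carrier_matD [OF kappa_inv_carrier] .

text \<open>The word even refers to the first factor in the product rule, not to D. Thus
  \<open>gderiv\<close> and the action of odd elements of \<open>osp\<close> are instances, next to
  ordinary derivations.\<close>

locale even_derivation =
  fixes D :: "('i::linorder, 'r::idom) grassmann \<Rightarrow> ('i, 'r) grassmann"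
  assumes D_add: "D (f + g) = D f + D g"
    and D_mult: "gparity 0 f \<Longrightarrow> D (f * g) = D f * g + f * D g"
begin

lemma D_zero: "D 0 = 0"
  using D_add [of 0 0] by simp

lemma D_sum: "D (sum f I) = (\<Sum>i\<in>I. D (f i))"
  by (induction I rule: infinite_finite_induct) (simp_all add: D_add D_zero)

lemma D_one: "D 1 = 0"
  using D_mult [of 1 1] by simp

lemma D_uminus: "D (- f) = - D f"
  using D_add [of f "- f"] D_zero by (simp add: minus_unique)

lemma D_of_int: "D (of_int k * f) = of_int k * D f"
proof -
  have nat: "D (of_nat j * f) = of_nat j * D f" for j
    by (induction j) (simp_all add: D_zero D_add distrib_right)
  show ?thesis
  proof (cases k)
    case (nonneg j)
    then show ?thesis by (simp add: nat)
  next
    case (neg j)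
    then have "of_int k * h = - (of_nat (Suc j) * h)" for h :: "('i, 'r) grassmann"
      by (simp only: of_int_minus of_int_of_nat_eq minus_mult_left)
    then show ?thesis by (simp only: D_uminus nat)
  qed
qed

lemma D_prod_list:
  assumes "\<And>f. f \<in> set fs \<Longrightarrow> gparity 0 f" "\<And>f. f \<in> set fs \<Longrightarrow> D f = of_nat c * f"
  shows "D (prod_list fs) = of_nat (length fs * c) * prod_list fs"
  using assms
proof (induction fs)
  case (Cons f fs)
  have "D (prod_list (f # fs)) = of_nat c * f * prod_list fs + f * (of_nat (length fs * c) * prod_list fs)"
    using Cons by (simp add: D_mult)
  also have "f * (of_nat (length fs * c) * prod_list fs) = of_nat (length fs * c) * (f * prod_list fs)"
    by (rule of_nat_mult_left_commute)
  finally show ?case by (simp add: distrib_right mult.assoc)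
qed (simp add: D_one)

lemma D_power:
  assumes "gparity 0 f" "D f = of_nat c * f"
  shows "D (f ^ k) = of_nat (k * c) * f ^ k"
  using D_prod_list [of "replicate k f" c] assms by simp

text \<open>Every Leibniz monomial is a product of m eigenvectors with the same eigenvalue c, and
  eigenvalues add up in products.\<close>

lemma D_sdet:
  assumes "\<And>i j. i < m \<Longrightarrow> j < m \<Longrightarrow> gparity 0 (M i j)"
    and "\<And>i j. i < m \<Longrightarrow> j < m \<Longrightarrow> D (M i j) = of_nat c * M i j"
  shows "D (sdet m M) = of_nat (m * c) * sdet m M"
proof -
  have "D (of_int (sign p) * prod_list (map (\<lambda>i. M i (p i)) [0..<m])) =
      of_nat (m * c) * (of_int (sign p) * prod_list (map (\<lambda>i. M i (p i)) [0..<m]))"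
    if "p permutes {..<m}" for p
  proof -
    have "p i < m" if "i < m" for i
      using permutes_in_image [OF \<open>p permutes {..<m}\<close>, of i] that by simp
    then have "D (prod_list (map (\<lambda>i. M i (p i)) [0..<m])) =
        of_nat (length (map (\<lambda>i. M i (p i)) [0..<m]) * c) * prod_list (map (\<lambda>i. M i (p i)) [0..<m])"
      by (intro D_prod_list) (auto simp: assms)
    then show ?thesis by (simp only: D_of_int of_nat_mult_left_commute length_map length_upt diff_zero)
  qed
  then show ?thesis unfolding sdet_def D_sum sum_distrib_left by (intro sum.cong) auto
qed

lemma D_sqrt:
  assumes two: "(2 :: 'r) \<noteq> 0" and f: "gparity 0 f" "coef f {} \<noteq> 0"
    and D: "D (f * f) = of_nat (2 * c) * (f * f)"
  shows "D f = of_nat c * f"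
proof -
  have "2 * (f * D f) = D (f * f)"
    using D_mult [OF f(1), of f] gparity_even_commute [OF f(1), of "D f"] by (simp add: mult_2)
  also have "\<dots> = 2 * (f * (of_nat c * f))"
    unfolding D of_nat_mult_left_commute [of f] by (simp add: mult.assoc)
  finally have "f * D f = f * (of_nat c * f)"
    by (rule grassmann_double_cancel [OF two])
  then have "f * (D f - of_nat c * f) = 0" by (simp add: right_diff_distrib)
  from grassmann_mult_eq_0 [OF this f(2)] show ?thesis by simp
qed

end

lemma gmap_pderiv_add: "gmap (pderiv_var v) (f + g) = gmap (pderiv_var v) f + gmap (pderiv_var v) g"
  by (rule grassmann_eqI) (simp add: coef_gmap pderiv_var_add)

lemma gderiv_add: "gderiv v (f + g) = gderiv v f + gderiv v g"
  by (rule grassmann_eqI) (simp add: gderiv.rep_eq distrib_left)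

lemma gderiv_gconst_mult: "gderiv v (gconst c * f) = gconst c * gderiv v (f :: ('i::linorder, 'r::comm_ring_1) grassmann)"
  by (rule grassmann_eqI) (simp add: gderiv.rep_eq coef_gconst_times mult_ac)

lemma gderiv_gtheta: "gderiv v (gtheta w) = (if v = w then 1 else 0 :: ('i::linorder, 'r::comm_ring_1) grassmann)"
  by (rule grassmann_eqI) (auto simp: gderiv.rep_eq gtheta.rep_eq coef_one)

lemma gderiv_gconst [simp]: "gderiv v (gconst c) = 0"
  by (rule grassmann_eqI) (simp add: gderiv.rep_eq coef_gconst)

lemma gmap_pderiv_derivation: "even_derivation (gmap (pderiv_var v))"
  by unfold_locales (rule gmap_pderiv_add, rule gmap_pderiv_times)

lemma gderiv_mult_parity:
  assumes "gparity r f"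
  shows "gderiv v (f * g) = gderiv v f * g + (- 1) ^ r * (f * gderiv v g)"
proof (rule gderiv_times)
  fix A assume "coef f A \<noteq> 0"
  then have "even (card A + r)" using assms by (auto simp: gparity_def)
  then show "card A mod 2 = r mod 2" by presburger
qed

lemma gderiv_derivation: "even_derivation (gderiv v :: ('i::linorder, 'r::idom) grassmann \<Rightarrow> _)"
  by unfold_locales (simp_all add: gderiv_add gderiv_mult_parity)

lemma Xderiv_add: "Xderiv m a t (f + g) = Xderiv m a t f + Xderiv m a t g"
  by (simp add: Xderiv_def gmap_pderiv_add gderiv_add)

lemma lie_act_derivation: "mat_parity m n p Y \<Longrightarrow> even_derivation (lie_act m n Y)"
  by unfold_locales
    (simp_all add: lie_act_def Xderiv_add distrib_left sum.distrib
      lie_act_superderivation [where r = 0, unfolded sparity_iff_gparity lie_act_def])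

lemma two_cpoly: "(2 :: cpoly) \<noteq> 0"
  by simp

section \<open>The action on the quadratic invariants\<close>

lemma sconst_one [simp]: "sconst 1 = 1"
  by (simp add: sconst_def pconst_hom)

lemma sconst_power: "sconst (a ^ k) = sconst a ^ k"
  by (induction k) (simp_all add: sconst.c_mult)

lemma sconst_minus_one: "sconst ((- 1) ^ k) = (- 1) ^ k"
proof -
  have "sconst (- 1) = - 1"
    using sconst.c_add [of 1 "- 1"] by (simp add: sconst.c_zero eq_neg_iff_add_eq_0 add.commute)
  then show ?thesis by (simp add: sconst_power)
qed

lemma qform_eq_bil:
  "qform m n t s = sconst.bil (m + 2 * n) (kappa_inv m n) (\<lambda>a. Xgen m a t) (\<lambda>b. Xgen m b s)"
  by (simp add: qform_def sconst.bil_def mult.assoc)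

lemma gparity_qform: "gparity 0 (qform m n t s)"
  unfolding qform_eq_bil sconst.bil_def
proof (intro gparity_sum)
  fix a b assume "a \<in> {..<m + 2 * n}" "b \<in> {..<m + 2 * n}"
  then have ab: "kappa_inv m n $$ (a, b) \<noteq> 0 \<Longrightarrow> idx_parity m a = idx_parity m b"
    by (intro kappa_inv_parity) auto
  show "gparity 0 (Xgen m a t * (sconst (kappa_inv m n $$ (a, b)) * Xgen m b s))"
  proof (cases "kappa_inv m n $$ (a, b) = 0")
    case False
    have "gparity (idx_parity m a + idx_parity m b) (Xgen m a t * (sconst (kappa_inv m n $$ (a, b)) * Xgen m b s))"
      unfolding sconst_def by (intro gparity_mult gparity_gconst_mult gparity_Xgen)
    then show ?thesis by (rule gparity_cong) (use ab False in simp)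
  qed simp
qed

section \<open>The orthosymplectic Lie superalgebra annihilates the quadratic forms\<close>

lemma lie_act_sconst_mult:
  assumes "mat_parity m n p Y"
  shows "lie_act m n Y (sconst c * f) = sconst c * lie_act m n Y f"
proof -
  have "pderiv_var v (pconst c) = 0" for v
    by (simp add: pconst_def pderiv_var_single)
  then have "gmap (pderiv_var v) (sconst c) = 0" for v
    by (intro grassmann_eqI) (simp add: sconst_def coef_gmap coef_gconst)
  then have "lie_act m n Y (sconst c) = 0"
    unfolding lie_act_def Xderiv_def by (auto simp: sconst_def intro!: sum.neutral)
  then show ?thesis
    using lie_act_superderivation [OF assms, of 0 "sconst c" f]
    by (simp add: sparity_iff_gparity sconst_def)
qed

text \<open>The sign is the one that arises in the super Leibniz rule when an element of parity p
  passes the left generator with index a.\<close>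

definition signed_kappa_inv :: "nat \<Rightarrow> nat \<Rightarrow> nat \<Rightarrow> complex mat" where
  "signed_kappa_inv m n p =
    mat (m + 2 * n) (m + 2 * n) (\<lambda>(a, b). (- 1) ^ (p * idx_parity m a) * kappa_inv m n $$ (a, b))"

lemma signed_kappa_inv_carrier [simp]: "signed_kappa_inv m n p \<in> carrier_mat (m + 2 * n) (m + 2 * n)"
  by (simp add: signed_kappa_inv_def)

lemma lie_act_qform:
  assumes Y: "mat_parity m n p Y" and t: "t < m" and s: "s < m"
  shows "lie_act m n Y (qform m n t s) =
    sconst.bil (m + 2 * n) (Y * kappa_inv m n + signed_kappa_inv m n p * Y\<^sup>T)
      (\<lambda>a. Xgen m a t) (\<lambda>b. Xgen m b s)"
proof -
  let ?N = "m + 2 * n" and ?K = "kappa_inv m n" and ?T = "signed_kappa_inv m n p"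
  interpret even_derivation "lie_act m n Y" by (rule lie_act_derivation [OF Y])
  have Yc: "Y \<in> carrier_mat ?N ?N" using Y by (simp add: mat_parity_def)
  have "lie_act m n Y (Xgen m a t * (sconst (?K $$ (a, b)) * Xgen m b s)) =
      lin_act m n Y a t * (sconst (?K $$ (a, b)) * Xgen m b s)
      + Xgen m a t * (sconst (?T $$ (a, b)) * lin_act m n Y b s)"
    if ab: "a < ?N" "b < ?N" for a b
  proof -
    have T: "sconst (?T $$ (a, b)) = (- 1) ^ (p * idx_parity m a) * sconst (?K $$ (a, b))"
      using ab by (simp add: signed_kappa_inv_def sconst.c_mult sconst_minus_one)
    have "lie_act m n Y (Xgen m a t * (sconst (?K $$ (a, b)) * Xgen m b s)) =
        lin_act m n Y a t * (sconst (?K $$ (a, b)) * Xgen m b s)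
        + (- 1) ^ (p * idx_parity m a) * (Xgen m a t * (sconst (?K $$ (a, b)) * lin_act m n Y b s))"
      using lie_act_superderivation [OF Y, of "idx_parity m a" "Xgen m a t"] ab t s
      by (simp add: sparity_iff_gparity gparity_Xgen lie_act_sconst_mult [OF Y] lie_act_Xgen)
    then show ?thesis
      unfolding T by (cases "even (p * idx_parity m a)") simp_all
  qed
  then have "lie_act m n Y (qform m n t s) =
      sconst.bil ?N ?K (\<lambda>a. lin_act m n Y a t) (\<lambda>b. Xgen m b s)
      + sconst.bil ?N ?T (\<lambda>a. Xgen m a t) (\<lambda>b. lin_act m n Y b s)"
    by (simp add: qform_eq_bil sconst.bil_def D_sum sum.distrib)
  also have "\<dots> = sconst.bil ?N (Y * ?K) (\<lambda>a. Xgen m a t) (\<lambda>b. Xgen m b s)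
      + sconst.bil ?N (?T * Y\<^sup>T) (\<lambda>a. Xgen m a t) (\<lambda>b. Xgen m b s)"
    unfolding lin_act_def using Yc
    by (simp only: sconst.bil_left [OF Yc kappa_inv_carrier] sconst.bil_right [OF Yc signed_kappa_inv_carrier])
  also have "\<dots> = sconst.bil ?N (Y * ?K + ?T * Y\<^sup>T) (\<lambda>a. Xgen m a t) (\<lambda>b. Xgen m b s)"
    by (rule sconst.bil_add [symmetric])
      (rule mult_carrier_mat [OF Yc kappa_inv_carrier],
        rule mult_carrier_mat [OF signed_kappa_inv_carrier], use Yc in simp)
  finally show ?thesis .
qed

text \<open>Testing the invariance of the form on basis vectors gives
  \<open>Y\<^sup>T * kappa m n = - (W * Y)\<close>, where W is \<open>kappa\<close> with signed
  rows. Multiplying by the inverse of W on the left and by \<open>kappa_inv\<close> on the right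
  transports this to the dual side, which governs the q_ts.\<close>

lemma osp_homogeneous_relation:
  assumes Y: "mat_parity m n p Y"
    and form: "\<And>r s v w. r \<in> {0, 1} \<Longrightarrow> s \<in> {0, 1} \<Longrightarrow> vec_parity m n r v \<Longrightarrow> vec_parity m n s w \<Longrightarrow>
       bform m n (Y *\<^sub>v v) w + (- 1) ^ (p * r) * bform m n v (Y *\<^sub>v w) = 0"
  shows "Y * kappa_inv m n + signed_kappa_inv m n p * Y\<^sup>T = 0\<^sub>m (m + 2 * n) (m + 2 * n)"
proof -
  let ?N = "m + 2 * n" and ?K = "kappa_inv m n" and ?T = "signed_kappa_inv m n p"
  define W where "W = mat ?N ?N (\<lambda>(a, b). (- 1) ^ (p * idx_parity m a) * kappa m n $$ (a, b))"
  have Yc: "Y \<in> carrier_mat ?N ?N" using Y by (simp add: mat_parity_def)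
  have YT: "Y\<^sup>T \<in> carrier_mat ?N ?N" using Yc by simp
  have W: "W \<in> carrier_mat ?N ?N" by (simp add: W_def)
  have kc: "kappa m n \<in> carrier_mat ?N ?N" and Kc: "?K \<in> carrier_mat ?N ?N" by simp_all
  \<comment> \<open>\<open>kappa_inv\<close> pairs only indices of equal parity, so in every nonzero
    summand the two signs coincide and cancel.\<close>
  have TW: "?T * W = 1\<^sub>m ?N"
  proof (rule trans [OF _ kappa_inv_kappa], rule eq_matI)
    fix a b assume ab: "a < dim_row (?K * kappa m n)" "b < dim_col (?K * kappa m n)"
    then have ab: "a < ?N" "b < ?N" by (simp_all)
    have "(?T * W) $$ (a, b) = (\<Sum>c<?N. (- 1) ^ (p * idx_parity m a) * ?K $$ (a, c) *
        ((- 1) ^ (p * idx_parity m c) * kappa m n $$ (c, b)))"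
      using ab by (auto simp: scalar_prod_def signed_kappa_inv_def W_def lessThan_atLeast0 intro!: sum.cong)
    also have "\<dots> = (\<Sum>c<?N. ?K $$ (a, c) * kappa m n $$ (c, b))"
    proof (rule sum.cong [OF refl])
      fix c assume "c \<in> {..<?N}"
      then have "?K $$ (a, c) = 0 \<or> idx_parity m a = idx_parity m c"
        using kappa_inv_parity [OF ab(1)] by auto
      then show "(- 1) ^ (p * idx_parity m a) * ?K $$ (a, c) * ((- 1) ^ (p * idx_parity m c) * kappa m n $$ (c, b))
          = ?K $$ (a, c) * kappa m n $$ (c, b)"
        by (cases "even (p * idx_parity m c)") auto
    qed
    also have "\<dots> = (?K * kappa m n) $$ (a, b)"
      using ab by (auto simp: scalar_prod_def lessThan_atLeast0 intro!: sum.cong)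
    finally show "(?T * W) $$ (a, b) = (?K * kappa m n) $$ (a, b)" .
  qed (simp_all add: W_def signed_kappa_inv_def)
  have "Y\<^sup>T * kappa m n = - (W * Y)"
  proof (rule eq_matI)
    fix a b assume "a < dim_row (- (W * Y))" "b < dim_col (- (W * Y))"
    then have ab: "a < ?N" "b < ?N" using W Yc by auto
    have unit: "vec_parity m n (idx_parity m c) (unit_vec ?N c)" if "c < ?N" for c
      using that by (auto simp: vec_parity_def unit_vec_def split: if_splits)
    have col: "Z *\<^sub>v unit_vec ?N c = col Z c" if "c < ?N" "Z \<in> carrier_mat ?N ?N"
      for c and Z :: "complex mat"
      using that by (intro eq_vecI) auto
    note mult = col [OF _ Yc] and kappa_col = col [OF ab(2) kc]
    have 1: "bform m n (Y *\<^sub>v unit_vec ?N a) (unit_vec ?N b) = (Y\<^sup>T * kappa m n) $$ (a, b)"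
      using ab Yc by (simp add: bform_def mult kappa_col)
    have 2: "bform m n (unit_vec ?N a) (Y *\<^sub>v unit_vec ?N b) = (kappa m n * Y) $$ (a, b)"
    proof -
      have "kappa m n *\<^sub>v col Y b \<in> carrier_vec ?N" by (intro carrier_vecI) simp
      then show ?thesis using ab Yc by (simp add: bform_def mult scalar_prod_left_unit)
    qed
    have 3: "(W * Y) $$ (a, b) = (- 1) ^ (p * idx_parity m a) * (kappa m n * Y) $$ (a, b)"
      using ab Yc by (auto simp: scalar_prod_def W_def sum_distrib_left mult.assoc intro!: sum.cong)
    have "bform m n (Y *\<^sub>v unit_vec ?N a) (unit_vec ?N b)
        + (- 1) ^ (p * idx_parity m a) * bform m n (unit_vec ?N a) (Y *\<^sub>v unit_vec ?N b) = 0"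
      by (rule form [OF _ _ unit unit]) (use ab in \<open>auto simp: idx_parity_def\<close>)
    then have "(Y\<^sup>T * kappa m n) $$ (a, b) + (W * Y) $$ (a, b) = 0" by (simp only: 1 2 3)
    then show "(Y\<^sup>T * kappa m n) $$ (a, b) = (- (W * Y)) $$ (a, b)"
      using ab W Yc by (simp add: eq_neg_iff_add_eq_0)
  qed (use W Yc in auto)
  then have "?T * (Y\<^sup>T * kappa m n) = - (?T * (W * Y))"
    using W Yc by (simp add: signed_kappa_inv_def)
  also have "?T * (W * Y) = Y"
    by (simp only: assoc_mult_mat [OF signed_kappa_inv_carrier W Yc, symmetric] TW left_mult_one_mat [OF Yc])
  finally have *: "?T * (Y\<^sup>T * kappa m n) = - Y" .
  have "?T * Y\<^sup>T = (?T * Y\<^sup>T) * (kappa m n * ?K)"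
    using YT by (simp add: kappa_kappa_inv signed_kappa_inv_def)
  also have "\<dots> = (?T * (Y\<^sup>T * kappa m n)) * ?K"
    by (simp only: assoc_mult_mat [OF mult_carrier_mat [OF signed_kappa_inv_carrier YT] kc Kc, symmetric]
        assoc_mult_mat [OF signed_kappa_inv_carrier YT kc])
  also have "\<dots> = - (Y * ?K)" unfolding * using Yc by simp
  finally have "?T * Y\<^sup>T = - (Y * ?K)" .
  then show ?thesis using Yc Kc by (intro eq_matI) auto
qed

lemma osp_carrier: "Y \<in> osp m n \<Longrightarrow> Y \<in> carrier_mat (m + 2 * n) (m + 2 * n)"
  by (induction rule: osp.induct) (auto simp: mat_parity_def)

lemma lie_act_add:
  assumes "Y \<in> carrier_mat (m + 2 * n) (m + 2 * n)" "Z \<in> carrier_mat (m + 2 * n) (m + 2 * n)"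
  shows "lie_act m n (Y + Z) f = lie_act m n Y f + lie_act m n Z f"
  using assms by (simp add: lie_act_def lin_act_def sconst.c_add distrib_right sum.distrib)

lemma lie_act_smult:
  assumes "Y \<in> carrier_mat (m + 2 * n) (m + 2 * n)"
  shows "lie_act m n (c \<cdot>\<^sub>m Y) f = sconst c * lie_act m n Y f"
  using assms by (simp add: lie_act_def lin_act_def sconst.c_mult sum_distrib_left sum_distrib_right mult.assoc)

text \<open>The Leibniz rule is available for homogeneous elements only. The action is linear in Y
  and \<open>osp\<close> is generated linearly by homogeneous elements, which annihilate the q_ts;
  so these are the only ones to be considered.\<close>

lemma lie_act_osp_zero:
  assumes "Y \<in> osp m n"
    and homogeneous: "\<And>p Y. mat_parity m n p Y \<Longrightarrow> (\<And>t s. t < m \<Longrightarrow> s < m \<Longrightarrow> lie_act m n Y (qform m n t s) = 0) \<Longrightarrow>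
      lie_act m n Y f = 0"
  shows "lie_act m n Y f = 0"
  using assms(1)
proof (induction rule: osp.induct)
  case (homogeneous p Y)
  have rel: "Y * kappa_inv m n + signed_kappa_inv m n p * Y\<^sup>T = 0\<^sub>m (m + 2 * n) (m + 2 * n)"
    by (rule osp_homogeneous_relation [OF homogeneous(2)]) (rule homogeneous(3))
  have "lie_act m n Y (qform m n t s) = 0" if "t < m" "s < m" for t s
    unfolding lie_act_qform [OF homogeneous(2) that] rel by (rule sconst.bil_zero)
  then show ?case using assms(2) homogeneous(2) by blast
qed (simp_all add: lie_act_add lie_act_smult osp_carrier)

section \<open>The Euler derivation and the degree\<close>

lemma lookup_pvar_pderiv:
  "Poly_Mapping.lookup (pvar v * pderiv_var v p) \<alpha> =
    of_nat (Poly_Mapping.lookup \<alpha> v) * Poly_Mapping.lookup p \<alpha>"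
proof -
  let ?e = "Poly_Mapping.single v (1::nat)"
  have single: "pvar v * pderiv_var v (Poly_Mapping.single \<beta> a) =
      Poly_Mapping.single \<beta> (of_nat (Poly_Mapping.lookup \<beta> v) * a)" for \<beta> a
  proof (cases "Poly_Mapping.lookup \<beta> v = 0")
    case False
    then have "?e + (\<beta> - ?e) = \<beta>"
      by (intro poly_mapping_eqI) (auto simp: lookup_add lookup_minus lookup_single when_def)
    then show ?thesis by (simp add: pvar_def pderiv_var_single mult_single)
  qed (simp add: pderiv_var_single)
  have "pvar v * pderiv_var v p = (\<Sum>\<beta>\<in>Poly_Mapping.keys p.
      Poly_Mapping.single \<beta> (of_nat (Poly_Mapping.lookup \<beta> v) * Poly_Mapping.lookup p \<beta>))"
    by (subst poly_mapping_sum_single [of p]) (simp only: pderiv_var_sum sum_distrib_left single)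
  also have "Poly_Mapping.lookup \<dots> \<alpha> = (\<Sum>\<beta>\<in>Poly_Mapping.keys p.
      if \<beta> = \<alpha> then of_nat (Poly_Mapping.lookup \<alpha> v) * Poly_Mapping.lookup p \<alpha> else 0)"
    unfolding lookup_sum by (rule sum.cong) (auto simp: lookup_single when_def)
  finally show ?thesis by (simp add: in_keys_iff)
qed

lemma lookup_of_nat_mult: "Poly_Mapping.lookup (of_nat k * p) \<alpha> = of_nat k * Poly_Mapping.lookup p \<alpha>"
  for p :: cpoly
  by (induction k) (simp_all add: distrib_right lookup_add)

lemma finite_even_gens: "finite (even_gens m)"
proof -
  have "even_gens m = (\<lambda>(a, t). Gen a t) ` ({..<m} \<times> {..<m})" by (auto simp: even_gens_def)
  then show ?thesis by simp
qed

lemma finite_odd_gens: "finite (odd_gens m n)"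
proof -
  have "odd_gens m n = (\<lambda>(a, t). Gen a t) ` ({..<2 * n} \<times> {..<m})" by (auto simp: odd_gens_def)
  then show ?thesis by simp
qed

text \<open>The identity matrix acts as the Euler derivation.\<close>

lemma mat_parity_one: "mat_parity m n 0 (1\<^sub>m (m + 2 * n))"
  by (auto simp: mat_parity_def idx_parity_def)

lemma euler_qform:
  assumes "t < m" "s < m"
  shows "lie_act m n (1\<^sub>m (m + 2 * n)) (qform m n t s) = of_nat 2 * qform m n t s"
proof -
  have "signed_kappa_inv m n 0 = kappa_inv m n"
    using kappa_inv_carrier [of m n] by (intro eq_matI) (auto simp: signed_kappa_inv_def)
  then show ?thesis
    unfolding lie_act_qform [OF mat_parity_one assms]
    by (simp add: qform_eq_bil sconst.bil_add left_mult_one_mat' right_mult_one_mat' flip: mult_2)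
qed

text \<open>The Euler derivation multiplies each monomial by its degree, and degrees can be compared
  in characteristic zero. The sum defining the action runs over generators in range, so membership
  in \<open>superalg\<close> is needed for it to count all variables of a monomial.\<close>

lemma euler_homogeneous:
  assumes f: "f \<in> superalg m n" and euler: "lie_act m n (1\<^sub>m (m + 2 * n)) f = of_nat d * f"
  shows "shomogeneous d f"
  unfolding shomogeneous_def
proof (intro allI ballI)
  fix A \<alpha> assume \<alpha>: "\<alpha> \<in> Poly_Mapping.keys (coef f A)"
  then have nz: "coef f A \<noteq> 0" by auto
  then have fin: "finite A" using coef_infinite by blast
  have A: "A \<subseteq> odd_gens m n" and sub: "Poly_Mapping.keys \<alpha> \<subseteq> even_gens m"
    using f nz \<alpha> by (auto simp: superalg_def)
  let ?L = "\<lambda>f. Poly_Mapping.lookup (coef f A) \<alpha>"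
  have lin: "lin_act m n (1\<^sub>m (m + 2 * n)) a t = Xgen m a t" if "a < m + 2 * n" for a t
  proof -
    have "lin_act m n (1\<^sub>m (m + 2 * n)) a t = (\<Sum>b<m + 2 * n. if b = a then Xgen m a t else 0)"
      unfolding lin_act_def using that by (intro sum.cong) (auto simp: sconst.c_zero)
    then show ?thesis using that by simp
  qed
  have even_part: "?L (Xgen m a t * Xderiv m a t f) = of_nat (Poly_Mapping.lookup \<alpha> (Gen a t)) * ?L f"
    if "a < m" for a t
  proof -
    have "?L (Xgen m a t * Xderiv m a t f) =
        Poly_Mapping.lookup (pvar (Gen a t) * pderiv_var (Gen a t) (coef f A)) \<alpha>"
      using that by (simp add: Xgen_def Xderiv_def coef_gconst_times coef_gmap)
    also have "\<dots> = of_nat (Poly_Mapping.lookup \<alpha> (Gen a t)) * ?L f"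
      by (rule lookup_pvar_pderiv)
    finally show ?thesis .
  qed
  have odd_part: "?L (Xgen m a t * Xderiv m a t f) = (if Gen (a - m) t \<in> A then 1 else 0) * ?L f"
    if "\<not> a < m" for a t
  proof -
    let ?v = "Gen (a - m) t"
    \<comment> \<open>Removing a generator and putting it back projects onto the monomials that
      contain it: both operations have the same sign.\<close>
    have "coef (gtheta ?v * gderiv ?v f) A = (if ?v \<in> A then coef f A else 0)"
    proof (cases "?v \<in> A")
      case True
      have "{b \<in> A - {?v}. b < ?v} = {b \<in> A. b < ?v}" by auto
      then show ?thesis using True
        by (cases "even (card {b \<in> A. b < ?v})")
          (simp_all add: coef_gtheta_times gderiv.rep_eq ksign_single_left insert_absorb)
    qed (simp add: coef_gtheta_times)
    then show ?thesis using that by (simp add: Xgen_def Xderiv_def)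
  qed
  have "of_nat d * ?L f = ?L (lie_act m n (1\<^sub>m (m + 2 * n)) f)"
    unfolding euler coef_of_nat_times by (rule lookup_of_nat_mult [symmetric])
  also have "\<dots> = (\<Sum>a<m + 2 * n. \<Sum>t<m. ?L (Xgen m a t * Xderiv m a t f))"
    by (simp add: lie_act_def coef_sum lookup_sum lin)
  also have "\<dots> = (\<Sum>a<m. \<Sum>t<m. ?L (Xgen m a t * Xderiv m a t f))
      + (\<Sum>a<2 * n. \<Sum>t<m. ?L (Xgen m (m + a) t * Xderiv m (m + a) t f))"
    by (rule sum_lessThan_add)
  also have "(\<Sum>a<m. \<Sum>t<m. ?L (Xgen m a t * Xderiv m a t f)) =
      of_nat (\<Sum>v\<in>Poly_Mapping.keys \<alpha>. Poly_Mapping.lookup \<alpha> v) * ?L f"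
  proof -
    have "(\<Sum>a<m. \<Sum>t<m. ?L (Xgen m a t * Xderiv m a t f)) =
        of_nat (\<Sum>a<m. \<Sum>t<m. Poly_Mapping.lookup \<alpha> (Gen a t)) * ?L f"
      by (simp add: even_part sum_distrib_right)
    also have "(\<Sum>a<m. \<Sum>t<m. Poly_Mapping.lookup \<alpha> (Gen a t)) =
        (\<Sum>v\<in>even_gens m. Poly_Mapping.lookup \<alpha> v)"
      unfolding sum.cartesian_product
      by (rule sum.reindex_bij_witness [of _ "\<lambda>v. (gen_row v, gen_col v)" "\<lambda>(a, t). Gen a t"])
        (auto simp: even_gens_def)
    also have "\<dots> = (\<Sum>v\<in>Poly_Mapping.keys \<alpha>. Poly_Mapping.lookup \<alpha> v)"
      by (rule sum.mono_neutral_right) (use sub in \<open>auto simp: finite_even_gens in_keys_iff\<close>)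
    finally show ?thesis .
  qed
  also have "(\<Sum>a<2 * n. \<Sum>t<m. ?L (Xgen m (m + a) t * Xderiv m (m + a) t f)) = of_nat (card A) * ?L f"
  proof -
    have "(\<Sum>a<2 * n. \<Sum>t<m. ?L (Xgen m (m + a) t * Xderiv m (m + a) t f)) =
        (\<Sum>a<2 * n. \<Sum>t<m. if Gen a t \<in> A then 1 else 0) * ?L f"
      by (simp add: odd_part sum_distrib_right)
    also have "(\<Sum>a<2 * n. \<Sum>t<m. if Gen a t \<in> A then 1 else 0) =
        (\<Sum>v\<in>odd_gens m n. if v \<in> A then 1 else (0 :: complex))"
      unfolding sum.cartesian_product
      by (rule sum.reindex_bij_witness [of _ "\<lambda>v. (gen_row v, gen_col v)" "\<lambda>(a, t). Gen a t"])
        (auto simp: odd_gens_def)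
    also have "\<dots> = of_nat (card A)"
      using A by (simp add: sum.If_cases finite_odd_gens Int_absorb1)
    finally show ?thesis .
  qed
  finally have "of_nat d * ?L f =
      of_nat ((\<Sum>v\<in>Poly_Mapping.keys \<alpha>. Poly_Mapping.lookup \<alpha> v) + card A) * ?L f"
    by (simp add: distrib_right)
  moreover have "?L f \<noteq> 0" using \<alpha> by (simp add: in_keys_iff)
  ultimately show "(\<Sum>v\<in>Poly_Mapping.keys \<alpha>. Poly_Mapping.lookup \<alpha> v) + card A = d"
    by (metis mult_cancel_right of_nat_eq_iff)
qed

section \<open>The determinant of the quadratic form\<close>

abbreviation gmat :: "nat \<Rightarrow> cpoly mat" where
  "gmat m \<equiv> mat m m (\<lambda>(i, j). pvar (Gen i j))"

text \<open>Specialising the matrix of variables to the identity matrix sends \<open>Delta\<close>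
  to 1.\<close>

lemma Delta_nonzero: "Delta m \<noteq> 0"
proof -
  let ?h = "peval (\<lambda>c::complex. c) (\<lambda>v. if gen_row v = gen_col v then 1 else 0)"
  have c: "comm_ring_hom (\<lambda>c::complex. c)" by unfold_locales simp_all
  interpret comm_ring_hom ?h by (rule peval_hom [OF c])
  have "map_mat ?h (gmat m) = 1\<^sub>m m"
    by (intro eq_matI) (auto simp: peval_pvar [OF c])
  then have "?h (Delta m) = 1"
    by (simp only: Delta_def hom_det [symmetric] det_one)
  then show ?thesis by auto
qed

text \<open>\<open>kappa_inv\<close> has no mixed entries and is the identity on even indices; this
  separates the leading term of q_ts from its nilpotent part.\<close>

lemma qform_split:
  "qform m n t s = (\<Sum>a<m. gconst (pvar (Gen a t) * pvar (Gen a s))) +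
    (\<Sum>\<mu><2 * n. \<Sum>\<nu><2 * n. gtheta (Gen \<mu> t) *
      (sconst (kappa_inv m n $$ (m + \<mu>, m + \<nu>)) * gtheta (Gen \<nu> s)))"
proof -
  let ?f = "\<lambda>a b. Xgen m a t * (sconst (kappa_inv m n $$ (a, b)) * Xgen m b s)"
  have "(\<Sum>b<m + 2 * n. ?f a b) = gconst (pvar (Gen a t) * pvar (Gen a s))" if "a < m" for a
  proof -
    have "(\<Sum>b<m + 2 * n. ?f a b) = (\<Sum>b<m + 2 * n. if b = a then gconst (pvar (Gen a t) * pvar (Gen a s)) else 0)"
      using that by (intro sum.cong) (auto simp: kappa_inv_even Xgen_def gconst_mult)
    then show ?thesis using that by simp
  qed
  moreover have "(\<Sum>b<m + 2 * n. ?f (m + \<mu>) b) = (\<Sum>\<nu><2 * n. gtheta (Gen \<mu> t) *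
      (sconst (kappa_inv m n $$ (m + \<mu>, m + \<nu>)) * gtheta (Gen \<nu> s)))" if "\<mu> < 2 * n" for \<mu>
  proof -
    have "(\<Sum>b<m. ?f (m + \<mu>) b) = 0"
      using that by (intro sum.neutral) (simp add: kappa_inv_odd_even)
    then show ?thesis by (simp add: sum_lessThan_add Xgen_def)
  qed
  ultimately show ?thesis
    by (simp add: qform_eq_bil sconst.bil_def sum_lessThan_add [of _ m "2 * n"])
qed

lemma det_transpose_gmat: "det (mat m m (\<lambda>(t, s). \<Sum>a<m. pvar (Gen a t) * pvar (Gen a s))) = Delta m ^ 2"
proof -
  have "mat m m (\<lambda>(t, s). \<Sum>a<m. pvar (Gen a t) * pvar (Gen a s)) = (gmat m)\<^sup>T * gmat m"
    by (intro eq_matI) (auto simp: scalar_prod_def lessThan_atLeast0)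
  then show ?thesis
    using det_mult [of "(gmat m)\<^sup>T" m "gmat m"] det_transpose [of "gmat m" m]
    by (simp add: Delta_def power2_eq_square)
qed

lemma gparity_detQ: "gparity 0 (detQ m n)"
  unfolding detQ_def by (rule gparity_sdet) (rule gparity_qform)

text \<open>Taking the leading term is a ring homomorphism, so it commutes with the determinant and
  leaves that of the Gram matrix of the columns of X.\<close>

lemma coef_detQ_empty: "coef (detQ m n) {} = Delta m ^ 2"
proof -
  have "coef (qform m n t s) {} = (\<Sum>a<m. pvar (Gen a t) * pvar (Gen a s))" for t s
    by (simp add: qform_split coef_sum coef_gconst gtheta.rep_eq)
  moreover have "coef (detQ m n) {} = sdet m (\<lambda>t s. coef (qform m n t s) {})"
    unfolding detQ_def by (rule sdet_hom) (simp_all add: coef_one)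
  ultimately show ?thesis by (simp add: sdet_comm det_transpose_gmat)
qed

section \<open>The group action\<close>

lemma gparity_lin_act:
  assumes Y: "mat_parity m n 0 Y" and a: "a < m + 2 * n"
  shows "gparity (idx_parity m a) (lin_act m n Y a t)"
  unfolding lin_act_def
proof (rule gparity_sum)
  fix b assume b: "b \<in> {..<m + 2 * n}"
  show "gparity (idx_parity m a) (sconst (Y $$ (b, a)) * Xgen m b t)"
  proof (cases "Y $$ (b, a) = 0")
    case False
    then have "idx_parity m a mod 2 = idx_parity m b" using Y a b by (auto simp: mat_parity_def)
    then have "idx_parity m a = idx_parity m b" by (auto simp: idx_parity_def split: if_splits)
    then show ?thesis
      unfolding sconst_def using gparity_Xgen by (auto intro: gparity_gconst_mult)
  qed (simp add: sconst.c_zero)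
qed

lemma coef_gprod_empty:
  assumes "finite A" "A \<noteq> {}" "\<And>v. coef (\<tau> v) {} = 0"
  shows "coef (gprod \<tau> A) {} = 0"
proof -
  have "coef (prod_list (map \<tau> xs)) {} = 0" if "xs \<noteq> []" for xs
    using that assms(3) by (cases xs) auto
  then show ?thesis using assms(1,2) by (simp add: gprod_def)
qed

lemma Abs_geven_sconst_hom: "comm_ring_hom (\<lambda>c. Abs_geven (sconst c))"
proof -
  interpret g: comm_ring_hom "\<lambda>c. Abs_geven (gconst c) :: (gen, cpoly) geven"
    by (rule Abs_geven_gconst_hom)
  show ?thesis
    unfolding sconst_def by unfold_locales (simp_all add: pconst_hom g.hom_add g.hom_mult zero_geven_def one_geven_def)
qed

text \<open>A homomorphism on all of \<open>spoly\<close> that agrees with the group action on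
  \<open>\<S>(m)\<close>; \<open>group_act\<close> itself takes arbitrary values at generators out of range.\<close>

definition gact_even :: "nat \<Rightarrow> nat \<Rightarrow> complex mat \<Rightarrow> cpoly \<Rightarrow> (gen, cpoly) geven" where
  "gact_even m n g = peval (\<lambda>c. Abs_geven (sconst c))
    (\<lambda>v. if v \<in> even_gens m then Abs_geven (lin_act m n g (gen_row v) (gen_col v)) else 0)"

definition gact_odd :: "nat \<Rightarrow> nat \<Rightarrow> complex mat \<Rightarrow> gen \<Rightarrow> spoly" where
  "gact_odd m n g v = (if v \<in> odd_gens m n then lin_act m n g (m + gen_row v) (gen_col v) else 0)"

definition gact :: "nat \<Rightarrow> nat \<Rightarrow> complex mat \<Rightarrow> spoly \<Rightarrow> spoly" where
  "gact m n g = gsubst (\<lambda>p. of_geven (gact_even m n g p)) (gact_odd m n g)"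

context
  fixes m n :: nat and g :: "complex mat"
  assumes g: "g \<in> OSp0 m n"
begin

lemma gparity_gact_odd: "gparity (Suc 0) (gact_odd m n g v)"
proof (cases "v \<in> odd_gens m n")
  case True
  then obtain \<mu> t where v: "v = Gen \<mu> t" "\<mu> < 2 * n" by (auto simp: odd_gens_def)
  then show ?thesis
    using gparity_lin_act [OF OSp0_mat_parity [OF g], of "m + \<mu>" t] True
    by (simp add: gact_odd_def idx_parity_def)
qed (simp add: gact_odd_def)

lemma gact_even_hom: "comm_ring_hom (gact_even m n g)"
  unfolding gact_even_def by (rule peval_hom [OF Abs_geven_sconst_hom])

interpretation even: comm_ring_hom "gact_even m n g" by (rule gact_even_hom)

lemma gact_grassmann_hom: "grassmann_hom (gact_odd m n g) (\<lambda>p. of_geven (gact_even m n g p))"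
proof unfold_locales
  show "gact_odd m n g v * gact_odd m n g w = - (gact_odd m n g w * gact_odd m n g v)" for v w
    by (rule gparity_odd_anticommute [OF gparity_gact_odd gparity_gact_odd])
  show "gact_odd m n g v * gact_odd m n g v = 0" for v
    by (rule gparity_odd_square [OF gparity_gact_odd two_cpoly])
  show "of_geven (gact_even m n g c) * gact_odd m n g v = gact_odd m n g v * of_geven (gact_even m n g c)" for c v
    by (rule gparity_even_commute) simp
qed (simp_all add: even.hom_add even.hom_mult plus_geven.rep_eq times_geven.rep_eq one_geven.rep_eq)

interpretation hom: grassmann_hom "gact_odd m n g" "\<lambda>p. of_geven (gact_even m n g p)"
  by (rule gact_grassmann_hom)

lemmas gact_add = hom.gsubst_add [folded gact_def]
lemmas gact_mult = hom.gsubst_mult [folded gact_def]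
lemmas gact_one = hom.gsubst_one [folded gact_def]
lemmas gact_power = hom.gsubst_power [folded gact_def]
lemmas gact_sum = hom.gsubst_sum [folded gact_def]
lemmas gact_gconst = hom.gsubst_gconst [folded gact_def]
lemmas gact_gtheta = hom.gsubst_gtheta [folded gact_def]

text \<open>An element of \<open>superalg\<close> involves only generators in range, where both maps
  have the same values. The ordered products of even images in \<open>subst\<close> agree with the
  unordered ones computed in \<open>geven\<close>.\<close>

lemma group_act_eq_gact:
  assumes f: "f \<in> superalg m n"
  shows "group_act m n g f = gact m n g f"
  unfolding group_act_def subst_def gact_def gsubst_def
proof (rule sum.cong [OF refl])
  fix A assume "A \<in> {A. coef f A \<noteq> 0}"
  then have A: "coef f A \<noteq> 0" and fin: "finite A" using coef_infinite by auto
  let ?\<xi> = "\<lambda>v. lin_act m n g (gen_row v) (gen_col v)"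
  let ?\<tau> = "\<lambda>v. lin_act m n g (m + gen_row v) (gen_col v)"
  have "A \<subseteq> odd_gens m n" using f A by (auto simp: superalg_def)
  then have \<tau>: "prod_list (map ?\<tau> (sorted_list_of_set A)) = gprod (gact_odd m n g) A"
    unfolding gprod_def using fin by (intro arg_cong [of _ _ prod_list] map_cong refl) (auto simp: gact_odd_def)
  have mono: "prod_list (map (\<lambda>v. ?\<xi> v ^ Poly_Mapping.lookup \<alpha> v) (sorted_list_of_set (Poly_Mapping.keys \<alpha>))) =
      of_geven (\<Prod>v\<in>Poly_Mapping.keys \<alpha>.
        (if v \<in> even_gens m then Abs_geven (?\<xi> v) else 0) ^ Poly_Mapping.lookup \<alpha> v)"
    if \<alpha>: "\<alpha> \<in> Poly_Mapping.keys (coef f A)" for \<alpha>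
  proof -
    have sub: "Poly_Mapping.keys \<alpha> \<subseteq> even_gens m" using f A \<alpha> by (auto simp: superalg_def)
    have "?\<xi> v = of_geven (if v \<in> even_gens m then Abs_geven (?\<xi> v) else 0)" if "v \<in> Poly_Mapping.keys \<alpha>" for v
    proof -
      have "v \<in> even_gens m" using sub that by auto
      then have "gparity 0 (?\<xi> v)"
        using gparity_lin_act [OF OSp0_mat_parity [OF g], of "gen_row v" "gen_col v"]
        by (auto simp: even_gens_def idx_parity_def)
      then show ?thesis using \<open>v \<in> even_gens m\<close> by (simp add: of_geven_Abs)
    qed
    then have "map (\<lambda>v. ?\<xi> v ^ Poly_Mapping.lookup \<alpha> v) (sorted_list_of_set (Poly_Mapping.keys \<alpha>)) =
        map of_geven (map (\<lambda>v. (if v \<in> even_gens m then Abs_geven (?\<xi> v) else 0) ^ Poly_Mapping.lookup \<alpha> v)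
          (sorted_list_of_set (Poly_Mapping.keys \<alpha>)))"
      by (simp add: of_geven_power)
    then show ?thesis
      using prod.distinct_set_conv_list [of "sorted_list_of_set (Poly_Mapping.keys \<alpha>)"
          "\<lambda>v. (if v \<in> even_gens m then Abs_geven (?\<xi> v) else 0) ^ Poly_Mapping.lookup \<alpha> v"]
      by (simp only: of_geven_prod_list [symmetric]) simp
  qed
  have "(\<Sum>\<alpha>\<in>Poly_Mapping.keys (coef f A). sconst (Poly_Mapping.lookup (coef f A) \<alpha>) *
      prod_list (map (\<lambda>v. ?\<xi> v ^ Poly_Mapping.lookup \<alpha> v) (sorted_list_of_set (Poly_Mapping.keys \<alpha>)))) =
      of_geven (gact_even m n g (coef f A))"
    unfolding gact_even_def peval_def of_geven_sum times_geven.rep_eq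
    by (intro sum.cong refl) (simp add: mono of_geven_Abs sconst_def)
  then show "(\<Sum>\<alpha>\<in>Poly_Mapping.keys (coef f A). sconst (Poly_Mapping.lookup (coef f A) \<alpha>) *
      prod_list (map (\<lambda>v. ?\<xi> v ^ Poly_Mapping.lookup \<alpha> v) (sorted_list_of_set (Poly_Mapping.keys \<alpha>))) *
      prod_list (map ?\<tau> (sorted_list_of_set A))) =
      of_geven (gact_even m n g (coef f A)) * gprod (gact_odd m n g) A"
    by (simp only: \<tau> flip: sum_distrib_right)
qed

lemma gact_sconst: "gact m n g (sconst c) = sconst c"
proof -
  have "gact m n g (sconst c) = of_geven (gact_even m n g (pconst c))"
    by (simp add: sconst_def gact_gconst)
  also have "\<dots> = of_geven (Abs_geven (sconst c))"
    by (simp only: gact_even_def peval_pconst [OF Abs_geven_sconst_hom])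
  finally show ?thesis by (simp add: of_geven_Abs sconst_def)
qed

lemma gact_even_pvar:
  assumes "i < m" "t < m"
  shows "of_geven (gact_even m n g (pvar (Gen i t))) = lin_act m n g i t"
proof -
  have "Gen i t \<in> even_gens m" using assms by (auto simp: even_gens_def)
  moreover have "gparity 0 (lin_act m n g i t)"
    using gparity_lin_act [OF OSp0_mat_parity [OF g], of i t] assms by (simp add: idx_parity_def)
  ultimately show ?thesis
    unfolding gact_even_def peval_pvar [OF Abs_geven_sconst_hom] by (simp add: of_geven_Abs)
qed

lemma gact_Xgen:
  assumes "a < m + 2 * n" "t < m"
  shows "gact m n g (Xgen m a t) = lin_act m n g a t"
proof (cases "a < m")
  case True
  then show ?thesis using assms by (simp add: Xgen_def gact_gconst gact_even_pvar)
next
  case False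
  then have "Gen (a - m) t \<in> odd_gens m n" using assms by (auto simp: odd_gens_def)
  then show ?thesis using False by (simp add: Xgen_def gact_gtheta gact_odd_def)
qed

lemma gact_qform:
  assumes "t < m" "s < m"
  shows "gact m n g (qform m n t s) = qform m n t s"
proof -
  let ?N = "m + 2 * n" and ?K = "kappa_inv m n"
  have gc: "g \<in> carrier_mat ?N ?N" by (rule OSp0_carrier [OF g])
  have "gact m n g (qform m n t s) =
      sconst.bil ?N ?K (\<lambda>a. lin_act m n g a t) (\<lambda>b. lin_act m n g b s)"
    using assms by (simp add: qform_eq_bil sconst.bil_def gact_sum gact_mult gact_sconst gact_Xgen)
  also have "\<dots> = sconst.bil ?N (g * ?K * g\<^sup>T) (\<lambda>a. Xgen m a t) (\<lambda>b. Xgen m b s)"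
    unfolding lin_act_def
    by (simp only: sconst.bil_left [OF gc kappa_inv_carrier]
        sconst.bil_right [OF gc mult_carrier_mat [OF gc kappa_inv_carrier]])
  finally show ?thesis by (simp only: OSp0_kappa_inv [OF g] qform_eq_bil)
qed

lemma gact_detQ: "gact m n g (detQ m n) = detQ m n"
  unfolding detQ_def sdet_hom [of "gact m n g", OF gact_add gact_mult gact_one]
  by (rule sdet_cong) (rule gact_qform)

text \<open>On the even generators g acts through its block A, so that X becomes the product of the
  transpose of A with X.\<close>

lemma gact_Delta: "of_geven (gact_even m n g (Delta m)) = sconst (det g) * gconst (Delta m)"
proof -
  obtain A B where gAB: "g = four_block_mat A (0\<^sub>m m (2 * n)) (0\<^sub>m (2 * n) m) B"
    and A: "A \<in> orthogonal_group m" and B: "B \<in> symplectic_group n"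
    using g by (auto simp: OSp0_def)
  have Ac: "A \<in> carrier_mat m m" and Bc: "B \<in> carrier_mat (2 * n) (2 * n)"
    using A B by (auto simp: orthogonal_group_def symplectic_group_def)
  have lin: "lin_act m n g i t = gconst (\<Sum>b<m. pconst (A $$ (b, i)) * pvar (Gen b t))"
    if "i < m" for i t
  proof -
    have 1: "g $$ (b, i) = A $$ (b, i)" if "b < m" for b
      using that \<open>i < m\<close> Ac Bc unfolding gAB by (subst index_mat_four_block) auto
    have 2: "g $$ (m + b, i) = 0" if "b < 2 * n" for b
      using that \<open>i < m\<close> Ac Bc unfolding gAB by (subst index_mat_four_block) auto
    show ?thesis
      unfolding lin_act_def sum_lessThan_add
      by (simp add: 1 2 sconst.c_zero Xgen_def gconst_sum gconst_mult sconst_def pconst_hom)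
  qed
  interpret pconst: comm_ring_hom pconst by unfold_locales (simp_all add: pconst_hom)
  have "of_geven (gact_even m n g (Delta m)) =
      sdet m (\<lambda>i j. of_geven (gact_even m n g (pvar (Gen i j))))"
    unfolding Delta_def sdet_of_geven even.hom_det [symmetric]
    by (intro arg_cong [of _ _ of_geven] arg_cong [of _ _ det] eq_matI) auto
  also have "\<dots> = sdet m (\<lambda>i j. gconst (\<Sum>b<m. pconst (A $$ (b, i)) * pvar (Gen b j)))"
    by (rule sdet_cong) (simp add: gact_even_pvar lin)
  also have "\<dots> = gconst (det (mat m m (\<lambda>(i, j). \<Sum>b<m. pconst (A $$ (b, i)) * pvar (Gen b j))))"
    by (rule sdet_gconst)
  also have "mat m m (\<lambda>(i, j). \<Sum>b<m. pconst (A $$ (b, i)) * pvar (Gen b j)) = map_mat pconst A\<^sup>T * gmat m"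
    using Ac by (intro eq_matI) (auto simp: scalar_prod_def lessThan_atLeast0)
  also have "det (map_mat pconst A\<^sup>T * gmat m) = pconst (det A) * Delta m"
    using det_mult [of "map_mat pconst A\<^sup>T" m "gmat m"] Ac det_transpose [OF Ac]
    by (simp add: Delta_def)
  also have "gconst \<dots> = sconst (det g) * gconst (Delta m)"
    unfolding gAB OSp0_det [OF A B] by (simp add: gconst_mult sconst_def)
  finally show ?thesis .
qed

text \<open>Odd generators go to odd elements, which have no constant term, so only the summand with
  \<open>A = {}\<close> survives.\<close>

lemma coef_gact_empty: "coef (gact m n g f) {} = coef (of_geven (gact_even m n g (coef f {}))) {}"
proof -
  let ?F = "insert {} {A. coef f A \<noteq> 0}"
  have nil: "coef (gact_odd m n g v) {} = 0" for v
    using gparity_gact_odd [of v] by (auto simp: gparity_def)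
  have "coef (gact m n g f) {} =
      (\<Sum>A\<in>?F. coef (of_geven (gact_even m n g (coef f A))) {} * coef (gprod (gact_odd m n g) A) {})"
    unfolding gact_def by (subst hom.gsubst_finite_superset [of ?F]) (auto simp: finite_coef coef_sum)
  also have "\<dots> = (\<Sum>A\<in>?F. if A = {} then coef (of_geven (gact_even m n g (coef f {}))) {} else 0)"
  proof (rule sum.cong [OF refl])
    fix A assume "A \<in> ?F"
    then have "finite A" using coef_infinite by auto
    then show "coef (of_geven (gact_even m n g (coef f A))) {} * coef (gprod (gact_odd m n g) A) {} =
        (if A = {} then coef (of_geven (gact_even m n g (coef f {}))) {} else 0)"
      using coef_gprod_empty [of A "gact_odd m n g", OF _ _ nil] by (auto simp: coef_one)
  qed
  finally show ?thesis by (simp add: finite_coef)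
qed

end

section \<open>Square roots of powers of the determinant\<close>

lemma gderiv_eq_0_iff: "gderiv v f = 0 \<longleftrightarrow> (\<forall>A. v \<in> A \<longrightarrow> coef f A = 0)"
  for f :: "('i::linorder, 'r::idom) grassmann"
proof
  assume zero: "gderiv v f = 0"
  show "\<forall>A. v \<in> A \<longrightarrow> coef f A = 0"
  proof (intro allI impI)
    fix A assume v: "v \<in> A"
    have "coef (gderiv v f) (A - {v}) = 0" using zero by simp
    then show "coef f A = 0" using v by (simp add: gderiv.rep_eq insert_absorb)
  qed
qed (auto intro!: grassmann_eqI simp: gderiv.rep_eq)

lemma pderiv_var_eq_0:
  assumes "pderiv_var v p = 0" "\<alpha> \<in> Poly_Mapping.keys p"
  shows "v \<notin> Poly_Mapping.keys \<alpha>"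
proof
  assume v: "v \<in> Poly_Mapping.keys \<alpha>"
  let ?e = "Poly_Mapping.single v (1::nat)"
  have "\<alpha> - ?e + ?e = \<alpha>"
    using v by (intro poly_mapping_eqI) (auto simp: lookup_add lookup_minus lookup_single when_def in_keys_iff)
  then have "of_nat (Suc (Poly_Mapping.lookup (\<alpha> - ?e) v)) * Poly_Mapping.lookup p \<alpha> = 0"
    using lookup_pderiv_var [of v p "\<alpha> - ?e"] assms(1) by (simp only: lookup_zero)
  then show False using assms(2) by (simp add: in_keys_iff del: of_nat_Suc)
qed

lemma gderiv_sconst_mult: "gderiv v (sconst c * f) = sconst c * gderiv v f"
  by (simp add: sconst_def gderiv_gconst_mult)

lemma gderiv_qform:
  assumes "v \<notin> odd_gens m n" "t < m" "s < m"
  shows "gderiv v (qform m n t s) = 0"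
proof -
  interpret even_derivation "gderiv v :: spoly \<Rightarrow> spoly" by (rule gderiv_derivation)
  have gen: "gderiv v (gtheta (Gen \<mu> t) :: spoly) = 0" if "\<mu> < 2 * n" "t < m" for \<mu> t
    using assms(1) that by (auto simp: gderiv_gtheta odd_gens_def)
  have "gderiv v (gtheta (Gen \<mu> t) * (sconst c * gtheta (Gen \<nu> s))) = 0" if "\<mu> < 2 * n" "\<nu> < 2 * n" for \<mu> \<nu> c
    using gderiv_mult_parity [OF gparity_gtheta, of v "Gen \<mu> t" "sconst c * gtheta (Gen \<nu> s)"] gen that assms
    by (simp add: gderiv_sconst_mult)
  then show ?thesis by (simp add: qform_split D_add D_sum)
qed

lemma pderiv_qform:
  assumes "v \<notin> even_gens m" "t < m" "s < m"
  shows "gmap (pderiv_var v) (qform m n t s) = 0"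
proof -
  interpret even_derivation "gmap (pderiv_var v) :: spoly \<Rightarrow> spoly" by (rule gmap_pderiv_derivation)
  have "pderiv_var v (pvar (Gen a t)) = 0" if "a < m" "t < m" for a t
  proof -
    have "v \<noteq> Gen a t" using assms(1) that by (auto simp: even_gens_def)
    then show ?thesis by (simp add: pvar_def pderiv_var_single lookup_single)
  qed
  then have 1: "gmap (pderiv_var v) (gconst (pvar (Gen a t) * pvar (Gen a s))) = 0" if "a < m" for a
    using that assms by (intro grassmann_eqI) (simp add: coef_gmap coef_gconst pderiv_var_times)
  have 2: "gmap (pderiv_var v) (gtheta w) = 0" for w
    by (intro grassmann_eqI) (simp add: coef_gmap gtheta.rep_eq)
  have 3: "gmap (pderiv_var v) (sconst c) = 0" for c
    by (intro grassmann_eqI) (simp add: coef_gmap sconst_def coef_gconst pconst_def pderiv_var_single)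
  show ?thesis by (simp add: qform_split D_add D_sum 1 gmap_pderiv_times 2 3)
qed

locale detQ_root =
  fixes m n :: nat and \<Omega> :: spoly
  assumes even: "gparity 0 \<Omega>" and square: "\<Omega> * \<Omega> = detQ m n ^ (2 * n + 1)"
    and leading: "coef \<Omega> {} = Delta m ^ (2 * n + 1)"
begin

lemma leading_nonzero: "coef \<Omega> {} \<noteq> 0"
  using Delta_nonzero by (simp add: leading)

text \<open>Eigenvalue 2c on the q_ts gives 2mc on det Q, then (2n+1) times that on the square of
  \<Omega>, and half of it on \<Omega>. The case c = 0 is annihilation, c = 1 the Euler
  derivation.\<close>

lemma derivation_eigen:
  assumes D: "even_derivation D" and q: "\<And>t s. t < m \<Longrightarrow> s < m \<Longrightarrow> D (qform m n t s) = of_nat (2 * c) * qform m n t s"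
  shows "D \<Omega> = of_nat (m * (2 * n + 1) * c) * \<Omega>"
proof -
  interpret even_derivation D by (rule D)
  have "D (detQ m n) = of_nat (m * (2 * c)) * detQ m n"
    unfolding detQ_def by (rule D_sdet [OF gparity_qform q])
  then have "D (\<Omega> * \<Omega>) = of_nat ((2 * n + 1) * (m * (2 * c))) * (\<Omega> * \<Omega>)"
    unfolding square by (rule D_power [OF gparity_detQ])
  also have "(2 * n + 1) * (m * (2 * c)) = 2 * (m * (2 * n + 1) * c)" by (simp add: algebra_simps)
  finally show ?thesis by (rule D_sqrt [OF two_cpoly even leading_nonzero])
qed

lemma derivation_zero:
  assumes "even_derivation D" "\<And>t s. t < m \<Longrightarrow> s < m \<Longrightarrow> D (qform m n t s) = 0"
  shows "D \<Omega> = 0"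
  using derivation_eigen [OF assms(1), of 0] assms(2) by simp

text \<open>The derivative in a generator outside the range annihilates all q_ts, hence \<Omega>; in
  characteristic zero this means that the generator does not occur in \<Omega>.\<close>

lemma in_superalg: "\<Omega> \<in> superalg m n"
proof -
  have "gderiv v \<Omega> = 0" if "v \<notin> odd_gens m n" for v
    by (rule derivation_zero [OF gderiv_derivation gderiv_qform [OF that]])
  then have odd: "A \<subseteq> odd_gens m n" if "coef \<Omega> A \<noteq> 0" for A
    using that unfolding gderiv_eq_0_iff by blast
  have "gmap (pderiv_var v) \<Omega> = 0" if "v \<notin> even_gens m" for v
    by (rule derivation_zero [OF gmap_pderiv_derivation pderiv_qform [OF that]])
  then have "pderiv_var v (coef \<Omega> A) = 0" if "v \<notin> even_gens m" for v A
    using that coef_gmap [of "pderiv_var v" \<Omega> A] by simp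
  then have "Poly_Mapping.keys \<alpha> \<subseteq> even_gens m" if "\<alpha> \<in> Poly_Mapping.keys (coef \<Omega> A)" for \<alpha> A
    using that pderiv_var_eq_0 by blast
  with odd show ?thesis by (auto simp: superalg_def)
qed

lemma in_osp_invariants: "\<Omega> \<in> osp_invariants m n"
  unfolding osp_invariants_def
  using in_superalg lie_act_osp_zero [of _ m n \<Omega>] derivation_zero lie_act_derivation by blast

lemma homogeneous: "shomogeneous (m * (2 * n + 1)) \<Omega>"
proof (rule euler_homogeneous [OF in_superalg])
  have "lie_act m n (1\<^sub>m (m + 2 * n)) (qform m n t s) = of_nat (2 * 1) * qform m n t s" if "t < m" "s < m" for t s
    using euler_qform [OF that] by simp
  from derivation_eigen [OF lie_act_derivation [OF mat_parity_one] this]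
  show "lie_act m n (1\<^sub>m (m + 2 * n)) \<Omega> = of_nat (m * (2 * n + 1)) * \<Omega>" by simp
qed

lemma group_act:
  assumes g: "g \<in> OSp0 m n"
  shows "group_act m n g \<Omega> = sconst (det g) * \<Omega>"
proof -
  interpret even: comm_ring_hom "gact_even m n g" by (rule gact_even_hom [OF g])
  let ?\<Omega>' = "gact m n g \<Omega>" and ?d = "sconst (det g)"
  have det: "det g * det g = 1"
    using g by (auto simp: OSp0_def OSp0_det orthogonal_det)
  then have dd: "?d * ?d = 1" by (simp flip: sconst.c_mult)
  \<comment> \<open>The square of the determinant is 1, and the odd exponent of \<open>Delta\<close>
    in the leading term is why the sign survives.\<close>
  have oddpow: "?d ^ (2 * n + 1) = ?d"
    by (simp add: power_add power_mult power2_eq_square dd)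
  have sq: "?\<Omega>' * ?\<Omega>' = \<Omega> * \<Omega>"
    by (simp only: square gact_mult [OF g, symmetric] gact_power [OF g] gact_detQ [OF g])
  have "coef ?\<Omega>' {} = coef (of_geven (gact_even m n g (Delta m)) ^ (2 * n + 1)) {}"
    by (simp only: coef_gact_empty [OF g] leading even.hom_power of_geven_power)
  also have "of_geven (gact_even m n g (Delta m)) ^ (2 * n + 1) = ?d ^ (2 * n + 1) * gconst (Delta m) ^ (2 * n + 1)"
    by (simp only: gact_Delta [OF g] sconst_def gconst_mult [symmetric] gconst_power [symmetric] power_mult_distrib)
  finally have lead: "coef ?\<Omega>' {} = coef (?d * \<Omega>) {}"
    unfolding oddpow by (simp add: coef_gconst leading)
  have "(?\<Omega>' + ?d * \<Omega>) * (?\<Omega>' - ?d * \<Omega>) = ?\<Omega>' * ?\<Omega>' - ?d * ?d * (\<Omega> * \<Omega>)"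
  proof -
    have "?\<Omega>' * (?d * \<Omega>) = ?d * \<Omega> * ?\<Omega>'"
      using gparity_even_commute [OF even, of ?\<Omega>'] by (simp add: sconst.c_central [of _ ?\<Omega>', symmetric] mult.assoc flip: mult.assoc [of ?\<Omega>'])
    moreover have "?d * \<Omega> * (?d * \<Omega>) = ?d * ?d * (\<Omega> * \<Omega>)"
      using sconst.c_central [of "det g" \<Omega>] by (metis mult.assoc)
    ultimately show ?thesis by (simp add: distrib_left distrib_right right_diff_distrib left_diff_distrib)
  qed
  then have "(?\<Omega>' + ?d * \<Omega>) * (?\<Omega>' - ?d * \<Omega>) = 0" by (simp add: dd sq)
  moreover have "coef (?\<Omega>' + ?d * \<Omega>) {} \<noteq> 0"
  proof -
    have "pconst (det g) \<noteq> 0" using det by (metis mult_zero_left pconst_hom(2-4) zero_neq_one)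
    then have "coef (?d * \<Omega>) {} \<noteq> 0"
      using leading_nonzero by (simp add: sconst_def coef_gconst_times coef_gconst)
    then show ?thesis using two_cpoly by (simp add: lead flip: mult_2)
  qed
  ultimately have "?\<Omega>' - ?d * \<Omega> = 0" by (rule grassmann_mult_eq_0)
  then show ?thesis by (simp add: group_act_eq_gact [OF g in_superalg])
qed

lemma pseudo: "pseudo_invariant m n \<Omega>"
  by (simp add: pseudo_invariant_def in_osp_invariants group_act)

end

section \<open>Polynomiality\<close>

lemma gconst_left_commute: "f * (gconst c * g) = gconst c * (f * g)"
  by (simp only: mult.assoc [symmetric] gconst_commute [of c f])

definition fr :: "cpoly \<Rightarrow> cpoly fract" where
  "fr p = Fract p 1"

lemma fr_hom: "comm_ring_hom fr"
  by unfold_locales (simp_all add: fr_def Zero_fract_def One_fract_def)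

interpretation fr: comm_ring_hom fr by (rule fr_hom)

lemma fr_inject: "fr p = fr q \<longleftrightarrow> p = q"
  by (simp add: fr_def eq_fract)

lemma fr_eq_0_iff: "fr p = 0 \<longleftrightarrow> p = 0"
  using fr_inject [of p 0] by (simp only: fr.hom_zero)

lemma two_fract: "(2 :: cpoly fract) \<noteq> 0"
proof -
  have "fr 2 = 2" using fr.hom_add [of 1 1] by simp
  then show ?thesis using fr_eq_0_iff [of 2] two_cpoly by simp
qed

lemma coef_to_loc: "coef (to_loc f) A = fr (coef f A)"
  by (simp add: to_loc_def coef_gmap fr_def Zero_fract_def [symmetric])

lemma to_loc_zero: "to_loc 0 = 0"
  by (rule grassmann_eqI) (simp add: coef_to_loc)

lemma to_loc_minus: "to_loc (f - g) = to_loc f - to_loc g"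
  by (rule grassmann_eqI) (simp add: coef_to_loc fr.hom_minus)

lemma to_loc_sum: "to_loc (sum f I) = (\<Sum>i\<in>I. to_loc (f i))"
  by (induction I rule: infinite_finite_induct) (simp_all add: to_loc_zero to_loc_hom)

lemma to_loc_power: "to_loc (f ^ k) = to_loc f ^ k"
  by (induction k) (simp_all add: to_loc_hom)

lemma to_loc_gconst: "to_loc (gconst p) = gconst (fr p)"
  by (rule grassmann_eqI) (simp add: coef_to_loc coef_gconst)

lemma to_loc_gtheta: "to_loc (gtheta v) = gtheta v"
  by (rule grassmann_eqI) (simp add: coef_to_loc gtheta.rep_eq)

lemma to_loc_gderiv: "gderiv v (to_loc f) = to_loc (gderiv v f)"
proof (rule grassmann_eqI)
  fix A
  show "coef (gderiv v (to_loc f)) A = coef (to_loc (gderiv v f)) A"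
    by (cases "even (card {b \<in> A. b < v})") (simp_all add: coef_to_loc gderiv.rep_eq fr.hom_uminus)
qed

lemma gparity_to_loc: "gparity r (to_loc f) \<longleftrightarrow> gparity r f"
  by (simp add: gparity_def coef_to_loc fr_eq_0_iff)

lemma lconst_eq: "lconst c = gconst (fr (pconst c))"
  by (simp add: lconst_def sconst_def to_loc_gconst)

lemma lconst_central_hom: "central_hom lconst"
proof
  show "lconst x * f = f * lconst x" for x f
    unfolding lconst_eq by (rule gconst_commute)
qed (simp_all add: lconst_eq pconst_hom gconst_add gconst_mult fr.hom_add fr.hom_mult)

interpretation lconst: central_hom lconst by (rule lconst_central_hom)

text \<open>\<open>uvar\<close> is \<open>u = \<Theta> X\<^sup>-\<^sup>1\<close>. Multiplication by \<open>\<Delta>\<^sup>2\<^sup>n\<close>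
  turns the product of all \<open>u\<close> into the product of all \<open>\<theta>\<close>; the other monomials in \<open>u\<close>
  arise from it by the derivations \<open>\<partial>/\<partial>u = \<Sum>\<^sub>t x\<^sub>t \<partial>/\<partial>\<theta>\<^sub>t\<close>
  (\<open>uderiv\<close>), which have polynomial coefficients.\<close>

definition Xinv :: "nat \<Rightarrow> cpoly fract mat" where
  "Xinv m = inverse (fr (Delta m)) \<cdot>\<^sub>m adj_mat (map_mat fr (gmat m))"

definition uvar :: "nat \<Rightarrow> nat \<Rightarrow> gen \<Rightarrow> lpoly" where
  "uvar m n v = (if v \<in> odd_gens m n
    then \<Sum>t<m. gconst (Xinv m $$ (t, gen_col v)) * gtheta (Gen (gen_row v) t) else 0)"

lemma fr_Delta: "det (map_mat fr (gmat m)) = fr (Delta m)"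
  by (simp only: fr.hom_det Delta_def)

lemma Xinv_carrier: "Xinv m \<in> carrier_mat m m"
  unfolding Xinv_def by (intro smult_carrier_mat adj_mat(1)) simp

lemma X_Xinv: "map_mat fr (gmat m) * Xinv m = 1\<^sub>m m"
  and Xinv_X: "Xinv m * map_mat fr (gmat m) = 1\<^sub>m m"
proof -
  let ?X = "map_mat fr (gmat m)"
  have X: "?X \<in> carrier_mat m m" by simp
  have "?X * Xinv m = inverse (fr (Delta m)) \<cdot>\<^sub>m (?X * adj_mat ?X)"
    unfolding Xinv_def by (rule mult_smult_distrib [OF X adj_mat(1) [OF X]])
  also have "\<dots> = inverse (fr (Delta m)) \<cdot>\<^sub>m (fr (Delta m) \<cdot>\<^sub>m 1\<^sub>m m)"
    by (simp only: adj_mat(2) [OF X] fr_Delta)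
  also have "\<dots> = 1\<^sub>m m"
  proof -
    have "fr (Delta m) \<noteq> 0" by (simp only: fr_eq_0_iff Delta_nonzero not_False_eq_True)
    then have "inverse (fr (Delta m)) * fr (Delta m) = 1" by (rule left_inverse)
    then show ?thesis by (intro eq_matI) (auto)
  qed
  finally show *: "?X * Xinv m = 1\<^sub>m m" .
  show "Xinv m * ?X = 1\<^sub>m m"
    by (rule mat_mult_left_right_inverse [OF X Xinv_carrier *])
qed

lemma X_Xinv_entry:
  assumes "a < m" "b < m"
  shows "(\<Sum>t<m. fr (pvar (Gen a t)) * Xinv m $$ (t, b)) = (if a = b then 1 else 0)"
proof -
  have "(map_mat fr (gmat m) * Xinv m) $$ (a, b) = (\<Sum>t<m. fr (pvar (Gen a t)) * Xinv m $$ (t, b))"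
    using assms Xinv_carrier [of m] by (auto simp: scalar_prod_def lessThan_atLeast0 intro!: sum.cong)
  then show ?thesis using assms by (simp only: X_Xinv index_one_mat)
qed

lemma Xinv_X_entry:
  assumes "s < m" "t < m"
  shows "(\<Sum>a<m. Xinv m $$ (s, a) * fr (pvar (Gen a t))) = (if s = t then 1 else 0)"
proof -
  have "(Xinv m * map_mat fr (gmat m)) $$ (s, t) = (\<Sum>a<m. Xinv m $$ (s, a) * fr (pvar (Gen a t)))"
    using assms Xinv_carrier [of m] by (auto simp: scalar_prod_def lessThan_atLeast0 intro!: sum.cong)
  then show ?thesis using assms by (simp only: Xinv_X index_one_mat)
qed

lemma gparity_uvar: "gparity (Suc 0) (uvar m n v)"
  by (auto simp: uvar_def intro!: gparity_sum gparity_gconst_mult)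

lemma uvar_Gen: "\<mu> < 2 * n \<Longrightarrow> a < m \<Longrightarrow>
    uvar m n (Gen \<mu> a) = (\<Sum>t<m. gconst (Xinv m $$ (t, a)) * gtheta (Gen \<mu> t))"
  by (auto simp: uvar_def odd_gens_def)

lemma gtheta_uvar:
  assumes "\<mu> < 2 * n" "t < m"
  shows "gtheta (Gen \<mu> t) = (\<Sum>a<m. gconst (fr (pvar (Gen a t))) * uvar m n (Gen \<mu> a))"
proof -
  have "(\<Sum>a<m. gconst (fr (pvar (Gen a t))) * uvar m n (Gen \<mu> a)) =
      (\<Sum>a<m. \<Sum>s<m. gconst (Xinv m $$ (s, a) * fr (pvar (Gen a t))) * gtheta (Gen \<mu> s))"
    using assms
    by (intro sum.cong) (auto simp: uvar_Gen sum_distrib_left mult.assoc [symmetric] mult.commute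
        simp flip: gconst_mult)
  also have "\<dots> = (\<Sum>s<m. gconst (\<Sum>a<m. Xinv m $$ (s, a) * fr (pvar (Gen a t))) * gtheta (Gen \<mu> s))"
    by (subst sum.swap) (simp only: gconst_sum sum_distrib_right)
  also have "\<dots> = (\<Sum>s<m. if s = t then gtheta (Gen \<mu> t) else 0)"
    using assms by (intro sum.cong) (auto simp: Xinv_X_entry)
  finally show ?thesis using assms by simp
qed

lemma anticommuting_uvar: "anticommuting (uvar m n)"
  by unfold_locales (rule gparity_odd_anticommute [OF gparity_uvar gparity_uvar],
      rule gparity_odd_square [OF gparity_uvar two_fract])

interpretation u: grassmann_hom "uvar m n" lconst for m n
proof -
  interpret anticommuting "uvar m n" by (rule anticommuting_uvar)
  show "grassmann_hom (uvar m n) lconst"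
    by unfold_locales (rule lconst.c_add, rule lconst.c_mult, rule lconst.c_one, rule lconst.c_central)
qed

text \<open>Generators are ordered by row first, so the product of all odd generators is a product
  over rows, and each row can be treated by its own determinant.\<close>

lemma sorted_odd_gens:
  "sorted_list_of_set (odd_gens m n) = concat (map (\<lambda>\<mu>. map (Gen \<mu>) [0..<m]) [0..<2 * n])"
proof -
  let ?l = "\<lambda>k. concat (map (\<lambda>\<mu>. map (Gen \<mu>) [0..<m]) [0..<k])"
  have set: "set (?l k) = {Gen \<mu> t | \<mu> t. \<mu> < k \<and> t < m}" for k by auto
  have row: "sorted_wrt (<) (map (Gen \<mu>) [0..<m])" for \<mu>
    by (auto simp: sorted_wrt_map less_gen_def intro: sorted_wrt_mono_rel [OF _ sorted_wrt_upt])
  have "sorted_wrt (<) (?l k)" for k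
  proof (induction k)
    case (Suc k)
    then show ?case by (simp add: sorted_wrt_append row) (auto simp: less_gen_def)
  qed simp
  then have "sorted (?l (2 * n)) \<and> distinct (?l (2 * n))"
    by (simp only: strict_sorted_iff [symmetric])
  moreover have "set (?l (2 * n)) = odd_gens m n" unfolding set odd_gens_def ..
  ultimately show ?thesis by (metis sorted_list_of_set.idem_if_sorted_distinct)
qed

text \<open>Within a row the \<theta> are linear combinations of the u with the transpose of X as
  matrix, so by \<open>prod_list_linear\<close> each of the 2n rows yields one factor
  \<open>Delta\<close>.\<close>

lemma gprod_uvar_top: "gconst (fr (Delta m) ^ (2 * n)) * gprod (uvar m n) (odd_gens m n) = gprod gtheta (odd_gens m n)"
proof -
  let ?M = "(map_mat fr (gmat m))\<^sup>T" and ?D = "gconst (fr (Delta m)) :: lpoly"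
  have det: "det ?M = fr (Delta m)"
    by (subst det_transpose [of _ m]) (simp_all only: fr_Delta, simp)
  have row: "prod_list (map (\<lambda>t. gtheta (Gen \<mu> t)) [0..<m]) =
      ?D * prod_list (map (\<lambda>a. uvar m n (Gen \<mu> a)) [0..<m])" if "\<mu> < 2 * n" for \<mu>
  proof -
    have anti: "anticommuting (\<lambda>a. uvar m n (Gen \<mu> a))"
      by unfold_locales (rule u.anticommute, rule u.square_zero)
    have "prod_list (map (\<lambda>t. gtheta (Gen \<mu> t)) [0..<m]) =
        prod_list (map (\<lambda>t. \<Sum>a<m. gconst (?M $$ (t, a)) * uvar m n (Gen \<mu> a)) [0..<m])"
      using that by (intro arg_cong [of _ _ prod_list] map_cong refl) (simp add: gtheta_uvar)
    then show ?thesis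
      by (simp only: prod_list_linear [OF anti, of ?M m, simplified] det transpose_carrier_mat map_carrier_mat mat_carrier)
  qed
  have rows: "prod_list (map (\<lambda>\<mu>. ?D * f \<mu>) xs) = ?D ^ length xs * prod_list (map f xs)"
    for f :: "nat \<Rightarrow> lpoly" and xs
  proof (induction xs)
    case (Cons x xs)
    have "f x * ?D ^ length xs = ?D ^ length xs * f x"
      by (simp only: gconst_power [symmetric] gconst_commute)
    then show ?case by (simp add: Cons mult.assoc flip: mult.assoc [of "f x"])
  qed simp
  have concat: "prod_list (map \<tau> (concat xss)) = prod_list (map (\<lambda>xs. prod_list (map \<tau> xs)) xss)"
    for \<tau> :: "gen \<Rightarrow> lpoly" and xss
    by (induction xss) simp_all
  have "(gprod gtheta (odd_gens m n) :: lpoly) = prod_list (map (\<lambda>\<mu>. prod_list (map (\<lambda>t. gtheta (Gen \<mu> t)) [0..<m])) [0..<2 * n])"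
    by (simp add: gprod_def sorted_odd_gens concat comp_def)
  also have "\<dots> = prod_list (map (\<lambda>\<mu>. ?D * prod_list (map (\<lambda>a. uvar m n (Gen \<mu> a)) [0..<m])) [0..<2 * n])"
    by (intro arg_cong [of _ _ prod_list] map_cong refl) (simp add: row)
  also have "\<dots> = ?D ^ (2 * n) * gprod (uvar m n) (odd_gens m n)"
    unfolding rows by (simp add: gprod_def sorted_odd_gens concat comp_def)
  finally show ?thesis by (simp add: gconst_power)
qed

definition uderiv :: "nat \<Rightarrow> gen \<Rightarrow> lpoly \<Rightarrow> lpoly" where
  "uderiv m v f = (\<Sum>t<m. gconst (fr (pvar (Gen (gen_col v) t))) * gderiv (Gen (gen_row v) t) f)"

lemma uderiv_gconst_mult: "uderiv m v (gconst c * f) = gconst c * uderiv m v f"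
  unfolding uderiv_def gderiv_gconst_mult sum_distrib_left
  by (intro sum.cong refl) (simp add: mult.commute flip: mult.assoc gconst_mult)

lemma uderiv_odd_mult:
  assumes "gparity (Suc 0) f"
  shows "uderiv m v (f * g) = uderiv m v f * g - f * uderiv m v g"
proof -
  have "gconst c * gderiv w (f * g) = gconst c * gderiv w f * g - f * (gconst c * gderiv w g)" for c w
  proof -
    show ?thesis
      by (simp add: gderiv_mult_parity [OF assms] right_diff_distrib mult.assoc gconst_left_commute [of f])
  qed
  then show ?thesis
    by (simp add: uderiv_def sum_subtractf sum_distrib_left sum_distrib_right)
qed

text \<open>The coefficients combine to an entry of X times its inverse; hence \<open>uderiv\<close>
  really is the partial derivative in the variables u.\<close>

lemma uderiv_uvar:
  assumes "v \<in> odd_gens m n" "w \<in> odd_gens m n"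
  shows "uderiv m v (uvar m n w) = (if v = w then 1 else 0)"
proof -
  obtain \<mu> a \<nu> b where v: "v = Gen \<mu> a" "\<mu> < 2 * n" "a < m" and w: "w = Gen \<nu> b" "\<nu> < 2 * n" "b < m"
    using assms by (auto simp: odd_gens_def)
  have D: "gderiv (Gen \<mu> t) (uvar m n w) = (if \<mu> = \<nu> then gconst (Xinv m $$ (t, b)) else 0)" if "t < m" for t
  proof -
    interpret even_derivation "gderiv (Gen \<mu> t) :: lpoly \<Rightarrow> lpoly" by (rule gderiv_derivation)
    have "gderiv (Gen \<mu> t) (uvar m n w) =
        (\<Sum>s<m. gconst (Xinv m $$ (s, b)) * (if \<mu> = \<nu> \<and> t = s then 1 else 0))"
      using w by (simp add: uvar_Gen D_sum gderiv_gconst_mult gderiv_gtheta)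
    also have "\<dots> = (\<Sum>s<m. if s = t then if \<mu> = \<nu> then gconst (Xinv m $$ (t, b)) else 0 else 0)"
      by (intro sum.cong) auto
    finally show ?thesis using that by simp
  qed
  have "uderiv m v (uvar m n w) =
      (\<Sum>t<m. if \<mu> = \<nu> then gconst (fr (pvar (Gen a t)) * Xinv m $$ (t, b)) else 0)"
    using v by (simp add: uderiv_def D gconst_mult if_distrib cong: if_cong)
  also have "\<dots> = (if v = w then 1 else 0)"
  proof (cases "\<mu> = \<nu>")
    case True
    then show ?thesis using v w by (simp add: X_Xinv_entry flip: gconst_sum)
  qed (use v w in simp)
  finally show ?thesis .
qed

lemma uderiv_gprod:
  assumes v: "v \<in> odd_gens m n" "v \<notin> A" and A: "A \<subseteq> odd_gens m n"
  shows "uderiv m v (gprod (uvar m n) A) = 0"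
proof -
  have zero: "uderiv m v 1 = 0"
    using uderiv_gconst_mult [of m v 0 1] by (simp add: uderiv_def flip: gconst_one del: gconst_one)
  have "uderiv m v (prod_list (map (uvar m n) xs)) = 0" if "set xs \<subseteq> odd_gens m n" "v \<notin> set xs" for xs
    using that by (induction xs) (auto simp: zero uderiv_odd_mult [OF gparity_uvar] uderiv_uvar v)
  moreover have "finite A" using A finite_odd_gens finite_subset by blast
  ultimately show ?thesis using assms by (simp add: gprod_def)
qed

lemma uderiv_to_loc: "uderiv m v (to_loc f) \<in> range to_loc"
  unfolding uderiv_def to_loc_gderiv to_loc_gconst [symmetric] to_loc_hom(2) [symmetric] to_loc_sum [symmetric]
  by (rule rangeI)

text \<open>Downward induction from the full product: the product over A is the derivative in u_v of
  the product with one more factor. The power of \<open>Delta\<close> may be carried along because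
  \<open>uderiv\<close> differentiates odd variables only and is linear over the rational
  functions.\<close>

lemma gprod_uvar_polynomial:
  assumes "A \<subseteq> odd_gens m n"
  shows "gconst (fr (Delta m) ^ (2 * n)) * gprod (uvar m n) A \<in> range to_loc"
  using assms
proof (induction "card (odd_gens m n - A)" arbitrary: A rule: less_induct)
  case less
  let ?c = "gconst (fr (Delta m) ^ (2 * n)) :: lpoly" and ?I = "odd_gens m n"
  have fin: "finite ?I" and finA: "finite A"
    using finite_odd_gens less.prems finite_subset by blast+
  show ?case
  proof (cases "A = ?I")
    case True
    have "prod_list (map gtheta xs) \<in> range to_loc" for xs :: "gen list"
    proof (induction xs)
      case (Cons x xs)
      then obtain f where "prod_list (map gtheta xs) = to_loc f" by auto
      then have "prod_list (map gtheta (x # xs)) = to_loc (gtheta x * f)"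
        by (simp add: to_loc_hom to_loc_gtheta)
      then show ?case by (simp only: rangeI)
    qed (metis list.map(1) prod_list.Nil rangeI to_loc_hom(3))
    then show ?thesis unfolding True gprod_uvar_top unfolding gprod_def .
  next
    case False
    then obtain v where v: "v \<in> ?I" "v \<notin> A" using less.prems by auto
    let ?B = "insert v A"
    have "card (?I - ?B) < card (?I - A)"
      using v fin by (intro psubset_card_mono) auto
    then obtain f where f: "?c * gprod (uvar m n) ?B = to_loc f"
      using less.hyps [of ?B] less.prems v(1) by auto
    have "gprod (uvar m n) A = uderiv m v (uvar m n v * gprod (uvar m n) A)"
      by (simp add: uderiv_odd_mult [OF gparity_uvar] uderiv_uvar [OF v(1) v(1)] uderiv_gprod [OF v less.prems])
    also have "\<dots> = uderiv m v (ksign {v} A * gprod (uvar m n) ?B)"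
      by (simp only: u.gprod_insert [OF finA v(2)])
    finally have "?c * gprod (uvar m n) A = uderiv m v (?c * (ksign {v} A * gprod (uvar m n) ?B))"
      by (simp only: uderiv_gconst_mult)
    also have "?c * (ksign {v} A * gprod (uvar m n) ?B) = to_loc (ksign {v} A * f)"
    proof -
      have "to_loc (ksign {v} A * f) = ksign {v} A * to_loc f"
        using to_loc_minus [of 0 f] by (cases "even (inversions {v} A)") (simp_all add: ksign_def to_loc_zero)
      moreover have "?c * (ksign {v} A * h) = ksign {v} A * (?c * h)" for h
        by (cases "even (inversions {v} A)") (simp_all add: ksign_def)
      ultimately show ?thesis by (simp only: f)
    qed
    finally show ?thesis using uderiv_to_loc by simp
  qed
qed

lemma uvar_subst_polynomial:
  "gconst (fr (Delta m) ^ (2 * n)) * gsubst lconst (uvar m n) h \<in> range to_loc"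
proof -
  let ?c = "gconst (fr (Delta m) ^ (2 * n)) :: lpoly"
  have "?c * gprod (uvar m n) A \<in> range to_loc" if "coef h A \<noteq> 0" for A
  proof (cases "A \<subseteq> odd_gens m n")
    \<comment> \<open>A monomial with a generator out of range contributes nothing, because
      \<open>uvar\<close> is set to 0 there.\<close>
    case False
    then obtain v where "v \<in> A" "v \<notin> odd_gens m n" by auto
    then have v: "v \<in> A" "uvar m n v = 0" by (simp_all add: uvar_def)
    have "finite A" using that coef_infinite by blast
    moreover have "prod_list (map (uvar m n) xs) = 0" if "v \<in> set xs" for xs
      using that v(2) by (induction xs) auto
    ultimately have "gprod (uvar m n) A = 0" using v(1) by (simp add: gprod_def)
    then show ?thesis using to_loc_zero by (metis mult_zero_right rangeI)
  qed (rule gprod_uvar_polynomial)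
  then have "\<forall>A\<in>{A. coef h A \<noteq> 0}. \<exists>f. ?c * gprod (uvar m n) A = to_loc f" by auto
  then obtain f where f: "\<And>A. coef h A \<noteq> 0 \<Longrightarrow> ?c * gprod (uvar m n) A = to_loc (f A)"
    by (metis (mono_tags) mem_Collect_eq)
  have "?c * gsubst lconst (uvar m n) h = (\<Sum>A | coef h A \<noteq> 0. lconst (coef h A) * (?c * gprod (uvar m n) A))"
    unfolding gsubst_def sum_distrib_left
    by (intro sum.cong refl) (simp add: lconst.c_central [of _ ?c] flip: mult.assoc)
  also have "\<dots> = to_loc (\<Sum>A | coef h A \<noteq> 0. sconst (coef h A) * f A)"
    unfolding to_loc_sum by (intro sum.cong refl) (simp add: f to_loc_hom lconst_def)
  finally show ?thesis by simp
qed

section \<open>The super Pfaffian\<close>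

text \<open>The entries of the matrix Q_0 of the overview, with formal generators in place of u;
  keeping it over the constants makes every later expression in u the image of one with constant
  coefficients.\<close>

definition qform_u :: "nat \<Rightarrow> nat \<Rightarrow> nat \<Rightarrow> nat \<Rightarrow> (gen, complex) grassmann" where
  "qform_u m n a b = (if a = b then 1 else 0) + (\<Sum>\<mu><2 * n. \<Sum>\<nu><2 * n. gtheta (Gen \<mu> a) *
      (gconst (kappa_inv m n $$ (m + \<mu>, m + \<nu>)) * gtheta (Gen \<nu> b)))"

definition detQ_u :: "nat \<Rightarrow> nat \<Rightarrow> (gen, complex) grassmann" where
  "detQ_u m n = sdet m (qform_u m n)"

abbreviation usubst :: "nat \<Rightarrow> nat \<Rightarrow> (gen, complex) grassmann \<Rightarrow> lpoly" where
  "usubst m n \<equiv> gsubst lconst (uvar m n)"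

lemma usubst_qform_u:
  "usubst m n (qform_u m n a b) = (if a = b then 1 else 0) + (\<Sum>\<mu><2 * n. \<Sum>\<nu><2 * n. uvar m n (Gen \<mu> a) *
      (lconst (kappa_inv m n $$ (m + \<mu>, m + \<nu>)) * uvar m n (Gen \<nu> b)))"
  by (simp add: qform_u_def u.gsubst_add u.gsubst_sum u.gsubst_mult u.gsubst_gconst u.gsubst_gtheta
      u.gsubst_one u.gsubst_zero)

lemma gparity_usubst_qform_u: "gparity 0 (usubst m n (qform_u m n a b))"
  unfolding usubst_qform_u lconst_eq
  by (intro gparity_add gparity_sum gparity_mult_odd gparity_gconst_mult gparity_uvar) simp

text \<open>Since \<Theta> = u X, the odd part of Q acquires a factor X on each side just as the
  even part does, and both can be taken out together.\<close>

lemma to_loc_qform: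
  assumes "t < m" "s < m"
  shows "to_loc (qform m n t s) = (\<Sum>a<m. gconst (fr (pvar (Gen a t))) *
    (\<Sum>b<m. usubst m n (qform_u m n a b) * gconst (fr (pvar (Gen b s)))))"
proof -
  let ?x = "\<lambda>a t. gconst (fr (pvar (Gen a t))) :: lpoly"
  let ?k = "\<lambda>\<mu> \<nu>. lconst (kappa_inv m n $$ (m + \<mu>, m + \<nu>))"
  let ?u = "\<lambda>\<mu> a. uvar m n (Gen \<mu> a)"
  have odd: "gtheta (Gen \<mu> t) * (?k \<mu> \<nu> * gtheta (Gen \<nu> s)) =
      (\<Sum>a<m. \<Sum>b<m. ?x a t * (?u \<mu> a * (?k \<mu> \<nu> * ?u \<nu> b) * ?x b s))" if "\<mu> < 2 * n" "\<nu> < 2 * n" for \<mu> \<nu>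
  proof -
    have "?k \<mu> \<nu> * (?x b s * ?u \<nu> b) = ?k \<mu> \<nu> * ?u \<nu> b * ?x b s" for b
      by (simp only: gconst_commute mult.assoc)
    then show ?thesis
      unfolding gtheta_uvar [OF that(1) assms(1)] gtheta_uvar [OF that(2) assms(2)]
      by (simp add: sum_distrib_left sum_distrib_right mult.assoc) (rule sum.swap)
  qed
  have "to_loc (qform m n t s) = (\<Sum>a<m. ?x a t * ?x a s) +
      (\<Sum>\<mu><2 * n. \<Sum>\<nu><2 * n. gtheta (Gen \<mu> t) * (?k \<mu> \<nu> * gtheta (Gen \<nu> s)))"
    by (simp add: qform_split to_loc_hom to_loc_sum to_loc_gconst to_loc_gtheta gconst_mult fr.hom_mult
        lconst_def)
  also have "(\<Sum>\<mu><2 * n. \<Sum>\<nu><2 * n. gtheta (Gen \<mu> t) * (?k \<mu> \<nu> * gtheta (Gen \<nu> s))) =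
      (\<Sum>\<mu><2 * n. \<Sum>\<nu><2 * n. \<Sum>a<m. \<Sum>b<m. ?x a t * (?u \<mu> a * (?k \<mu> \<nu> * ?u \<nu> b) * ?x b s))"
    by (intro sum.cong refl odd) auto
  also have "\<dots> = (\<Sum>a<m. \<Sum>b<m. \<Sum>\<mu><2 * n. \<Sum>\<nu><2 * n. ?x a t * (?u \<mu> a * (?k \<mu> \<nu> * ?u \<nu> b) * ?x b s))"
    by (simp only: sum.swap [of _ "{..<m}" "{..<2 * n}"])
  also have "\<dots> = (\<Sum>a<m. \<Sum>b<m. ?x a t * ((\<Sum>\<mu><2 * n. \<Sum>\<nu><2 * n. ?u \<mu> a * (?k \<mu> \<nu> * ?u \<nu> b)) * ?x b s))"
    by (simp only: sum_distrib_left sum_distrib_right)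
  also have "(\<Sum>a<m. ?x a t * ?x a s) = (\<Sum>a<m. \<Sum>b<m. ?x a t * ((if a = b then 1 else 0) * ?x b s))"
  proof (rule sum.cong [OF refl])
    fix a assume "a \<in> {..<m}"
    have "(\<Sum>b<m. ?x a t * ((if a = b then 1 else 0) * ?x b s)) = (\<Sum>b<m. if b = a then ?x a t * ?x a s else 0)"
      by (intro sum.cong) auto
    then show "?x a t * ?x a s = (\<Sum>b<m. ?x a t * ((if a = b then 1 else 0) * ?x b s))"
      using \<open>a \<in> {..<m}\<close> by simp
  qed
  finally show ?thesis
    unfolding usubst_qform_u sum_distrib_left
    by (simp only: sum.distrib [symmetric] distrib_left [symmetric] distrib_right [symmetric])
qed

lemma to_loc_detQ: "to_loc (detQ m n) = gconst (fr (Delta m) ^ 2) * usubst m n (detQ_u m n)"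
proof -
  let ?x = "\<lambda>a t. gconst (fr (pvar (Gen a t))) :: lpoly"
  let ?q = "\<lambda>a b. usubst m n (qform_u m n a b)"
  have x: "sdet m (\<lambda>b s. ?x b s) = gconst (fr (Delta m))"
  proof -
    have "mat m m (\<lambda>(b, s). fr (pvar (Gen b s))) = map_mat fr (gmat m)" by (intro eq_matI) auto
    then show ?thesis by (simp only: sdet_gconst fr_Delta)
  qed
  have xT: "sdet m (\<lambda>t a. ?x a t) = gconst (fr (Delta m))"
  proof -
    have "mat m m (\<lambda>(t, a). fr (pvar (Gen a t))) = (map_mat fr (gmat m))\<^sup>T" by (intro eq_matI) auto
    then show ?thesis using det_transpose [of "map_mat fr (gmat m)" m] by (simp only: sdet_gconst fr_Delta) simp
  qed
  have "to_loc (detQ m n) = sdet m (\<lambda>t s. to_loc (qform m n t s))"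
    unfolding detQ_def by (rule sdet_hom) (rule to_loc_hom)+
  also have "\<dots> = sdet m (\<lambda>t s. \<Sum>a<m. ?x a t * (\<Sum>b<m. ?q a b * ?x b s))"
    by (rule sdet_cong) (rule to_loc_qform)
  also have "\<dots> = sdet m (\<lambda>t a. ?x a t) * sdet m (\<lambda>a s. \<Sum>b<m. ?q a b * ?x b s)"
    by (rule sdet_mult) (auto intro!: gparity_sum gparity_mult_even gparity_usubst_qform_u)
  also have "sdet m (\<lambda>a s. \<Sum>b<m. ?q a b * ?x b s) = sdet m ?q * sdet m (\<lambda>b s. ?x b s)"
    by (rule sdet_mult) (auto intro!: gparity_usubst_qform_u)
  also have "sdet m ?q = usubst m n (detQ_u m n)"
    unfolding detQ_u_def by (rule sdet_hom [symmetric]) (rule u.gsubst_add u.gsubst_mult u.gsubst_one)+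
  finally show ?thesis
    unfolding x xT power2_eq_square gconst_mult
    by (simp only: mult.assoc gconst_commute [of _ "usubst m n (detQ_u m n)"])
qed

lemma zeta_frac_eq: "zeta_frac m n = usubst m n (detQ_u m n - 1)"
  and to_loc_detQ_zeta: "to_loc (detQ m n) = gconst (fr (Delta m)) ^ 2 * (1 + zeta_frac m n)"
proof -
  let ?D = "fr (Delta m) ^ 2" and ?i = "Fract 1 (Delta m ^ 2)"
  have D: "fr (Delta m ^ 2) = ?D" by (rule fr.hom_power)
  have inv: "?D * ?i = 1"
    unfolding D [symmetric] unfolding fr_def using Delta_nonzero [of m] by (simp add: One_fract_def eq_fract)
  have "to_loc (zeta m n) = gconst ?D * usubst m n (detQ_u m n) - gconst ?D"
    unfolding zeta_def to_loc_minus to_loc_detQ by (simp only: gconst_power [symmetric] to_loc_gconst D)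
  also have "\<dots> = usubst m n (detQ_u m n - 1) * gconst ?D"
    by (simp only: u.gsubst_minus u.gsubst_one left_diff_distrib mult_1_left gconst_commute [of ?D "usubst m n (detQ_u m n)"])
  finally have "zeta_frac m n = usubst m n (detQ_u m n - 1) * gconst (?D * ?i)"
    unfolding zeta_frac_def by (simp only: gconst_mult mult.assoc)
  then show *: "zeta_frac m n = usubst m n (detQ_u m n - 1)" by (simp only: inv gconst_one mult_1_right)
  show "to_loc (detQ m n) = gconst (fr (Delta m)) ^ 2 * (1 + zeta_frac m n)"
    unfolding * u.gsubst_minus u.gsubst_one to_loc_detQ gconst_power by simp
qed

section \<open>The square root series and the Pfaffian\<close>

lemma coef_zeta_frac_empty: "coef (zeta_frac m n) {} = 0"
  by (simp add: zeta_frac_def coef_to_loc zeta_def coef_detQ_empty coef_gconst)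

text \<open>The defining sum runs over the exponents with nonzero power. By nilpotency these are
  bounded, and adding the vanishing terms gives an initial segment, to which
  \<open>sqrt_series_square\<close> applies.\<close>

lemma Fsqrt_eq: "\<exists>N. zeta_frac m n ^ N = 0 \<and> Fsqrt m n = (\<Sum>k<N. lconst ((1 / 2) gchoose k) * zeta_frac m n ^ k)"
proof -
  let ?z = "zeta_frac m n"
  let ?f = "\<lambda>k. lconst ((1 / 2) gchoose k) * ?z ^ k"
  obtain N where N: "\<And>k. k \<ge> N \<Longrightarrow> ?z ^ k = 0"
    using grassmann_nilpotent [OF coef_zeta_frac_empty [of m n]] by auto
  have b: "1 / fact k * (\<Prod>j = 0..<k. 1 / 2 - of_nat j) = (1 / 2 gchoose k :: complex)" for k
    by (simp add: gbinomial_prod_rev)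
  have "k < Suc N" if "?z ^ k \<noteq> 0" for k
    using that N [of k] by (cases "N \<le> k") auto
  then have sub: "{k. 1 \<le> k \<and> ?z ^ k \<noteq> 0} \<subseteq> {1..<Suc N}" by auto
  have "Fsqrt m n = 1 + (\<Sum>k | 1 \<le> k \<and> ?z ^ k \<noteq> 0. ?f k)"
    unfolding Fsqrt_def by (simp only: b)
  also have "(\<Sum>k | 1 \<le> k \<and> ?z ^ k \<noteq> 0. ?f k) = (\<Sum>k\<in>{1..<Suc N}. ?f k)"
    by (rule sum.mono_neutral_left) (use sub in auto)
  also have "1 + (\<Sum>k\<in>{1..<Suc N}. ?f k) = (\<Sum>k<Suc N. ?f k)"
  proof -
    have "{..<Suc N} = insert 0 {1..<Suc N}" by auto
    then show ?thesis by (simp only:) (subst sum.insert, auto simp: lconst.c_one)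
  qed
  \<comment> \<open>The bound is \<open>Suc N\<close> because the range has to contain k = 0, the
    summand 1 of the definition, even when N = 0.\<close>
  finally show ?thesis using N [of "Suc N"] by (intro exI [of _ "Suc N"]) simp
qed

lemma Fsqrt_square: "Fsqrt m n ^ 2 = 1 + zeta_frac m n"
proof -
  obtain N where N: "zeta_frac m n ^ N = 0"
    and F: "Fsqrt m n = (\<Sum>k<N. lconst ((1 / 2) gchoose k) * zeta_frac m n ^ k)"
    using Fsqrt_eq by blast
  show ?thesis
    unfolding F by (rule sqrt_series_square [OF lconst.c_add lconst.c_mult lconst.c_one lconst.c_central N])
qed

lemma coef_Fsqrt_empty: "coef (Fsqrt m n) {} = 1"
  by (simp add: Fsqrt_def coef_one coef_sum coef_zeta_frac_empty power_0_left)

lemma gparity_zeta_frac: "gparity 0 (zeta_frac m n)"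
  unfolding zeta_frac_def zeta_def
  by (intro gparity_mult_even gparity_gconst)
    (simp add: gparity_to_loc gparity_minus gparity_detQ gparity_power)

lemma gparity_Fsqrt: "gparity 0 (Fsqrt m n)"
  unfolding Fsqrt_def lconst_eq
  by (intro gparity_add gparity_sum gparity_gconst_mult gparity_power gparity_zeta_frac gparity_one)

text \<open>F is a truncated power series in zeta/Delta^2, which depends on u alone, so it comes
  from constant coefficients. The n factors det Q then supply the power of \<open>Delta\<close>
  demanded by \<open>uvar_subst_polynomial\<close>; the remaining factor \<open>Delta\<close> is
  polynomial anyway.\<close>

lemma super_Pfaffian_polynomial: "super_Pfaffian m n \<in> range to_loc"
proof -
  obtain N where F: "Fsqrt m n = (\<Sum>k<N. lconst ((1 / 2) gchoose k) * zeta_frac m n ^ k)"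
    using Fsqrt_eq by blast
  define f where "f = (\<Sum>k<N. gconst ((1 / 2) gchoose k) * (detQ_u m n - 1) ^ k)"
  have Ff: "Fsqrt m n = usubst m n f"
    by (simp add: F f_def zeta_frac_eq u.gsubst_sum u.gsubst_mult u.gsubst_gconst u.gsubst_power)
  have pow: "(gconst c * g) ^ k = gconst (c ^ k) * g ^ k" for c k and g :: lpoly
    by (induction k) (simp_all add: gconst_mult gconst_left_commute [of g] mult.assoc)
  have "super_Pfaffian m n = gconst (fr (Delta m)) * usubst m n f *
      (gconst ((fr (Delta m) ^ 2) ^ n) * usubst m n (detQ_u m n) ^ n)"
    unfolding super_Pfaffian_def Ff to_loc_detQ to_loc_gconst pow ..
  also have "\<dots> = gconst (fr (Delta m)) * (gconst (fr (Delta m) ^ (2 * n)) * usubst m n (f * detQ_u m n ^ n))"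
    by (simp only: u.gsubst_mult u.gsubst_power power_mult [symmetric] mult.assoc
        gconst_left_commute [of "usubst m n f"])
  finally have *: "super_Pfaffian m n =
      to_loc (gconst (Delta m)) * (gconst (fr (Delta m) ^ (2 * n)) * usubst m n (f * detQ_u m n ^ n))"
    by (simp only: to_loc_gconst)
  obtain h where "gconst (fr (Delta m) ^ (2 * n)) * usubst m n (f * detQ_u m n ^ n) = to_loc h"
    using uvar_subst_polynomial [of m n "f * detQ_u m n ^ n"] by auto
  then have "super_Pfaffian m n = to_loc (gconst (Delta m) * h)"
    by (simp only: * to_loc_hom)
  then show ?thesis by simp
qed

text \<open>The square of \<open>Delta\<close> times F is det Q, and all factors are even, so the
  rearrangement can be done in the commutative ring \<open>geven\<close>.\<close>

lemma super_Pfaffian_square: "super_Pfaffian m n * super_Pfaffian m n = to_loc (detQ m n) ^ (2 * n + 1)"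
proof -
  define D F T where "D = (Abs_geven (gconst (fr (Delta m))) :: (gen, cpoly fract) geven)"
    and "F = Abs_geven (Fsqrt m n)" and "T = Abs_geven (to_loc (detQ m n))"
  have rep: "of_geven D = gconst (fr (Delta m))" "of_geven F = Fsqrt m n" "of_geven T = to_loc (detQ m n)"
    by (simp_all add: D_def F_def T_def of_geven_Abs gparity_Fsqrt gparity_to_loc gparity_detQ)
  have "T = D ^ 2 * F ^ 2"
    by (simp only: of_geven_inject [symmetric] times_geven.rep_eq of_geven_power rep Fsqrt_square to_loc_detQ_zeta)
  have "D * F * T ^ n * (D * F * T ^ n) = (D ^ 2 * F ^ 2) * T ^ (2 * n)"
    unfolding mult_2 power_add by (simp add: power2_eq_square mult_ac)
  also have "\<dots> = T ^ (2 * n + 1)" by (simp flip: \<open>T = D ^ 2 * F ^ 2\<close>)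
  finally have "D * F * T ^ n * (D * F * T ^ n) = T ^ (2 * n + 1)" .
  from arg_cong [OF this, of of_geven] show ?thesis
    by (simp only: times_geven.rep_eq of_geven_power rep super_Pfaffian_def to_loc_gconst)
qed

text \<open>Parity, square and leading term are read off in the localisation and pulled back along
  the injective map \<open>to_loc\<close>.\<close>

lemma super_Pfaffian_root:
  assumes \<Omega>: "to_loc \<Omega> = super_Pfaffian m n"
  shows "detQ_root m n \<Omega>"
proof
  have "gparity 0 (super_Pfaffian m n)"
    unfolding super_Pfaffian_def to_loc_gconst
    by (intro gparity_mult_even gparity_gconst gparity_Fsqrt gparity_power)
      (simp add: gparity_to_loc gparity_detQ)
  then show "gparity 0 \<Omega>" by (simp add: \<Omega> [symmetric] gparity_to_loc)
  have "to_loc (\<Omega> * \<Omega>) = to_loc (detQ m n ^ (2 * n + 1))"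
    by (simp only: to_loc_hom to_loc_power \<Omega> super_Pfaffian_square)
  then show "\<Omega> * \<Omega> = detQ m n ^ (2 * n + 1)" using inj_to_loc by (rule injD [rotated])
  have "fr (coef \<Omega> {}) = fr (Delta m) * fr (Delta m ^ 2) ^ n"
    unfolding coef_to_loc [symmetric] \<Omega> super_Pfaffian_def
    by (simp only: coef_times_empty coef_power_empty coef_Fsqrt_empty coef_detQ_empty coef_to_loc coef_gconst
        if_True simp_thms mult_1_right)
  also have "\<dots> = fr (Delta m ^ (2 * n + 1))"
    by (simp only: fr.hom_mult [symmetric] fr.hom_power [symmetric] power_mult [symmetric] power_add power_one_right mult.commute)
  finally have "fr (coef \<Omega> {}) = fr (Delta m ^ (2 * n + 1))" .
  then show "coef \<Omega> {} = Delta m ^ (2 * n + 1)" by (simp only: fr_inject)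
qed

theorem theorem3p5:
  fixes m n :: nat
  assumes "m \<ge> 1"
  shows "\<exists>\<Omega>. to_loc \<Omega> = super_Pfaffian m n
    \<and> \<Omega> \<in> osp_invariants m n
    \<and> seven \<Omega>
    \<and> shomogeneous (m * (2 * n + 1)) \<Omega>
    \<and> leading_term \<Omega> = Delta m ^ (2 * n + 1)
    \<and> (\<forall>g \<in> OSp0 m n. group_act m n g \<Omega> = sconst (det g) * \<Omega>)
    \<and> pseudo_invariant m n \<Omega>"
proof -
  obtain \<Omega> where \<Omega>: "to_loc \<Omega> = super_Pfaffian m n"
    using super_Pfaffian_polynomial [of m n] by auto
  interpret detQ_root m n \<Omega> by (rule super_Pfaffian_root [OF \<Omega>])
  show ?thesis
    using \<Omega> in_osp_invariants even homogeneous leading group_act pseudo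
    by (intro exI [of _ \<Omega>]) (simp add: seven_def sparity_iff_gparity leading_term_def)
qed

end
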